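(* Let $d\ge3$ and $\lambda>0$. For every integer $L>0$ there exists a constant $c>0$, depending only on $L$ and the dimension $d$ (and on the fixed parameter $\lambda$), such that for every finite subset $W\subset\mathbb{Z}^{d+1}$ with at least two and at most $L$ vertices, $$\mathsf{USF}(\mathscr{C}_W)\le c\,\langle W\rangle_\eta^{-(d-2)},$$ where $\mathscr{C}_W$ is the event that all points of $W$ lie in the same connected component of the uniform spanning forest of $\Gamma_d(\lambda)$.
   Context: $\Gamma_d(\lambda)$ is the nearest-neighbour lattice graph on $\mathbb{Z}^{d+1}=\mathbb{Z}\times\mathbb{Z}^d$ with conductance $\mu((n,x),(n',x'))=e^{\lambda\max(n,n')}$ on each edge $(n,x)\sim(n',x')$. On a finite connected network, the uniform spanning tree is the random spanning tree whose probability of being $t$ is proportional to the product of the conductances of the edges of $t$. On an infinite network, take an exhaustion by finite connected vertex sets $V_q$. The free spanning forest measure $\mathsf{FSF}$ is the weak limit of the uniform spanning tree measures of the networks induced on $V_q$; the wired spanning forest measure $\mathsf{WSF}$ is the weak limit of the uniform spanning tree measures of the networks obtained from $V_q$ by identifying (wiring) all vertices of its exterior boundary into a single vertex. On $\Gamma_d(\lambda)$ one has $\mathsf{WSF}=\mathsf{FSF}$, and this common measure is denoted $\mathsf{USF}$. For $z=(n,x)\in\mathbb{Z}\times\mathbb{Z}^d$, $\eta(z)=\max(|n|^{1/2},\|x\|)$ with $\|\cdot\|$ Euclidean, and $\langle z\rangle_\eta=\max(1,\eta(z))$. For a finite set $W$ with two or more vertices, its spread is $\langle W\rangle_\eta=\min_E\prod_{\{z,z'\}\in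 E}\langle z-z'\rangle_\eta$, the minimum over all edge sets $E$ making $(W,E)$ an undirected tree on the vertex set $W$. *)

theory Defs
  imports "HOL-Probability.Probability" "HOL-Library.Uprod"
begin

section \<open>Weighted multigraphs and trees\<close>

text \<open>
  Edges are unoriented, and parallel edges and loops are allowed because wiring produces them.
  The notion of a tree in Graph_Theory is not usable here: it only excludes directed cycles.
\<close>

record ('v, 'e) network =
  Verts :: "'v set"
  Edges :: "'e set"
  Ends :: "'e \<Rightarrow> 'v uprod"
  Cond :: "'e \<Rightarrow> real"

definition adjacency :: "('e \<Rightarrow> 'v uprod) \<Rightarrow> 'e set \<Rightarrow> 'v rel" where
  "adjacency ends T = {(x, y). \<exists>e\<in>T. ends e = Upair x y}"

definition joins :: "('e \<Rightarrow> 'v uprod) \<Rightarrow> 'e set \<Rightarrow> 'v set \<Rightarrow> bool" where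
  "joins ends T W \<longleftrightarrow> (\<forall>x\<in>W. \<forall>y\<in>W. (x, y) \<in> (adjacency ends T)\<^sup>*)"

text \<open>A loop is a cycle of length 1, and two parallel edges form a cycle of length 2.\<close>

definition is_cycle :: "('e \<Rightarrow> 'v uprod) \<Rightarrow> 'e set \<Rightarrow> 'v list \<Rightarrow> 'e list \<Rightarrow> bool" where
  "is_cycle ends T vs es \<longleftrightarrow>
     es \<noteq> [] \<and> length vs = length es \<and> distinct vs \<and> distinct es \<and> set es \<subseteq> T \<and>
     (\<forall>i<length es. ends (es ! i) = Upair (vs ! i) (vs ! (Suc i mod length es)))"

definition is_tree :: "'v set \<Rightarrow> ('e \<Rightarrow> 'v uprod) \<Rightarrow> 'e set \<Rightarrow> bool" where
  "is_tree U ends T \<longleftrightarrow>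
     (\<forall>e\<in>T. set_uprod (ends e) \<subseteq> U) \<and> joins ends T U \<and> (\<nexists>vs es. is_cycle ends T vs es)"

definition spanning_trees :: "('v, 'e) network \<Rightarrow> 'e set set" where
  "spanning_trees N = {T. T \<subseteq> Edges N \<and> is_tree (Verts N) (Ends N) T}"

section \<open>Uniform spanning trees and their infinite-volume limits\<close>

definition tree_weight :: "('v, 'e) network \<Rightarrow> 'e set \<Rightarrow> real" where
  "tree_weight N T = (if T \<in> spanning_trees N then \<Prod>e\<in>T. Cond N e else 0)"

definition ust :: "('v, 'e) network \<Rightarrow> 'e set pmf" where
  "ust N = embed_pmf (\<lambda>T. tree_weight N T / (\<Sum>T'\<in>spanning_trees N. tree_weight N T'))"

text \<open>
  Edge configurations are elements of \<open>'e \<Rightarrow> bool\<close> with the product topology.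
\<close>

definition ust_measure :: "('v, 'e) network \<Rightarrow> ('e \<Rightarrow> bool) measure" where
  "ust_measure N = distr (measure_pmf (ust N)) borel (\<lambda>T e. e \<in> T)"

definition weak_limit :: "(nat \<Rightarrow> 'a::topological_space measure) \<Rightarrow> 'a measure \<Rightarrow> bool" where
  "weak_limit Ms M \<longleftrightarrow>
     prob_space M \<and> sets M = sets borel \<and>
     (\<forall>f::'a \<Rightarrow> real. continuous_on UNIV f \<and> bounded (range f) \<longrightarrow>
        (\<lambda>q. integral\<^sup>L (Ms q) f) \<longlonglongrightarrow> integral\<^sup>L M f)"

definition induced :: "('v, 'e) network \<Rightarrow> 'v set \<Rightarrow> ('v, 'e) network" where
  "induced N V = N\<lparr>Verts := V, Edges := {e \<in> Edges N. set_uprod (Ends N e) \<subseteq> V}\<rparr>"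

text \<open>
  The exterior boundary of \<open>V\<close> becomes the single vertex \<open>None\<close>. Edges keep their identity as
  edges of \<open>N\<close>; those between two boundary vertices would be loops at \<open>None\<close>, lie in no spanning
  tree, and are left out.
\<close>

definition wired :: "('v, 'e) network \<Rightarrow> 'v set \<Rightarrow> ('v option, 'e) network" where
  "wired N V =
     \<lparr>Verts = insert None (Some ` V),
      Edges = {e \<in> Edges N. set_uprod (Ends N e) \<inter> V \<noteq> {}},
      Ends = (\<lambda>e. map_uprod (\<lambda>x. if x \<in> V then Some x else None) (Ends N e)),
      Cond = Cond N\<rparr>"

definition exhaustion :: "('v, 'e) network \<Rightarrow> (nat \<Rightarrow> 'v set) \<Rightarrow> bool" where
  "exhaustion N V \<longleftrightarrow>
     (\<forall>q. finite (V q) \<and> V q \<noteq> {} \<and> V q \<subseteq> V (Suc q) \<and>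
          joins (Ends N) (Edges (induced N (V q))) (V q)) \<and>
     (\<Union>q. V q) = Verts N"

definition free_spanning_forest :: "('v, 'e) network \<Rightarrow> ('e \<Rightarrow> bool) measure" where
  "free_spanning_forest N =
     (THE M. \<forall>V. exhaustion N V \<longrightarrow> weak_limit (\<lambda>q. ust_measure (induced N (V q))) M)"

definition wired_spanning_forest :: "('v, 'e) network \<Rightarrow> ('e \<Rightarrow> bool) measure" where
  "wired_spanning_forest N =
     (THE M. \<forall>V. exhaustion N V \<longrightarrow> weak_limit (\<lambda>q. ust_measure (wired N (V q))) M)"

section \<open>The network on the lattice\<close>

text \<open>The dimension \<open>d\<close> is \<open>CARD('d)\<close>.\<close>

type_synonym 'd site = "int \<times> (int ^ 'd)"

definition neighbours :: "'d::finite site \<Rightarrow> 'd site \<Rightarrow> bool" where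
  "neighbours z z' \<longleftrightarrow> \<bar>fst z - fst z'\<bar> + (\<Sum>i\<in>UNIV. \<bar>snd z $ i - snd z' $ i\<bar>) = 1"

lift_definition conductance :: "real \<Rightarrow> ('d::finite site, real) commute" is
  "\<lambda>lam z z'. exp (lam * real_of_int (max (fst z) (fst z')))"
  by (simp add: max.commute)

definition lattice_network :: "real \<Rightarrow> ('d::finite site, 'd site uprod) network" where
  "lattice_network lam =
     \<lparr>Verts = UNIV, Edges = {Upair z z' | z z'. neighbours z z'}, Ends = (\<lambda>e. e),
      Cond = case_uprod (conductance lam)\<rparr>"

text \<open>On this network the free and the wired spanning forest measures coincide.\<close>

definition USF :: "real \<Rightarrow> ('d::finite site uprod \<Rightarrow> bool) measure" where
  "USF lam = wired_spanning_forest (lattice_network lam)"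

definition same_component :: "'v set \<Rightarrow> ('v uprod \<Rightarrow> bool) set" where
  "same_component W = {\<omega>. joins (\<lambda>e. e) {e. \<omega> e} W}"

section \<open>Spread\<close>

definition eta :: "'d::finite site \<Rightarrow> real" where
  "eta z = max (sqrt \<bar>real_of_int (fst z)\<bar>) (norm (\<chi> i. real_of_int (snd z $ i)))"

definition eta_bracket :: "'d::finite site \<Rightarrow> real" where
  "eta_bracket z = max 1 (eta z)"

lift_definition eta_bracket_diff :: "('d::finite site, real) commute" is
  "\<lambda>z z'. eta_bracket (z - z')"
proof -
  fix z z' :: "'d site"
  have "(\<chi> i. real_of_int (snd (z - z') $ i)) = - (\<chi> i. real_of_int (snd (z' - z) $ i))"
    by (simp add: vec_eq_iff)
  then have "norm (\<chi> i. real_of_int (snd (z - z') $ i)) = norm (\<chi> i. real_of_int (snd (z' - z) $ i))"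
    by (metis norm_minus_cancel)
  then show "eta_bracket (z - z') = eta_bracket (z' - z)"
    by (simp add: eta_bracket_def eta_def abs_minus_commute)
qed

definition spread :: "'d::finite site set \<Rightarrow> real" where
  "spread W =
     Min ((\<lambda>E. \<Prod>e\<in>E. case_uprod eta_bracket_diff e) ` {E. is_tree W (\<lambda>e. e) E})"

end

theory Submission
  imports Defs
begin

text \<open>
  Orienting the edges of a spanning tree of the wired network on a finite set \<open>V\<close> towards the
  boundary turns it into a function on \<open>V\<close> that sends each vertex to a neighbour and all of
  whose orbits leave \<open>V\<close>. Exchanging the out-edge at \<open>x\<close> shows that the probability that
  the path from \<open>x\<close> leads to a given root is harmonic in \<open>x\<close> off the roots. By the maximum
  principle it is dominated by any nonnegative superharmonic
  function which is at least 1 at that root. The Green function of the network walk serves (the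
  walk is made lazy to allow for periodicity): its upward steps are \<open>exp \<lambda>\<close> times as likely as its
  downward steps, so that its vertical displacement is comparable to the number of steps and the
  Green function decays like \<open>\<langle>z\<rangle>\<^sup>-\<^sup>d\<close>.

  If all points of \<open>W\<close> lie in one tree, their paths have a last common ancestor \<open>z\<close>, which
  splits \<open>W\<close> into two parts whose paths meet only at \<open>z\<close>. Revealing the path from \<open>z\<close> and then
  the paths from the first part leaves a weighted forest on the complement, so the probabilities
  factorize. Summing over \<open>z\<close> gives the spread by induction on the size of \<open>W\<close>, because joining
  trees on the two parts by one edge gives a tree on \<open>W\<close>.

  The infinite-volume limit exists since, when the out-edges of finitely many vertices are exposed
  from the lowest to the highest, their probabilities are governed by hitting probabilities, which
  are monotone in \<open>V\<close> and stay away from 1 on account of the drift.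
\<close>

section \<open>Trees and bridges\<close>

text \<open>Every estimate must hold uniformly over all finite \<open>V\<close>, not only along an
  exhaustion: revealing paths replaces \<open>V\<close> by a rather arbitrary subset, with the
  revealed vertices as new roots. This is why hitting probabilities are compared with one function
  that is superharmonic everywhere. The exponents come from parabolic scaling. A ball of radius R
  holds at most of order R^(d+2) points and the Green function is at most of order R^(-d), so
  summing over the meeting point of two paths started at distance R gives R^(d+2-2d) = R^(2-d). The
  induction on \<open>W\<close> needs a version with a prescribed root r. Its bound carries the sum
  over w in \<open>W\<close> of the kernel F(w, r), not the product, because after the paths have
  merged only one of them still has to reach r. The definition of the forest measure asks for one
  limit common to all exhaustions, so convergence is proved along the net of all finite vertex sets.
  Lying in one component is not a local event; the bound passes to the limit for connections inside
  a finite set of edges, and then by continuity from below.\<close>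

lemma adjacency_sym: "(x, y) \<in> adjacency ends T \<longleftrightarrow> (y, x) \<in> adjacency ends T"
  by (auto simp: adjacency_def) (metis Upair_inject)+

lemma sym_adjacency_rtrancl: "sym ((adjacency ends T)\<^sup>*)"
  by (intro sym_rtrancl symI) (simp add: adjacency_sym)

lemma adjacency_mono: "T \<subseteq> T' \<Longrightarrow> adjacency ends T \<subseteq> adjacency ends T'"
  by (auto simp: adjacency_def)

text \<open>Loop erasure during the induction: if the new first vertex already lies on the path,
  everything before its occurrence is dropped.\<close>

lemma simple_path_exists:
  assumes "(a, b) \<in> (adjacency ends T)\<^sup>*"
  shows "\<exists>vs es. distinct vs \<and> length vs = Suc (length es) \<and> hd vs = a \<and> last vs = b \<and> set es \<subseteq> T \<and>
           (\<forall>i<length es. ends (es ! i) = Upair (vs ! i) (vs ! Suc i))"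
  using assms
proof (induction rule: converse_rtrancl_induct)
  case base
  show ?case by (rule exI[of _ "[b]"], rule exI[of _ "[]"]) auto
next
  case (step a c)
  then obtain vs es where p: "distinct vs" "length vs = Suc (length es)" "hd vs = c" "last vs = b"
    "set es \<subseteq> T" "\<And>i. i < length es \<Longrightarrow> ends (es ! i) = Upair (vs ! i) (vs ! Suc i)" by blast
  obtain e where e: "e \<in> T" "ends e = Upair a c" using step(1) by (auto simp: adjacency_def)
  have ne: "vs \<noteq> []" using p(2) by auto
  show ?case
  proof (cases "a \<in> set vs")
    case False
    have "\<forall>i<length (e # es). ends ((e # es) ! i) = Upair ((a # vs) ! i) ((a # vs) ! Suc i)"
      using e p(3,6) ne by (auto simp: nth_Cons hd_conv_nth split: nat.splits)
    then show ?thesis using False p e ne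
      by (intro exI[of _ "a # vs"] exI[of _ "e # es"]) auto
  next
    case True
    then obtain k where k: "k < length vs" "vs ! k = a" by (auto simp: in_set_conv_nth)
    have "\<forall>i<length (drop k es). ends (drop k es ! i) = Upair (drop k vs ! i) (drop k vs ! Suc i)"
      using p(2,6) k by auto
    then show ?thesis using p k
      by (intro exI[of _ "drop k vs"] exI[of _ "drop k es"])
        (auto simp: hd_drop_conv_nth last_drop dest: in_set_dropD)
  qed
qed

text \<open>A simple path between the endpoints of \<open>e\<close> that avoids \<open>e\<close> is
  closed up by \<open>e\<close>. Loops are covered: for \<open>a = b\<close> the path is a single
  vertex and the cycle has length 1.\<close>

lemma nonbridge_cycle:
  assumes "e \<in> T" "ends e = Upair a b" "(a, b) \<in> (adjacency ends (T - {e}))\<^sup>*"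
  shows "\<exists>vs es. is_cycle ends T vs es"
proof -
  obtain vs es where p: "distinct vs" "length vs = Suc (length es)" "hd vs = a" "last vs = b"
    "set es \<subseteq> T - {e}" "\<And>i. i < length es \<Longrightarrow> ends (es ! i) = Upair (vs ! i) (vs ! Suc i)"
    using simple_path_exists[OF assms(3)] by blast
  have ne: "vs \<noteq> []" using p(2) by auto
  have "distinct es"
    unfolding distinct_conv_nth
  proof (intro allI impI notI)
    fix i j assume ij: "i < length es" "j < length es" "i \<noteq> j" "es ! i = es ! j"
    then have "Upair (vs ! i) (vs ! Suc i) = Upair (vs ! j) (vs ! Suc j)" using p(6) by metis
    then show False using ij p(1,2) by (auto simp: nth_eq_iff_index_eq)
  qed
  moreover have "ends ((es @ [e]) ! i) = Upair (vs ! i) (vs ! (Suc i mod length (es @ [e])))"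
    if "i < length (es @ [e])" for i
  proof (cases "i < length es")
    case True then show ?thesis using p(6)[OF True] by (simp add: nth_append)
  next
    case False
    then have "i = length es" using that by simp
    then show ?thesis using assms(2) p(2,3,4) ne by (auto simp: hd_conv_nth last_conv_nth)
  qed
  ultimately show ?thesis using p assms(1)
    by (intro exI[of _ vs] exI[of _ "es @ [e]"]) (auto simp: is_cycle_def)
qed

lemma cycle_nonbridge:
  assumes "is_cycle ends T vs es"
  shows "\<exists>e\<in>T. \<exists>a b. ends e = Upair a b \<and> (a, b) \<in> (adjacency ends (T - {e}))\<^sup>*"
proof -
  from assms have c: "es \<noteq> []" "length vs = length es" "distinct es" "set es \<subseteq> T"
    "\<And>i. i < length es \<Longrightarrow> ends (es ! i) = Upair (vs ! i) (vs ! (Suc i mod length es))"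
    by (auto simp: is_cycle_def)
  define m where "m = length es - 1"
  have m: "m < length es" "Suc m = length es" using c(1) by (auto simp: m_def)
  have "i \<le> m \<Longrightarrow> (vs ! 0, vs ! i) \<in> (adjacency ends (T - {es ! m}))\<^sup>*" for i
  proof (induction i)
    case (Suc i)
    have "es ! i \<noteq> es ! m" using c(3) Suc.prems m by (auto simp: nth_eq_iff_index_eq)
    moreover have "es ! i \<in> T" using c(4) Suc.prems m by auto
    moreover have "ends (es ! i) = Upair (vs ! i) (vs ! Suc i)" using c(5)[of i] Suc.prems m by simp
    ultimately have "(vs ! i, vs ! Suc i) \<in> adjacency ends (T - {es ! m})"
      by (auto simp: adjacency_def)
    then show ?case using Suc by (auto intro: rtrancl_into_rtrancl)
  qed simp
  from this[of m] have "(vs ! 0, vs ! m) \<in> (adjacency ends (T - {es ! m}))\<^sup>*" by simp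
  moreover have "ends (es ! m) = Upair (vs ! 0) (vs ! m)" using c(5)[of m] m by auto
  moreover have "es ! m \<in> T" using c(4) m by auto
  ultimately show ?thesis by blast
qed

text \<open>Acyclicity as a property of single edges, so that the later arguments on joining,
  contracting and orienting trees can work with reachability instead of lists.\<close>

lemma is_tree_iff_bridges:
  "is_tree U ends T \<longleftrightarrow> (\<forall>e\<in>T. set_uprod (ends e) \<subseteq> U) \<and> joins ends T U \<and>
     (\<forall>e\<in>T. \<forall>a b. ends e = Upair a b \<longrightarrow> (a, b) \<notin> (adjacency ends (T - {e}))\<^sup>*)"
  unfolding is_tree_def using nonbridge_cycle cycle_nonbridge by metis

section \<open>Spread\<close>

lemma is_tree_edge:
  "is_tree W (\<lambda>e. e) E \<Longrightarrow> Upair a b \<in> E \<Longrightarrow> a \<in> W \<and> b \<in> W"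
  unfolding is_tree_def by (metis insert_subset set_uprod_simps)

lemma is_tree_insert_bridge:
  assumes T1: "is_tree W1 (\<lambda>e. e) E1" and T2: "is_tree W2 (\<lambda>e. e) E2"
    and disj: "W1 \<inter> W2 = {}" and w: "w1 \<in> W1" "w2 \<in> W2"
  shows "is_tree (W1 \<union> W2) (\<lambda>e. e) (insert (Upair w1 w2) (E1 \<union> E2))"
proof -
  let ?b = "Upair w1 w2" let ?T = "insert ?b (E1 \<union> E2)"
  let ?A = "\<lambda>T. adjacency (\<lambda>e. e) T"
  have s1: "\<And>x y. (x, y) \<in> ?A E1 \<Longrightarrow> x \<in> W1 \<and> y \<in> W1"
    using T1 by (fastforce simp: is_tree_def adjacency_def)
  have s2: "\<And>x y. (x, y) \<in> ?A E2 \<Longrightarrow> x \<in> W2 \<and> y \<in> W2"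
    using T2 by (fastforce simp: is_tree_def adjacency_def)
  have bn: "?b \<notin> E1" "?b \<notin> E2" using is_tree_edge[OF T1, of w1 w2] is_tree_edge[OF T2, of w1 w2] w disj by auto
  have proj: "\<forall>a b. e = Upair a b \<longrightarrow> (a, b) \<notin> (?A (?T - {e}))\<^sup>*"
    if F: "is_tree U (\<lambda>e. e) F" "is_tree U' (\<lambda>e. e) F'" and d: "U \<inter> U' = {}"
      and u: "u \<in> U" "u' \<in> U'" and e: "e \<in> F" and eq: "?T = insert (Upair u u') (F \<union> F')"
    for e F F' U U' u u'
  proof (intro allI impI notI)
    fix a b assume ab: "e = Upair a b" and p: "(a, b) \<in> (?A (?T - {e}))\<^sup>*"
    \<comment> \<open>Collapsing the far side to \<open>u\<close>, the endpoint of the joining edge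
      in \<open>U\<close>, turns a walk in the joined tree that avoids \<open>e\<close> into a walk
      in \<open>F\<close> that avoids \<open>e\<close>.\<close>
    define \<phi> where "\<phi> x = (if x \<in> U then x else u)" for x
    have "(\<phi> a, \<phi> b) \<in> (?A (F - {e}))\<^sup>*" using p
    proof (induction rule: rtrancl_induct)
      case (step y z)
      have "(\<phi> y, \<phi> z) \<in> (?A (F - {e}))\<^sup>*"
      proof -
        from step(2) consider "Upair y z = Upair u u'" | "Upair y z \<in> F - {e}" | "Upair y z \<in> F'"
          unfolding eq adjacency_def by auto
        then show ?thesis
        proof cases
          case 1 then show ?thesis using u d by (auto simp: \<phi>_def)
        next
          case 2
          then have "y \<in> U" "z \<in> U" using F(1) by (auto simp: is_tree_def)
          then show ?thesis using 2 by (auto simp: \<phi>_def adjacency_def)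
        next
          case 3
          then have "y \<in> U'" "z \<in> U'" using F(2) by (auto simp: is_tree_def)
          then show ?thesis using d by (auto simp: \<phi>_def)
        qed
      qed
      with step show ?case by simp
    qed simp
    moreover have "a \<in> U" "b \<in> U" using F(1) e ab by (auto simp: is_tree_def)
    ultimately have "(a, b) \<in> (?A (F - {e}))\<^sup>*" by (simp add: \<phi>_def)
    then show False using F(1) e ab unfolding is_tree_iff_bridges by blast
  qed
  show ?thesis
    unfolding is_tree_iff_bridges
  proof (intro conjI ballI)
    fix e assume "e \<in> ?T"
    then show "set_uprod e \<subseteq> W1 \<union> W2" using T1 T2 w by (auto simp: is_tree_def)
  next
    let ?R = "(?A ?T)\<^sup>*"
    have r1: "(?A E1)\<^sup>* \<subseteq> ?R" and r2: "(?A E2)\<^sup>* \<subseteq> ?R"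
      by (intro rtrancl_mono adjacency_mono; blast)+
    have m: "(x, w1) \<in> ?R" if "x \<in> W1 \<union> W2" for x
    proof -
      have 1: "(x, w1) \<in> ?R" if "x \<in> W1" for x
        using T1 that w(1) r1 by (auto simp: is_tree_def joins_def)
      have 2: "(x, w2) \<in> ?R" if "x \<in> W2" for x
        using T2 that w(2) r2 by (auto simp: is_tree_def joins_def)
      have "(w2, w1) \<in> ?R" by (rule r_into_rtrancl) (auto simp: adjacency_def)
      then show ?thesis using that 1 2[of x] by (auto intro: rtrancl_trans)
    qed
    show "joins (\<lambda>e. e) ?T (W1 \<union> W2)"
      unfolding joins_def
      using m sym_adjacency_rtrancl[of "\<lambda>e. e" ?T] by (meson rtrancl_trans symD)
  next
    fix e assume e: "e \<in> ?T"
    then consider "e \<in> E1" | "e \<in> E2" | "e = ?b" by blast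
    then show "\<forall>a b. e = Upair a b \<longrightarrow> (a, b) \<notin> (?A (?T - {e}))\<^sup>*"
    proof cases
      case 1 then show ?thesis using proj[OF T1 T2 disj w] by blast
    next
      case 2
      have "?T = insert (Upair w2 w1) (E2 \<union> E1)" by auto
      then show ?thesis using proj[OF T2 T1 _ w(2,1) 2] disj by blast
    next
      case 3
      have cl: "x \<in> W1 \<longleftrightarrow> y \<in> W1" if "(x, y) \<in> (?A (?T - {?b}))\<^sup>*" for x y
        using that
      proof (induction rule: rtrancl_induct)
        case (step y z)
        then have "Upair y z \<in> E1 \<or> Upair y z \<in> E2" by (auto simp: adjacency_def)
        then have "(y, z) \<in> ?A E1 \<or> (y, z) \<in> ?A E2" by (auto simp: adjacency_def)
        then show ?case using step.IH s1 s2 disj by blast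
      qed simp
      show ?thesis using 3 cl w disj by auto
    qed
  qed
qed

lemma is_tree_singleton: "is_tree {w} (\<lambda>e. e) E \<longleftrightarrow> E = {}"
proof
  assume t: "is_tree {w} (\<lambda>e. e) E"
  show "E = {}"
  proof (rule equals0I)
    fix e assume e: "e \<in> E"
    obtain a b where ab: "e = Upair a b" by (cases e)
    then show False using t e unfolding is_tree_iff_bridges
      by (metis (no_types, lifting) insert_subset rtrancl.rtrancl_refl set_uprod_simps singletonD)
  qed
qed (auto simp: is_tree_iff_bridges joins_def)

lemma tree_subset: "is_tree W (\<lambda>e. e) E \<Longrightarrow> E \<subseteq> (\<lambda>(x, y). Upair x y) ` (W \<times> W)"
proof
  fix e assume "is_tree W (\<lambda>e. e) E" "e \<in> E"
  then show "e \<in> (\<lambda>(x, y). Upair x y) ` (W \<times> W)"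
    by (cases e) (auto simp: image_iff dest: is_tree_edge)
qed

lemma finite_trees: "finite W \<Longrightarrow> finite {E. is_tree W (\<lambda>e. e) E}"
  by (rule finite_subset[of _ "Pow ((\<lambda>(x, y). Upair x y) ` (W \<times> W))"]) (auto dest: tree_subset)

lemma finite_tree: "finite W \<Longrightarrow> is_tree W (\<lambda>e. e) E \<Longrightarrow> finite E"
  by (rule finite_subset[OF tree_subset]) auto

lemma tree_exists:
  assumes "finite W" "W \<noteq> {}" shows "\<exists>E. is_tree W (\<lambda>e. e) E"
  using assms
proof (induction rule: finite_ne_induct)
  case (insert x F)
  then obtain E y where "is_tree F (\<lambda>e. e) E" "y \<in> F" by blast
  from is_tree_insert_bridge[OF is_tree_singleton[THEN iffD2, OF refl] this(1) _ _ this(2), of x x] insert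
  show ?case by auto
qed (auto simp: is_tree_singleton)

lemma spread_le: "finite W \<Longrightarrow> is_tree W (\<lambda>e. e) E \<Longrightarrow> spread W \<le> (\<Prod>e\<in>E. case_uprod eta_bracket_diff e)"
  unfolding spread_def by (rule Min_le) (auto intro: finite_trees)

lemma spread_attained:
  assumes "finite W" "W \<noteq> {}"
  obtains E where "is_tree W (\<lambda>e. e) E" "spread W = (\<Prod>e\<in>E. case_uprod eta_bracket_diff e)"
proof -
  have "spread W \<in> (\<lambda>E. \<Prod>e\<in>E. case_uprod eta_bracket_diff e) ` {E. is_tree W (\<lambda>e. e) E}"
    unfolding spread_def using assms tree_exists by (intro Min_in) (auto intro: finite_trees)
  then show ?thesis using that by blast
qed

lemma bracket_ge_1: "1 \<le> eta_bracket z" by (simp add: eta_bracket_def)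

lemma apply_bracket: "apply_commute eta_bracket_diff z z' = eta_bracket (z - z')"
  by transfer simp

lemma case_uprod_bracket_ge_1: "1 \<le> case_uprod eta_bracket_diff e"
  by (cases e) (simp add: apply_bracket bracket_ge_1)

lemma spread_ge_1: "finite W \<Longrightarrow> W \<noteq> {} \<Longrightarrow> 1 \<le> spread W"
  by (erule (1) spread_attained) (auto intro: prod_ge_1 case_uprod_bracket_ge_1)

lemma spread_singleton: "spread {w} = 1"
  by (simp add: spread_def is_tree_singleton)

text \<open>Optimal trees on the two parts together with one joining edge compete for the minimum on
  the union. Reciprocal powers of this inequality are what the induction on the size of
  \<open>W\<close> consumes.\<close>

lemma spread_union_le:
  assumes "finite W1" "finite W2" "W1 \<inter> W2 = {}" "w1 \<in> W1" "w2 \<in> W2"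
  shows "spread (W1 \<union> W2) \<le> spread W1 * spread W2 * eta_bracket (w1 - w2)"
proof -
  obtain E1 where E1: "is_tree W1 (\<lambda>e. e) E1" "spread W1 = (\<Prod>e\<in>E1. case_uprod eta_bracket_diff e)"
    using spread_attained[of W1] assms by blast
  obtain E2 where E2: "is_tree W2 (\<lambda>e. e) E2" "spread W2 = (\<Prod>e\<in>E2. case_uprod eta_bracket_diff e)"
    using spread_attained[of W2] assms by blast
  have fin: "finite E1" "finite E2" using finite_tree E1 E2 assms by blast+
  have sub: "\<And>e. e \<in> E1 \<Longrightarrow> set_uprod e \<subseteq> W1" "\<And>e. e \<in> E2 \<Longrightarrow> set_uprod e \<subseteq> W2"
    using E1 E2 by (auto simp: is_tree_def)
  have "E1 \<inter> E2 = {}"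
  proof (rule equals0I)
    fix e assume "e \<in> E1 \<inter> E2"
    then have "set_uprod e \<subseteq> W1 \<inter> W2" using sub by blast
    then show False using assms(3) by (cases e) auto
  qed
  moreover have "Upair w1 w2 \<notin> E1 \<union> E2" using sub assms by fastforce
  ultimately have "(\<Prod>e\<in>insert (Upair w1 w2) (E1 \<union> E2). case_uprod eta_bracket_diff e)
      = eta_bracket (w1 - w2) * (spread W1 * spread W2)"
    using fin by (simp add: prod.union_disjoint E1 E2 apply_bracket)
  moreover have "spread (W1 \<union> W2) \<le> (\<Prod>e\<in>insert (Upair w1 w2) (E1 \<union> E2). case_uprod eta_bracket_diff e)"
    using assms by (intro spread_le is_tree_insert_bridge E1 E2) auto
  ultimately show ?thesis by (simp add: mult_ac)
qed

section \<open>Sums over the lattice\<close>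

lemma bracket_minus_commute: "eta_bracket (z - z') = eta_bracket (z' - z)"
  by (metis (no_types) apply_commute_commute eta_bracket_diff.rep_eq)

lemma bracket_ge:
  "sqrt \<bar>real_of_int (fst z)\<bar> \<le> eta_bracket z" "norm (\<chi> i. real_of_int (snd z $ i)) \<le> eta_bracket z"
  by (auto simp: eta_bracket_def eta_def)

lemma bracket_triangle: "eta_bracket (x + y) \<le> eta_bracket x + eta_bracket y"
proof -
  have "sqrt \<bar>real_of_int (fst (x + y))\<bar> \<le> sqrt (\<bar>real_of_int (fst x)\<bar> + \<bar>real_of_int (fst y)\<bar>)"
    by simp
  also have "\<dots> \<le> sqrt \<bar>real_of_int (fst x)\<bar> + sqrt \<bar>real_of_int (fst y)\<bar>"
    by (rule sqrt_add_le_add_sqrt) auto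
  finally have 1: "sqrt \<bar>real_of_int (fst (x + y))\<bar> \<le> eta_bracket x + eta_bracket y"
    using bracket_ge(1)[of x] bracket_ge(1)[of y] by linarith
  have "(\<chi> i. real_of_int (snd (x + y) $ i)) = (\<chi> i. real_of_int (snd x $ i)) + (\<chi> i. real_of_int (snd y $ i))"
    by (simp add: vec_eq_iff)
  then have "norm (\<chi> i. real_of_int (snd (x + y) $ i)) \<le> norm (\<chi> i. real_of_int (snd x $ i)) + norm (\<chi> i. real_of_int (snd y $ i))"
    by (metis norm_triangle_ineq)
  then have 2: "norm (\<chi> i. real_of_int (snd (x + y) $ i)) \<le> eta_bracket x + eta_bracket y"
    using bracket_ge(2)[of x] bracket_ge(2)[of y] by linarith
  have "1 \<le> eta_bracket x + eta_bracket y" using bracket_ge_1[of x] bracket_ge_1[of y] by linarith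
  then show ?thesis unfolding eta_bracket_def[of "x + y"] eta_def[of "x + y"] using 1 2 by simp
qed

text \<open>The ball lies in a box of height of order R^2 and width of order R, because
  \<open>eta\<close> sees the vertical coordinate through its square root. This is the source of the
  exponent \<open>CARD('d) + 2\<close>.\<close>

lemma card_bracket_ball:
  assumes "U \<subseteq> {u :: 'd::finite site. eta_bracket u < real R}" "finite U"
  shows "real (card U) \<le> 3 ^ (CARD('d) + 1) * real R ^ (CARD('d) + 2)"
proof (cases "R = 0")
  case True
  have "u \<notin> U" for u using assms(1) bracket_ge_1[of u] True by auto
  then have "U = {}" by blast
  then show ?thesis by simp
next
  case False
  let ?I = "{- int R..int R}"
  let ?B = "{- int (R ^ 2)..int (R ^ 2)} \<times> ((\<lambda>f. \<chi> i. f i) ` (PiE (UNIV :: 'd set) (\<lambda>_. ?I)))"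
  have fP: "finite (PiE (UNIV :: 'd set) (\<lambda>_. ?I))" by (rule finite_PiE) auto
  have "U \<subseteq> ?B"
  proof
    fix u assume "u \<in> U"
    then have u: "eta_bracket u < real R" using assms by auto
    have "sqrt \<bar>real_of_int (fst u)\<bar> < real R" using u by (simp add: eta_bracket_def eta_def)
    then have "\<bar>real_of_int (fst u)\<bar> < (real R)\<^sup>2" by (metis abs_ge_zero real_sqrt_ge_zero real_sqrt_pow2 power_strict_mono zero_less_numeral)
    then have 1: "\<bar>fst u\<bar> \<le> int (R ^ 2)" by (metis of_int_abs of_int_less_iff of_int_of_nat_eq of_nat_power less_imp_le)
    have 2: "\<bar>snd u $ i\<bar> \<le> int R" for i
    proof -
      have "\<bar>real_of_int (snd u $ i)\<bar> \<le> norm (\<chi> i. real_of_int (snd u $ i))"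
        using component_le_norm_cart[of "\<chi> i. real_of_int (snd u $ i)" i] by simp
      also have "\<dots> < real R" using u by (simp add: eta_bracket_def eta_def)
      finally show ?thesis by linarith
    qed
    have "snd u = (\<chi> i. (snd u $ i))" by (simp add: vec_eq_iff)
    then have "snd u \<in> (\<lambda>f. \<chi> i. f i) ` (PiE (UNIV :: 'd set) (\<lambda>_. ?I))"
      using 2 by (intro image_eqI[of _ _ "\<lambda>i. snd u $ i"]) (auto simp: abs_le_iff minus_le_iff)
    then show "u \<in> ?B" using 1 by (cases u) (auto simp: abs_le_iff minus_le_iff)
  qed
  then have "card U \<le> card ?B" using fP by (intro card_mono) auto
  also have "card ?B \<le> (2 * R ^ 2 + 1) * card (PiE (UNIV :: 'd set) (\<lambda>_. ?I))"
  proof -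
    have c: "card {- int Q..int Q} = 2 * Q + 1" for Q by simp
    show ?thesis unfolding card_cartesian_product c
      using card_image_le[OF fP, of "\<lambda>f. \<chi> i. f i"] by (intro mult_mono) auto
  qed
  also have "card (PiE (UNIV :: 'd set) (\<lambda>_. ?I)) = (2 * R + 1) ^ CARD('d)"
  proof -
    have "nat (2 * int R + 1) = 2 * R + 1" by simp
    then show ?thesis by (subst card_PiE) simp_all
  qed
  also have "(2 * R ^ 2 + 1) * (2 * R + 1) ^ CARD('d) \<le> (3 * R ^ 2) * (3 * R) ^ CARD('d)"
    using False by (intro mult_mono power_mono) auto
  also have "\<dots> = 3 ^ (CARD('d) + 1) * R ^ (CARD('d) + 2)" by (simp add: power_mult_distrib power_add power2_eq_square)
  finally have "real (card U) \<le> real (3 ^ (CARD('d) + 1) * R ^ (CARD('d) + 2))" by (rule of_nat_mono)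
  then show ?thesis by simp
qed

lemma dyadic_sum_le:
  assumes "r > (0::real)"
  shows "(\<Sum>j<J. min (2 ^ j / r) (r / 2 ^ j)) \<le> 4"
proof -
  define t where "t j = 2 ^ j / r" for j :: nat
  have t: "t j > 0" "t (Suc j) = 2 * t j" for j using assms by (auto simp: t_def)
  \<comment> \<open>An invariant that the induction carries: up to the crossover a geometric sum is
    below its next term, and beyond it the bound approaches 4 with room for the decaying terms. The
    crossover case reduces to (t - 1)(t - 3) <= 0 for 1 < t <= 2.\<close>
  have "(\<Sum>j<J. min (t j) (1 / t j)) \<le> (if t J \<le> 2 then t J else 4 - 4 / t J)"
  proof (induction J)
    case 0 show ?case using t[of 0] by (auto simp: field_simps)
  next
    case (Suc J)
    consider "t J \<le> 1" | "1 < t J" "t J \<le> 2" | "2 < t J" by linarith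
    then show ?case
    proof cases
      case 1
      then show ?thesis using Suc.IH t[of J] by (auto simp: min_le_iff_disj)
    next
      case 2
      have "min (t J) (1 / t J) \<le> 1 / t J" by simp
      moreover have "t J + 1 / t J \<le> 4 - 2 / t J"
      proof -
        have "(t J - 1) * (t J - 3) \<le> 0" using 2 by (intro mult_nonneg_nonpos) auto
        then have "(t J * t J + 3) / t J \<le> 4" using t[of J] by (simp add: pos_divide_le_eq algebra_simps)
        moreover have "(t J * t J + 3) / t J = t J + 3 / t J" using t[of J] by (simp add: add_divide_distrib)
        ultimately show ?thesis by simp
      qed
      ultimately show ?thesis using Suc.IH t[of J] 2 by auto
    next
      case 3
      have "min (t J) (1 / t J) \<le> 1 / t J" by simp
      moreover have "4 - 4 / t J + 1 / t J \<le> 4 - 2 / t J" using t[of J] by (simp add: field_simps)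
      ultimately show ?thesis using Suc.IH t[of J] 3 by auto
    qed
  qed
  also have "\<dots> \<le> 4" using t[of J] by auto
  finally show ?thesis by (simp add: t_def)
qed

text \<open>Dyadic shells: by the volume bound shell j contributes at most a constant times 2^(2j) /
  max(2^j, r)^d. This grows geometrically while 2^j <= r and decays geometrically afterwards, the
  latter because d >= 3; both sides are thus governed by the shell 2^j ~ r, which gives
  r^(2-d).\<close>

lemma one_point_sum:
  assumes d: "CARD('d) \<ge> 3"
  shows "\<exists>C\<ge>0. \<forall>r>0. \<forall>U :: 'd::finite site set. finite U \<longrightarrow>
    (\<Sum>u\<in>U. 1 / (eta_bracket u ^ CARD('d) * max (eta_bracket u) r ^ CARD('d))) \<le> C / r ^ (CARD('d) - 2)"
proof -
  let ?d = "CARD('d)"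
  define C0 where "C0 = (3 ^ (?d + 1) * 2 ^ (?d + 2) :: real)"
  have C0: "C0 \<ge> 0" by (simp add: C0_def)
  have "(\<Sum>u\<in>U. 1 / (eta_bracket u ^ ?d * max (eta_bracket u) r ^ ?d)) \<le> 4 * C0 / r ^ (?d - 2)"
    if r: "r > 0" and U: "finite U" for r and U :: "'d site set"
  proof -
    define lev where "lev u = nat \<lfloor>log 2 (eta_bracket u)\<rfloor>" for u :: "'d site"
    have lev: "2 ^ lev u \<le> eta_bracket u" "eta_bracket u < 2 ^ Suc (lev u)" for u :: "'d site"
    proof -
      have b: "eta_bracket u \<ge> 1" by (rule bracket_ge_1)
      define k where "k = \<lfloor>log 2 (eta_bracket u)\<rfloor>"
      have k: "k \<ge> 0" using b by (simp add: k_def)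
      have "2 powr (real_of_int k) \<le> 2 powr (log 2 (eta_bracket u))" "2 powr (log 2 (eta_bracket u)) < 2 powr (real_of_int k + 1)"
      proof -
        have "real_of_int k \<le> log 2 (eta_bracket u)" "log 2 (eta_bracket u) < real_of_int k + 1"
          unfolding k_def by linarith+
        then show "2 powr (real_of_int k) \<le> 2 powr (log 2 (eta_bracket u))" "2 powr (log 2 (eta_bracket u)) < 2 powr (real_of_int k + 1)"
          by (auto intro: powr_mono powr_less_mono)
      qed
      moreover have "2 powr (log 2 (eta_bracket u)) = eta_bracket u" using b by simp
      moreover have "2 powr (real_of_int k) = 2 ^ nat k"
      proof -
        have "real_of_int k = real (nat k)" using k by simp
        then show ?thesis by (simp only: powr_realpow)
      qed
      moreover have "2 powr (real_of_int k + 1) = 2 ^ Suc (nat k)"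
      proof -
        have "real_of_int k + 1 = real (Suc (nat k))" using k by simp
        then show ?thesis by (simp only: powr_realpow)
      qed
      ultimately show "2 ^ lev u \<le> eta_bracket u" "eta_bracket u < 2 ^ Suc (lev u)"
        unfolding lev_def k_def[symmetric] by (simp_all only:)
    qed
    define J where "J = Suc (Max (lev ` U \<union> {0}))"
    have J: "u \<in> U \<Longrightarrow> lev u < J" for u using U by (auto simp: J_def less_Suc_eq_le intro!: Max_ge)
    have shell: "(\<Sum>u\<in>{u\<in>U. lev u = j}. 1 / (eta_bracket u ^ ?d * max (eta_bracket u) r ^ ?d))
       \<le> C0 / r ^ (?d - 2) * min (2 ^ j / r) (r / 2 ^ j)" for j
    proof -
      let ?S = "{u\<in>U. lev u = j}"
      let ?m = "max (2 ^ j) r"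
      have "(\<Sum>u\<in>?S. 1 / (eta_bracket u ^ ?d * max (eta_bracket u) r ^ ?d)) \<le> (\<Sum>u\<in>?S. 1 / ((2 ^ j) ^ ?d * ?m ^ ?d))"
      proof (rule sum_mono)
        fix u assume u: "u \<in> ?S"
        have "(2 ^ j) ^ ?d * ?m ^ ?d \<le> eta_bracket u ^ ?d * max (eta_bracket u) r ^ ?d"
          using u lev[of u] bracket_ge_1[of u] r by (intro mult_mono power_mono max.mono) auto
        moreover have "(0::real) < (2 ^ j) ^ ?d * ?m ^ ?d" using r by auto
        ultimately show "1 / (eta_bracket u ^ ?d * max (eta_bracket u) r ^ ?d) \<le> 1 / ((2 ^ j) ^ ?d * ?m ^ ?d)"
          by (intro divide_left_mono) auto
      qed
      also have "\<dots> = real (card ?S) * (1 / ((2 ^ j) ^ ?d * ?m ^ ?d))" by simp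
      also have "\<dots> \<le> (3 ^ (?d + 1) * real (2 ^ Suc j) ^ (?d + 2)) * (1 / ((2 ^ j) ^ ?d * ?m ^ ?d))"
      proof (rule mult_right_mono)
        have "?S \<subseteq> {u. eta_bracket u < real (2 ^ Suc j)}"
        proof
          fix u assume "u \<in> ?S"
          then show "u \<in> {u. eta_bracket u < real (2 ^ Suc j)}" using lev(2)[of u] by simp
        qed
        then show "real (card ?S) \<le> 3 ^ (?d + 1) * real (2 ^ Suc j) ^ (?d + 2)"
          by (rule card_bracket_ball) (use U in auto)
      qed (use r in auto)
      also have "\<dots> = C0 * ((2 ^ j) ^ 2 / ?m ^ ?d)"
      proof -
        have "real (2 ^ Suc j) ^ (?d + 2) = 2 ^ (?d + 2) * ((2 ^ j) ^ ?d * (2 ^ j) ^ 2)"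
        proof -
          have "real (2 ^ Suc j) = 2 * 2 ^ j" by simp
          then show ?thesis by (simp only: power_mult_distrib power_add mult_ac)
        qed
        then show ?thesis by (simp add: C0_def)
      qed
      also have "(2 ^ j) ^ 2 / ?m ^ ?d \<le> 1 / r ^ (?d - 2) * min (2 ^ j / r) (r / 2 ^ j)"
      proof -
        define q where "q = (2 ^ j :: real)"
        have q: "q > 0" by (simp add: q_def)
        have pw: "x ^ ?d = x ^ (?d - 2) * x ^ 2" for x :: real
        proof -
          have "?d = (?d - 2) + 2" using d by simp
          then show ?thesis by (metis power_add)
        qed
        have pw3: "x ^ (?d - 2) = x ^ (?d - 3) * x" for x :: real
        proof -
          have "?d - 2 = Suc (?d - 3)" using d by simp
          then show ?thesis by simp
        qed
        show ?thesis
        proof (cases "q \<le> r")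
          case True
          then have "q / r \<le> 1" "1 \<le> r / q" using q r by auto
          then have mn: "min (q / r) (r / q) = q / r" by simp
          have "q ^ 2 / r ^ ?d = 1 / r ^ (?d - 2) * (q / r) ^ 2" by (simp add: pw power_divide)
          also have "\<dots> \<le> 1 / r ^ (?d - 2) * (q / r)"
          proof (rule mult_left_mono)
            have "(q / r) * (q / r) \<le> (q / r) * 1" using r q \<open>q / r \<le> 1\<close> by (intro mult_left_mono) auto
            then show "(q / r) ^ 2 \<le> q / r" by (simp only: power2_eq_square mult_1_right)
          qed (use r in simp)
          finally show ?thesis using True mn by (simp add: q_def[symmetric] max_def)
        next
          case False
          then have "1 \<le> q / r" "r / q \<le> 1" using q r by auto
          then have mn: "min (q / r) (r / q) = r / q" by simp
          have "q ^ 2 / q ^ ?d = 1 / (q ^ (?d - 3) * q)" using q by (simp add: pw pw3)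
          also have "\<dots> \<le> 1 / (r ^ (?d - 3) * q)"
            using r q False by (intro divide_left_mono mult_right_mono power_mono) auto
          also have "\<dots> = 1 / r ^ (?d - 2) * (r / q)" using r by (simp add: pw3)
          finally show ?thesis using False mn by (simp add: q_def[symmetric] max_def)
        qed
      qed
      finally show ?thesis using C0 by (simp add: mult_left_mono)
    qed
    have "(\<Sum>u\<in>U. 1 / (eta_bracket u ^ ?d * max (eta_bracket u) r ^ ?d))
       = (\<Sum>j<J. \<Sum>u\<in>{u\<in>U. lev u = j}. 1 / (eta_bracket u ^ ?d * max (eta_bracket u) r ^ ?d))"
      using U J by (intro sum.group[symmetric]) auto
    also have "\<dots> \<le> (\<Sum>j<J. C0 / r ^ (?d - 2) * min (2 ^ j / r) (r / 2 ^ j))" by (intro sum_mono shell)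
    also have "\<dots> = C0 / r ^ (?d - 2) * (\<Sum>j<J. min (2 ^ j / r) (r / 2 ^ j))" by (simp only: sum_distrib_left)
    also have "\<dots> \<le> C0 / r ^ (?d - 2) * 4" using C0 r by (intro mult_left_mono dyadic_sum_le) auto
    finally show ?thesis by (simp add: mult.commute)
  qed
  then show ?thesis using C0 by (intro exI[of _ "4 * C0"]) auto
qed

text \<open>Each \<open>z\<close> is charged to the nearer of \<open>a\<close> and \<open>b\<close>.
  The distance to the other point is then at least the maximum of the nearer distance and half the
  distance of \<open>a\<close> and \<open>b\<close>, so \<open>one_point_sum\<close> applies around
  each of the two points.\<close>

lemma two_point_sum:
  assumes d: "CARD('d) \<ge> 3"
  shows "\<exists>C\<ge>0. \<forall>a b. \<forall>V :: 'd::finite site set. finite V \<longrightarrow>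
    (\<Sum>z\<in>V. 1 / eta_bracket (a - z) ^ CARD('d) * (1 / eta_bracket (b - z) ^ CARD('d))) \<le> C / eta_bracket (a - b) ^ (CARD('d) - 2)"
proof -
  let ?d = "CARD('d)"
  obtain C where C: "C \<ge> 0" "\<And>r (U :: 'd site set). r > 0 \<Longrightarrow> finite U \<Longrightarrow>
    (\<Sum>u\<in>U. 1 / (eta_bracket u ^ ?d * max (eta_bracket u) r ^ ?d)) \<le> C / r ^ (?d - 2)"
    using one_point_sum[OF d] by blast
  have "(\<Sum>z\<in>V. 1 / eta_bracket (a - z) ^ ?d * (1 / eta_bracket (b - z) ^ ?d)) \<le> (2 * C * 2 ^ (?d - 2)) / eta_bracket (a - b) ^ (?d - 2)"
    if V: "finite V" for a b and V :: "'d site set"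
  proof -
    define r where "r = eta_bracket (a - b) / 2"
    have r: "r > 0" using bracket_ge_1[of "a - b"] by (simp add: r_def)
    let ?f = "\<lambda>u :: 'd site. 1 / (eta_bracket u ^ ?d * max (eta_bracket u) r ^ ?d)"
    have pos: "eta_bracket u > 0" for u :: "'d site" using bracket_ge_1[of u] by linarith
    have f: "?f u \<ge> 0" for u using pos[of u] r by (auto intro!: divide_nonneg_nonneg mult_nonneg_nonneg)
    have le: "1 / eta_bracket (a - z) ^ ?d * (1 / eta_bracket (b - z) ^ ?d) \<le> ?f (a - z) + ?f (b - z)" for z
    proof -
      have t: "eta_bracket (a - b) \<le> eta_bracket (a - z) + eta_bracket (b - z)"
        using bracket_triangle[of "a - z" "z - b"] bracket_minus_commute[of z b] by simp
      have *: "1 / x ^ ?d * (1 / y ^ ?d) \<le> 1 / (x ^ ?d * max x r ^ ?d)"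
        if "0 < x" "x \<le> y" "2 * r \<le> x + y" for x y :: real
      proof -
        have "max x r \<le> y" using that by linarith
        then have "x ^ ?d * max x r ^ ?d \<le> x ^ ?d * y ^ ?d" using that r by (intro mult_left_mono power_mono) auto
        then show ?thesis using that r by (simp add: divide_left_mono)
      qed
      show ?thesis
      proof (cases "eta_bracket (a - z) \<le> eta_bracket (b - z)")
        case True
        from *[OF pos this] t have "1 / eta_bracket (a - z) ^ ?d * (1 / eta_bracket (b - z) ^ ?d) \<le> ?f (a - z)" by (simp add: r_def)
        then show ?thesis using f[of "b - z"] by linarith
      next
        case False
        then have "eta_bracket (b - z) \<le> eta_bracket (a - z)" by simp
        from *[OF pos this] t have "1 / eta_bracket (b - z) ^ ?d * (1 / eta_bracket (a - z) ^ ?d) \<le> ?f (b - z)" by (simp add: r_def)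
        then show ?thesis using f[of "a - z"] by (subst mult.commute) linarith
      qed
    qed
    have shift: "(\<Sum>z\<in>V. ?f (w - z)) \<le> C / r ^ (?d - 2)" for w
    proof -
      have "(\<Sum>z\<in>V. ?f (w - z)) = (\<Sum>u\<in>(\<lambda>z. w - z) ` V. ?f u)"
        by (subst sum.reindex) (auto simp: inj_on_def)
      also have "\<dots> \<le> C / r ^ (?d - 2)" using V r by (intro C(2)) auto
      finally show ?thesis .
    qed
    have "(\<Sum>z\<in>V. 1 / eta_bracket (a - z) ^ ?d * (1 / eta_bracket (b - z) ^ ?d)) \<le> (\<Sum>z\<in>V. ?f (a - z) + ?f (b - z))"
      by (intro sum_mono le)
    also have "\<dots> \<le> C / r ^ (?d - 2) + C / r ^ (?d - 2)" unfolding sum.distrib by (intro add_mono shift)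
    also have "\<dots> = (2 * C * 2 ^ (?d - 2)) / eta_bracket (a - b) ^ (?d - 2)" by (simp add: r_def power_divide)
    finally show ?thesis .
  qed
  then show ?thesis using C(1) by (intro exI[of _ "2 * C * 2 ^ (?d - 2)"]) auto
qed

section \<open>Weighted oriented forests\<close>

text \<open>Only vertices of \<open>V\<close> have an out-edge, so every vertex outside
  \<open>V\<close> is a root. The roots are kept distinct instead of being wired together, since
  revealed paths become further roots and it matters which of them is reached.\<close>

definition steps :: "('v \<Rightarrow> 'v) \<Rightarrow> 'v set \<Rightarrow> 'v rel" where
  "steps f V = {(v, f v) | v. v \<in> V}"

definition leads :: "('v \<Rightarrow> 'v) \<Rightarrow> 'v set \<Rightarrow> 'v \<Rightarrow> 'v \<Rightarrow> bool" where
  "leads f V v r \<longleftrightarrow> r \<notin> V \<and> (v, r) \<in> (steps f V)\<^sup>*"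

text \<open>Restricted to \<open>V\<close>: these are exactly the vertices whose out-edges become
  known when the paths from \<open>W\<close> are followed to their roots.\<close>

definition trail :: "('v \<Rightarrow> 'v) \<Rightarrow> 'v set \<Rightarrow> 'v set \<Rightarrow> 'v set" where
  "trail f V W = {v \<in> V. \<exists>w\<in>W. (w, v) \<in> (steps f V)\<^sup>*}"

definition forests :: "('v \<Rightarrow> 'v set) \<Rightarrow> 'v set \<Rightarrow> ('v \<Rightarrow> 'v) set" where
  "forests nb V = {f \<in> PiE V nb. \<forall>v\<in>V. \<exists>r. leads f V v r}"

definition wt :: "('v \<Rightarrow> 'v \<Rightarrow> real) \<Rightarrow> 'v set \<Rightarrow> ('v \<Rightarrow> 'v) \<Rightarrow> real" where
  "wt c V f = (\<Prod>v\<in>V. c v (f v))"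

text \<open>Left unnormalised, because the total mass \<open>Z\<close> may vanish once competing
  out-edges have been given weight 0.\<close>

definition mass :: "('v \<Rightarrow> 'v set) \<Rightarrow> ('v \<Rightarrow> 'v \<Rightarrow> real) \<Rightarrow> 'v set \<Rightarrow> (('v \<Rightarrow> 'v) \<Rightarrow> bool) \<Rightarrow> real" where
  "mass nb c V P = (\<Sum>f | f \<in> forests nb V \<and> P f. wt c V f)"

abbreviation Z where "Z nb c V \<equiv> mass nb c V (\<lambda>_. True)"

section \<open>Orbits of an out-edge function\<close>

lemma steps_iff: "(x, y) \<in> steps f V \<longleftrightarrow> x \<in> V \<and> y = f x"
  by (auto simp: steps_def)

lemma single_valued_steps: "single_valued (steps f V)"
  by (auto simp: single_valued_def steps_def)

lemma steps_cong: "(\<And>v. v \<in> V \<Longrightarrow> f v = g v) \<Longrightarrow> steps f V = steps g V"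
  by (auto simp: steps_def)

lemma leads_cong: "(\<And>v. v \<in> V \<Longrightarrow> f v = g v) \<Longrightarrow> leads f V = leads g V"
  using steps_cong[of V f g] by (auto simp: leads_def fun_eq_iff)

lemma steps_mono: "B \<subseteq> V \<Longrightarrow> steps f B \<subseteq> steps f V"
  by (auto simp: steps_def)

lemma steps_rtrancl_mono: "B \<subseteq> V \<Longrightarrow> (x, y) \<in> (steps f B)\<^sup>* \<Longrightarrow> (x, y) \<in> (steps f V)\<^sup>*"
  using rtrancl_mono[OF steps_mono] by blast

lemma steps_linear:
  "(x, a) \<in> (steps f V)\<^sup>* \<Longrightarrow> (x, b) \<in> (steps f V)\<^sup>* \<Longrightarrow> (a, b) \<in> (steps f V)\<^sup>* \<or> (b, a) \<in> (steps f V)\<^sup>*"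
  by (rule single_valued_confluent[OF single_valued_steps])

lemma steps_stuck: "(r, x) \<in> (steps f V)\<^sup>* \<Longrightarrow> r \<notin> V \<Longrightarrow> x = r"
  by (erule converse_rtranclE) (auto simp: steps_iff)

lemma steps_first: "(x, y) \<in> (steps f V)\<^sup>* \<Longrightarrow> x \<noteq> y \<Longrightarrow> x \<in> V \<and> (f x, y) \<in> (steps f V)\<^sup>*"
  by (erule converse_rtranclE) (auto simp: steps_iff)

lemma steps_source: "(x, y) \<in> (steps f V)\<^sup>* \<Longrightarrow> y \<in> V \<Longrightarrow> x \<in> V"
  using steps_first by fastforce

lemma leads_outside: "x \<notin> V \<Longrightarrow> leads f V x r \<longleftrightarrow> r = x"
  using steps_stuck by (fastforce simp: leads_def)

lemma leads_trans: "(x, y) \<in> (steps f V)\<^sup>* \<Longrightarrow> leads f V y r \<Longrightarrow> leads f V x r"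
  by (auto simp: leads_def)

lemma leads_back: "(x, y) \<in> (steps f V)\<^sup>* \<Longrightarrow> leads f V x r \<Longrightarrow> leads f V y r"
  using steps_linear steps_stuck unfolding leads_def by metis

text \<open>If \<open>x\<close> lay on a cycle, every vertex reachable from \<open>x\<close> could
  return to \<open>x\<close>. The root \<open>r\<close> is reachable but has no outgoing
  step.\<close>

lemma no_return:
  assumes "leads f V x r" "x \<in> V" shows "(f x, x) \<notin> (steps f V)\<^sup>*"
proof
  assume c: "(f x, x) \<in> (steps f V)\<^sup>*"
  have "(x, v) \<in> (steps f V)\<^sup>* \<Longrightarrow> (v, x) \<in> (steps f V)\<^sup>*" for v
  proof (induction rule: rtrancl_induct)
    case (step v u)
    then show ?case using c steps_first[of v x f V] by (cases "v = x") (auto simp: steps_iff)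
  qed simp
  then have "(r, x) \<in> (steps f V)\<^sup>*" using assms by (auto simp: leads_def)
  then show False using assms steps_stuck by (metis leads_def)
qed

lemma steps_antisym:
  assumes "(x, y) \<in> (steps f V)\<^sup>*" "(y, x) \<in> (steps f V)\<^sup>*" "leads f V x r"
  shows "x = y"
proof (rule ccontr)
  assume "x \<noteq> y"
  then have "x \<in> V" "(f x, y) \<in> (steps f V)\<^sup>*" using steps_first[OF assms(1)] by auto
  then show False using no_return[OF assms(3)] assms(2) by (meson rtrancl_trans)
qed

lemma leads_first_exit:
  assumes "B \<subseteq> V" "(v, r) \<in> (steps f V)\<^sup>*" "r \<notin> B"
  shows "\<exists>r'. leads f B v r' \<and> (r', r) \<in> (steps f V)\<^sup>*"
  using assms(2)
proof (induction rule: converse_rtrancl_induct)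
  case base then show ?case using assms(3) by (auto simp: leads_def)
next
  case (step y z)
  show ?case
  proof (cases "y \<in> B")
    case True
    then have "(y, z) \<in> (steps f B)\<^sup>*" using step(1) by (auto simp: steps_iff)
    then show ?thesis using step.IH leads_trans by metis
  next
    case False
    then show ?thesis using step(1,2) by (metis converse_rtrancl_into_rtrancl leads_outside)
  qed
qed

lemma forestsI:
  "(\<And>v. v \<in> V \<Longrightarrow> f v \<in> nb v) \<Longrightarrow> (\<And>v. v \<notin> V \<Longrightarrow> f v = undefined) \<Longrightarrow>
   (\<And>v. v \<in> V \<Longrightarrow> \<exists>r. leads f V v r) \<Longrightarrow> f \<in> forests nb V"
  by (auto simp: forests_def PiE_def extensional_def)

lemma forestsD:
  assumes "f \<in> forests nb V"
  shows "v \<in> V \<Longrightarrow> f v \<in> nb v" "v \<notin> V \<Longrightarrow> f v = undefined" "\<exists>r. leads f V v r"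
  using assms by (auto simp: forests_def PiE_def extensional_def) (metis leads_outside)

lemma forest_restrict:
  assumes "f \<in> forests nb V" "B \<subseteq> V" shows "restrict f B \<in> forests nb B"
proof (rule forestsI)
  fix v assume v: "v \<in> B"
  obtain r where "leads f V v r" using forestsD[OF assms(1)] by blast
  then show "\<exists>r. leads (restrict f B) B v r"
    using leads_first_exit[OF assms(2), of v r f] assms(2) leads_cong[of B f "restrict f B"]
    by (auto simp: leads_def[of f V])
qed (use assms forestsD(1)[OF assms(1)] in auto)

lemma forest_no_return: "f \<in> forests nb V \<Longrightarrow> x \<in> V \<Longrightarrow> (f x, x) \<notin> (steps f V)\<^sup>*"
  using no_return forestsD(3) by metis

lemma trail_subset: "trail f V W \<subseteq> V"
  by (auto simp: trail_def)

section \<open>Masses of sets of forests\<close>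

locale loc_finite =
  fixes nb :: "'v \<Rightarrow> 'v set"
  assumes finite_nb: "finite (nb v)"
begin

lemma finite_forests: "finite V \<Longrightarrow> finite (forests nb V)"
  unfolding forests_def using finite_nb
  by (intro finite_subset[OF _ finite_PiE[of V nb]]) auto

lemma mass_mono:
  assumes "finite V" "\<And>x y. c x y \<ge> 0" "\<And>f. f \<in> forests nb V \<Longrightarrow> P f \<Longrightarrow> Q f"
  shows "mass nb c V P \<le> mass nb c V Q"
  unfolding mass_def using assms finite_forests[OF assms(1)]
  by (intro sum_mono2) (auto simp: wt_def intro!: prod_nonneg)

lemma mass_nonneg: "(\<And>x y. c x y \<ge> 0) \<Longrightarrow> 0 \<le> mass nb c V P"
  unfolding mass_def by (intro sum_nonneg) (auto simp: wt_def intro!: prod_nonneg)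

lemma mass_cong:
  "(\<And>f. f \<in> forests nb V \<Longrightarrow> P f \<longleftrightarrow> Q f) \<Longrightarrow> mass nb c V P = mass nb c V Q"
  unfolding mass_def by (rule sum.cong) auto

lemma mass_Un_le:
  assumes "finite V" "\<And>x y. c x y \<ge> 0" "finite I" "\<And>f. f \<in> forests nb V \<Longrightarrow> P f \<Longrightarrow> \<exists>i\<in>I. Q i f"
  shows "mass nb c V P \<le> (\<Sum>i\<in>I. mass nb c V (Q i))"
proof -
  have fin: "finite (forests nb V)" by (rule finite_forests[OF assms(1)])
  have w: "0 \<le> wt c V f" for f using assms(2) by (auto simp: wt_def intro!: prod_nonneg)
  have "mass nb c V P \<le> (\<Sum>f\<in>forests nb V. \<Sum>i\<in>I. if Q i f then wt c V f else 0)"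
    unfolding mass_def sum.inter_filter[symmetric, OF fin] 
  proof -
    have "(\<Sum>f | f \<in> forests nb V \<and> P f. wt c V f) = (\<Sum>f\<in>forests nb V. if P f then wt c V f else 0)"
      using fin by (simp add: sum.If_cases Int_def conj_commute)
    also have "\<dots> \<le> (\<Sum>f\<in>forests nb V. \<Sum>i\<in>I. if Q i f then wt c V f else 0)"
    proof (rule sum_mono)
      fix f assume f: "f \<in> forests nb V"
      show "(if P f then wt c V f else 0) \<le> (\<Sum>i\<in>I. if Q i f then wt c V f else 0)"
      proof (cases "P f")
        case True
        then obtain i where i: "i \<in> I" "Q i f" using assms(4) f by blast
        have "(if Q i f then wt c V f else 0) \<le> (\<Sum>i\<in>I. if Q i f then wt c V f else 0)"
          using i w assms(3) by (intro member_le_sum) auto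
        then show ?thesis using True i by simp
      next
        case False then show ?thesis using w by (auto intro!: sum_nonneg)
      qed
    qed
    finally show "(\<Sum>f | f \<in> forests nb V \<and> P f. wt c V f) \<le> (\<Sum>f\<in>forests nb V. \<Sum>i\<in>I. if Q i f then wt c V f else 0)" .
  qed
  also have "\<dots> = (\<Sum>i\<in>I. mass nb c V (Q i))"
    unfolding mass_def using fin
    by (subst sum.swap) (simp add: sum.If_cases Int_def conj_commute)
  finally show ?thesis .
qed

text \<open>
  The sum over pairs of a forest and an alternative out-edge of \<open>x\<close> is invariant under
  exchanging the two out-edges, except when the alternative edge would close a cycle.
\<close>

lemma swap_steps_reach:
  assumes "(v, x) \<in> (steps f V)\<^sup>*" shows "(v, x) \<in> (steps (f(x := y)) V)\<^sup>*"
  using assms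
proof (induction rule: converse_rtrancl_induct)
  case (step a b)
  show ?case
  proof (cases "a = x")
    case False
    then have "(a, b) \<in> steps (f(x := y)) V" using step(1) by (auto simp: steps_iff)
    then show ?thesis using step.IH by (rule converse_rtrancl_into_rtrancl)
  qed auto
qed simp

lemma swap_steps_avoid:
  assumes "(v, r) \<in> (steps f V)\<^sup>*" "(v, x) \<notin> (steps f V)\<^sup>*"
  shows "(v, r) \<in> (steps (f(x := y)) V)\<^sup>*"
  using assms
proof (induction rule: converse_rtrancl_induct)
  case (step a b)
  then have "a \<noteq> x" "(b, x) \<notin> (steps f V)\<^sup>*" by (auto intro: converse_rtrancl_into_rtrancl)
  moreover have "(a, b) \<in> steps (f(x := y)) V" using step(1) \<open>a \<noteq> x\<close> by (auto simp: steps_iff)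
  ultimately show ?case using step.IH by (meson converse_rtrancl_into_rtrancl)
qed simp

lemma swap_forest:
  assumes f: "f \<in> forests nb V" and x: "x \<in> V" and y: "y \<in> nb x" and ny: "(y, x) \<notin> (steps f V)\<^sup>*"
  shows "f(x := y) \<in> forests nb V"
proof (rule forestsI)
  let ?g = "f(x := y)"
  obtain r where r: "leads f V y r" using forestsD(3)[OF f] by blast
  have "leads ?g V y r" using swap_steps_avoid[OF _ ny] r by (auto simp: leads_def)
  moreover have "(x, y) \<in> (steps ?g V)\<^sup>*" using x by (auto simp: steps_iff)
  ultimately have xr: "leads ?g V x r" by (metis leads_trans)
  fix v assume v: "v \<in> V"
  show "\<exists>r. leads ?g V v r"
  proof (cases "(v, x) \<in> (steps f V)\<^sup>*")
    case True then show ?thesis using swap_steps_reach xr leads_trans by metis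
  next
    case False
    obtain r' where "leads f V v r'" using forestsD(3)[OF f] by blast
    then show ?thesis using swap_steps_avoid[OF _ False] by (auto simp: leads_def)
  qed
qed (use assms forestsD[OF f] in auto)

lemma harmonic_leads:
  assumes V: "finite V" and x: "x \<in> V"
  shows "(\<Sum>y\<in>nb x. c x y * mass nb c V (\<lambda>f. leads f V y r)) = (\<Sum>y\<in>nb x. c x y) * mass nb c V (\<lambda>f. leads f V x r)"
proof -
  let ?F = "forests nb V"
  define A where "A = {(f, y). f \<in> ?F \<and> y \<in> nb x \<and> leads f V y r}"
  define B where "B = {(f, y). f \<in> ?F \<and> y \<in> nb x \<and> leads f V x r}"
  \<comment> \<open>If the exchange would close a cycle, \<open>y\<close> lies upstream of
    \<open>x\<close>, so that \<open>x\<close> and \<open>y\<close> lead to the same root and the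
    pair can stay fixed. Otherwise the new path from \<open>x\<close> continues as the old path from
    \<open>y\<close>. Hence \<open>\<tau>\<close> is an involution exchanging \<open>A\<close> and
    \<open>B\<close>, and it preserves \<open>wt c V f * c x y\<close>.\<close>
  define \<tau> where "\<tau> = (\<lambda>(f, y). if (y, x) \<in> (steps f V)\<^sup>* then (f, y) else (f(x := y), f x))"
  have fin: "finite ?F" by (rule finite_forests[OF V])
  have inv: "(f x, x) \<notin> (steps (f(x := y)) V)\<^sup>*" if "f \<in> ?F" for f y
  proof
    assume "(f x, x) \<in> (steps (f(x := y)) V)\<^sup>*"
    then have "(f x, x) \<in> (steps ((f(x := y))(x := f x)) V)\<^sup>*" by (rule swap_steps_reach)
    then show False using forest_no_return[OF that x] by simp
  qed
  have tt: "\<tau> (\<tau> p) = p" if "fst p \<in> ?F" for p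
    using that inv[of "fst p" "snd p"] by (cases p) (auto simp: \<tau>_def)
  have AB: "\<tau> p \<in> B" if pA: "p \<in> A" for p
  proof -
    obtain f y where p: "p = (f, y)" by (cases p)
    have f: "f \<in> ?F" and y: "y \<in> nb x" and l: "leads f V y r" using pA p by (auto simp: A_def)
    show ?thesis
    proof (cases "(y, x) \<in> (steps f V)\<^sup>*")
      case True
      then show ?thesis using f y leads_back[OF True l] p by (auto simp: \<tau>_def B_def)
    next
      case False
      have "leads (f(x := y)) V y r" using swap_steps_avoid[OF _ False] l by (auto simp: leads_def)
      moreover have "(x, y) \<in> (steps (f(x := y)) V)\<^sup>*" using x by (auto simp: steps_iff)
      ultimately have "leads (f(x := y)) V x r" by (metis leads_trans)
      then show ?thesis using False p swap_forest[OF f x y False] forestsD(1)[OF f x] by (auto simp: \<tau>_def B_def)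
    qed
  qed
  have BA: "\<tau> p \<in> A" if pB: "p \<in> B" for p
  proof -
    obtain f y where p: "p = (f, y)" by (cases p)
    have f: "f \<in> ?F" and y: "y \<in> nb x" and l: "leads f V x r" using pB p by (auto simp: B_def)
    show ?thesis
    proof (cases "(y, x) \<in> (steps f V)\<^sup>*")
      case True
      then show ?thesis using f y leads_trans[OF True l] p by (auto simp: \<tau>_def A_def)
    next
      case False
      have "(x, f x) \<in> (steps f V)\<^sup>*" using x by (auto simp: steps_iff)
      then have "leads f V (f x) r" using l by (metis leads_back)
      then have "leads (f(x := y)) V (f x) r"
        using swap_steps_avoid[OF _ forest_no_return[OF f x]] by (auto simp: leads_def)
      then show ?thesis using False p swap_forest[OF f x y False] forestsD(1)[OF f x] by (auto simp: \<tau>_def A_def)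
    qed
  qed
  have W: "wt c V (fst (\<tau> p)) * c x (snd (\<tau> p)) = wt c V (fst p) * c x (snd p)" for p
  proof -
    obtain f y where p: "p = (f, y)" by (cases p)
    have "(\<Prod>v\<in>V - {x}. c v ((f(x := y)) v)) = (\<Prod>v\<in>V - {x}. c v (f v))" by (rule prod.cong) auto
    then show ?thesis using V x p by (auto simp: \<tau>_def wt_def prod.remove[of V x])
  qed
  have "(\<Sum>p\<in>A. wt c V (fst p) * c x (snd p)) = (\<Sum>p\<in>B. wt c V (fst p) * c x (snd p))"
  proof (rule sum.reindex_bij_witness[of _ \<tau> \<tau>])
    show "\<tau> (\<tau> p) = p" if "p \<in> A" for p using that tt by (auto simp: A_def)
    show "\<tau> (\<tau> p) = p" if "p \<in> B" for p using that tt by (auto simp: B_def)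
  qed (auto simp: W AB BA)
  moreover have "(\<Sum>p\<in>A. wt c V (fst p) * c x (snd p)) = (\<Sum>y\<in>nb x. c x y * mass nb c V (\<lambda>f. leads f V y r))"
  proof -
    have "A = (\<lambda>(y, f). (f, y)) ` (SIGMA y:nb x. {f \<in> ?F. leads f V y r})" by (auto simp: A_def)
    then have "(\<Sum>p\<in>A. wt c V (fst p) * c x (snd p)) = (\<Sum>p\<in>(SIGMA y:nb x. {f \<in> ?F. leads f V y r}). wt c V (snd p) * c x (fst p))"
      by (simp add: sum.reindex inj_on_def split_def)
    also have "\<dots> = (\<Sum>y\<in>nb x. \<Sum>f\<in>{f \<in> ?F. leads f V y r}. wt c V f * c x y)"
      using finite_nb fin by (subst sum.Sigma) (auto simp: split_def)
    finally show ?thesis by (simp add: mass_def sum_distrib_left mult.commute)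
  qed
  moreover have "(\<Sum>p\<in>B. wt c V (fst p) * c x (snd p)) = (\<Sum>y\<in>nb x. c x y) * mass nb c V (\<lambda>f. leads f V x r)"
  proof -
    have "B = {f \<in> ?F. leads f V x r} \<times> nb x" by (auto simp: B_def)
    then have "(\<Sum>p\<in>B. wt c V (fst p) * c x (snd p)) = (\<Sum>f\<in>{f \<in> ?F. leads f V x r}. \<Sum>y\<in>nb x. wt c V f * c x y)"
      by (simp add: sum.cartesian_product split_def)
    then show ?thesis by (simp add: mass_def sum_product mult.commute) (subst sum.swap, simp add: mult.commute)
  qed
  ultimately show ?thesis by simp
qed

text \<open>Irreducibility is replaced by a forest with positive weights: a positive maximum
  propagates along its out-edges and reaches a root, where \<open>w\<close> is at most 0. This form
  still applies when many weights are 0.\<close>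

lemma maximum_principle:
  assumes V: "finite V" and f: "f \<in> forests nb V" and pos: "\<And>v. v \<in> V \<Longrightarrow> c v (f v) > 0"
    and nn: "\<And>x y. c x y \<ge> (0::real)"
    and sub: "\<And>v. v \<in> V \<Longrightarrow> (\<Sum>y\<in>nb v. c v y) * w v \<le> (\<Sum>y\<in>nb v. c v y * w y)"
    and out: "\<And>v. v \<notin> V \<Longrightarrow> w v \<le> (0::real)"
  shows "w v \<le> 0"
proof (rule ccontr)
  assume neg: "\<not> w v \<le> 0"
  then have vV: "v \<in> V" using out by blast
  define m where "m = Max (w ` V)"
  have m: "\<And>u. u \<in> V \<Longrightarrow> w u \<le> m" using V by (simp add: m_def)
  have "m \<in> w ` V" using V vV unfolding m_def by (intro Max_in) auto
  then obtain x where x: "x \<in> V" "w x = m" by auto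
  have mpos: "m > 0" using m[OF vV] neg by simp
  have le: "w u \<le> m" for u using m[of u] out[of u] mpos by (cases "u \<in> V") auto
  have step: "w (f u) = m" if u: "u \<in> V" "w u = m" for u
  proof (rule ccontr)
    assume "w (f u) \<noteq> m"
    then have lt: "w (f u) < m" using le[of "f u"] by simp
    have "(\<Sum>y\<in>nb u. c u y * w y) < (\<Sum>y\<in>nb u. c u y * m)"
    proof (rule sum_strict_mono_ex1)
      show "\<forall>y\<in>nb u. c u y * w y \<le> c u y * m" using nn le by (auto intro: mult_left_mono)
      show "\<exists>y\<in>nb u. c u y * w y < c u y * m"
        using forestsD(1)[OF f u(1)] pos[OF u(1)] lt by (intro bexI[of _ "f u"]) auto
    qed (rule finite_nb)
    then show False using sub[OF u(1)] u(2) by (simp add: sum_distrib_right)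
  qed
  obtain r where r: "leads f V x r" using forestsD(3)[OF f] by blast
  have "(x, u) \<in> (steps f V)\<^sup>* \<Longrightarrow> w u = m" for u
    by (induction rule: rtrancl_induct) (use x step in \<open>auto simp: steps_iff\<close>)
  then have "w r = m" using r by (auto simp: leads_def)
  then show False using out[of r] r mpos by (auto simp: leads_def)
qed

lemma positive_forest:
  assumes "finite V" "\<And>x y. c x y \<ge> 0" "Z nb c V > 0"
  shows "\<exists>f\<in>forests nb V. \<forall>v\<in>V. c v (f v) > 0"
proof (rule ccontr)
  assume "\<not> ?thesis"
  then have "\<And>f. f \<in> forests nb V \<Longrightarrow> \<exists>v\<in>V. c v (f v) = 0" using assms(2) by (metis less_eq_real_def)
  then have "\<And>f. f \<in> forests nb V \<Longrightarrow> wt c V f = 0" using assms(1) by (auto simp: wt_def)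
  then show False using assms(3) by (simp add: mass_def)
qed

lemma forest_Z_pos:
  assumes "finite V" "\<And>x y. c x y \<ge> 0" "f \<in> forests nb V" "\<And>v. v \<in> V \<Longrightarrow> c v (f v) > 0"
  shows "Z nb c V > 0"
proof -
  have "wt c V f \<le> Z nb c V" unfolding mass_def using assms finite_forests
    by (intro member_le_sum) (auto simp: wt_def intro!: prod_nonneg)
  moreover have "wt c V f > 0" using assms by (auto simp: wt_def intro!: prod_pos)
  ultimately show ?thesis by simp
qed

text \<open>The difference of the hitting mass and \<open>g\<close> times the total mass is
  subharmonic in \<open>V\<close> and nonpositive at all roots. Nothing about \<open>g\<close>
  refers to the shape of \<open>V\<close>, so one globally superharmonic \<open>g\<close> serves all
  finite sets at once.\<close>

lemma hit_bound:
  assumes V: "finite V" and nn: "\<And>x y. c x y \<ge> 0" and r: "r \<notin> V"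
    and super: "\<And>v. v \<in> V \<Longrightarrow> (\<Sum>y\<in>nb v. c v y * g y) \<le> (\<Sum>y\<in>nb v. c v y) * g v"
    and g: "\<And>v. v \<notin> V \<Longrightarrow> g v \<ge> 0" "g r \<ge> 1"
  shows "mass nb c V (\<lambda>f. leads f V x r) \<le> g x * Z nb c V"
proof (cases "Z nb c V > 0")
  case False
  then have z: "Z nb c V = 0" using mass_nonneg[of c V] nn by (metis less_eq_real_def)
  have "mass nb c V (\<lambda>f. leads f V x r) \<le> Z nb c V" by (rule mass_mono[OF V nn]) auto
  then show ?thesis using z mass_nonneg[of c V] nn by simp
next
  case True
  then obtain f where f: "f \<in> forests nb V" "\<And>v. v \<in> V \<Longrightarrow> c v (f v) > 0" using positive_forest[of V c] V nn by blast
  define w where "w y = mass nb c V (\<lambda>f. leads f V y r) - g y * Z nb c V" for y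
  have "w x \<le> 0"
  proof (rule maximum_principle[where c=c and w=w, OF V f(1)])
    fix v assume v: "v \<in> V"
    have "(\<Sum>y\<in>nb v. c v y * g y) * Z nb c V \<le> (\<Sum>y\<in>nb v. c v y) * g v * Z nb c V"
      using super[OF v] True by (intro mult_right_mono) auto
    moreover have "(\<Sum>y\<in>nb v. c v y * w y) = (\<Sum>y\<in>nb v. c v y * mass nb c V (\<lambda>f. leads f V y r)) - (\<Sum>y\<in>nb v. c v y * g y) * Z nb c V"
      by (simp add: w_def algebra_simps sum_subtractf sum_distrib_left)
    ultimately show "(\<Sum>y\<in>nb v. c v y) * w v \<le> (\<Sum>y\<in>nb v. c v y * w y)"
      using harmonic_leads[OF V v, of c r] by (simp add: w_def algebra_simps)
  next
    fix v assume v: "v \<notin> V"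
    show "w v \<le> 0"
    proof (cases "v = r")
      case True
      have "mass nb c V (\<lambda>f. leads f V v r) \<le> Z nb c V" by (rule mass_mono[OF V nn]) auto
      also have "\<dots> \<le> g v * Z nb c V" using True g(2) \<open>Z nb c V > 0\<close> by (simp add: mult_right_mono[of 1 "g r" "Z nb c V", simplified])
      finally show ?thesis by (simp add: w_def)
    next
      case False
      then have "mass nb c V (\<lambda>f. leads f V v r) = 0" using v by (simp add: mass_def leads_outside)
      then show ?thesis using g(1)[OF v] True by (simp add: w_def)
    qed
  qed (use f nn in auto)
  then show ?thesis by (simp add: w_def)
qed

section \<open>Revealing paths\<close>

lemma trail_agree_steps:
  assumes "\<And>v. v \<in> trail f V W \<Longrightarrow> f v = g v" "w \<in> W \<union> trail f V W" "(w, u) \<in> (steps f V)\<^sup>*"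
  shows "(w, u) \<in> (steps g V)\<^sup>*"
  using assms(3)
proof (induction rule: rtrancl_induct)
  case (step y z)
  have "y \<in> trail f V W" using assms(2) step(1,2) unfolding trail_def
    by (auto simp: steps_iff intro: rtrancl_trans)
  then have "(y, z) \<in> steps g V" using step(2) assms(1) by (auto simp: steps_iff)
  then show ?case using step.IH by simp
qed simp

lemma trail_agree_steps_iff:
  assumes "\<And>v. v \<in> trail f V W \<Longrightarrow> f v = g v" "w \<in> W"
  shows "(w, u) \<in> (steps f V)\<^sup>* \<longleftrightarrow> (w, u) \<in> (steps g V)\<^sup>*"
proof
  assume "(w, u) \<in> (steps g V)\<^sup>*"
  then show "(w, u) \<in> (steps f V)\<^sup>*"
  proof (induction rule: rtrancl_induct)
    case (step y z)
    then have "y \<in> trail f V W" using assms(2) by (auto simp: trail_def steps_iff)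
    then have "(y, z) \<in> steps f V" using step(2) assms(1) by (auto simp: steps_iff)
    then show ?case using step.IH by simp
  qed simp
next
  assume "(w, u) \<in> (steps f V)\<^sup>*"
  then show "(w, u) \<in> (steps g V)\<^sup>*"
    by (rule trail_agree_steps[where f=f and W=W and V=V, rotated 2]) (use assms in simp_all)
qed

lemma trail_agree:
  assumes "\<And>v. v \<in> trail f V W \<Longrightarrow> f v = g v"
  shows "trail g V W = trail f V W"
proof -
  have "(w, u) \<in> (steps f V)\<^sup>* \<longleftrightarrow> (w, u) \<in> (steps g V)\<^sup>*" if "w \<in> W" for w u
    by (rule trail_agree_steps_iff[where f=f and W=W and V=V]) (use assms that in simp_all)
  then show ?thesis by (auto simp: trail_def)
qed

text \<open>A trail is closed under steps inside \<open>V\<close>. Its vertices therefore act as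
  roots for the rest, and any forest on the complement can be glued in without creating a
  cycle.\<close>

lemma splice_forest:
  fixes W :: "'v set"
  assumes f: "f \<in> forests nb V" and k: "k \<in> forests nb (V - trail f V W)"
  defines "g \<equiv> (\<lambda>v. if v \<in> trail f V W then f v else k v)"
  shows "g \<in> forests nb V" "trail g V W = trail f V W" "restrict g (V - trail f V W) = k"
proof -
  let ?A = "trail f V W"
  have ag: "\<And>v. v \<in> ?A \<Longrightarrow> f v = g v" by (simp add: g_def)
  have A: "\<exists>r. leads g V a r" if "a \<in> ?A" for a
  proof -
    obtain r where "leads f V a r" using forestsD(3)[OF f] by blast
    then show ?thesis using trail_agree_steps[of f V W g, OF ag] that by (auto simp: leads_def)
  qed
  have sk: "steps k (V - ?A) = steps g (V - ?A)" by (rule steps_cong) (simp add: g_def)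
  show "g \<in> forests nb V"
  proof (rule forestsI)
    fix v assume v: "v \<in> V"
    show "g v \<in> nb v" using v forestsD(1)[OF f v] forestsD(1)[OF k, of v] by (auto simp: g_def)
    show "\<exists>r. leads g V v r"
    proof (cases "v \<in> ?A")
      case False
      obtain r where "leads k (V - ?A) v r" using forestsD(3)[OF k] by blast
      then have r: "r \<notin> V - ?A" "(v, r) \<in> (steps g V)\<^sup>*"
        using steps_rtrancl_mono[of "V - ?A" V v r g] by (auto simp: leads_def sk)
      then show ?thesis using A[of r] leads_trans[OF r(2)] by (cases "r \<in> ?A") (auto simp: leads_def)
    qed (rule A)
  next
    fix v assume "v \<notin> V"
    then show "g v = undefined" using forestsD(2)[OF k, of v] trail_subset[of f V W] by (auto simp: g_def)
  qed
  show "trail g V W = ?A" using trail_agree[of f V W g, OF ag] .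
  show "restrict g (V - ?A) = k" using forestsD(2)[OF k] by (auto simp: g_def restrict_def fun_eq_iff)
qed

text \<open>Forests with the same revealed paths correspond to forests on the complement, and the
  weight factorizes. The function \<open>\<phi>\<close> is general so that the restricted mass and
  the total mass come from the same identity.\<close>

lemma sum_fiber:
  fixes W :: "'v set"
  assumes V: "finite V" and f: "f \<in> forests nb V"
  defines "A \<equiv> trail f V W"
  shows "(\<Sum>g | g \<in> forests nb V \<and> trail g V W = A \<and> (\<forall>v\<in>A. f v = g v). \<phi> (restrict g (V - A)) * wt c V g)
    = wt c A f * (\<Sum>k\<in>forests nb (V - A). \<phi> k * wt c (V - A) k)"
proof -
  have AV: "A \<subseteq> V" by (simp add: A_def trail_subset)
  define m where "m k = (\<lambda>v. if v \<in> A then f v else k v)" for k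
  have "(\<Sum>g | g \<in> forests nb V \<and> trail g V W = A \<and> (\<forall>v\<in>A. f v = g v). \<phi> (restrict g (V - A)) * wt c V g)
    = (\<Sum>k\<in>forests nb (V - A). wt c A f * (\<phi> k * wt c (V - A) k))"
  proof (rule sum.reindex_bij_witness[of _ m "\<lambda>g. restrict g (V - A)"])
    fix g assume g: "g \<in> {g. g \<in> forests nb V \<and> trail g V W = A \<and> (\<forall>v\<in>A. f v = g v)}"
    then show "m (restrict g (V - A)) = g" using forestsD(2)[of g nb V] by (auto simp: m_def fun_eq_iff)
    show "restrict g (V - A) \<in> forests nb (V - A)" using g by (intro forest_restrict) auto
    have "wt c V g = wt c A f * wt c (V - A) (restrict g (V - A))"
      using g V AV by (simp add: wt_def prod.subset_diff[OF AV V] mult.commute)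
    then show "wt c A f * (\<phi> (restrict g (V - A)) * wt c (V - A) (restrict g (V - A)))
        = \<phi> (restrict g (V - A)) * wt c V g" by simp
  next
    fix k assume k: "k \<in> forests nb (V - A)"
    from splice_forest[OF f, of k W] k
    show "m k \<in> {g. g \<in> forests nb V \<and> trail g V W = A \<and> (\<forall>v\<in>A. f v = g v)}"
      "restrict (m k) (V - A) = k" by (auto simp: m_def A_def)
  qed
  then show ?thesis by (simp add: sum_distrib_left)
qed

text \<open>
  Domain Markov property: given the paths issuing from \<open>W\<close>, the rest of the forest is a weighted
  forest on the complement of these paths, to which they are added as roots.
\<close>

lemma mass_reveal:
  assumes V: "finite V" and nn: "\<And>x y. c x y \<ge> 0"
    and P: "\<And>f g. f \<in> forests nb V \<Longrightarrow> g \<in> forests nb V \<Longrightarrow> P f \<Longrightarrow>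
      (\<And>v. v \<in> trail f V W \<Longrightarrow> f v = g v) \<Longrightarrow> P g"
    and Q: "\<And>f. f \<in> forests nb V \<Longrightarrow> P f \<Longrightarrow>
      mass nb c (V - trail f V W) (Q (trail f V W)) \<le> b * Z nb c (V - trail f V W)"
  shows "mass nb c V (\<lambda>f. P f \<and> Q (trail f V W) (restrict f (V - trail f V W))) \<le> b * mass nb c V P"
proof -
  define S where "S = {f \<in> forests nb V. P f}"
  \<comment> \<open>The revealed data. By its assumption \<open>P\<close> is constant on each fibre
    of \<open>D\<close>, so a bound on every fibre can simply be summed.\<close>
  define D where "D f = (trail f V W, restrict f (trail f V W))" for f
  have fin: "finite S" using finite_forests[OF V] by (simp add: S_def)
  have Deq: "D g = D f \<longleftrightarrow> trail g V W = trail f V W \<and> (\<forall>v\<in>trail f V W. f v = g v)" for f g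
    unfolding D_def prod.inject by (auto simp: restrict_def fun_eq_iff)
  let ?w = "\<lambda>f. (if Q (trail f V W) (restrict f (V - trail f V W)) then 1 else 0) * wt c V f"
  have fib: "(\<Sum>g\<in>{g\<in>S. D g = y}. ?w g) \<le> b * (\<Sum>g\<in>{g\<in>S. D g = y}. wt c V g)" if "y \<in> D ` S" for y
  proof -
    from that obtain f where f: "f \<in> forests nb V" "P f" and y: "y = D f" by (auto simp: S_def)
    let ?A = "trail f V W"
    have eq: "{g\<in>S. D g = y} = {g. g \<in> forests nb V \<and> trail g V W = ?A \<and> (\<forall>v\<in>?A. f v = g v)}"
      using P[OF f(1) _ f(2)] by (auto simp: y Deq S_def)
    have wA: "0 \<le> wt c ?A f" using nn by (auto simp: wt_def intro!: prod_nonneg)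
    have fB: "finite (forests nb (V - ?A))" using finite_forests V by blast
    have "(\<Sum>g\<in>{g\<in>S. D g = y}. ?w g)
       = (\<Sum>g | g \<in> forests nb V \<and> trail g V W = ?A \<and> (\<forall>v\<in>?A. f v = g v).
            (if Q ?A (restrict g (V - ?A)) then 1 else 0) * wt c V g)"
      unfolding eq by (rule sum.cong) auto
    also have "\<dots> = wt c ?A f * (\<Sum>k\<in>forests nb (V - ?A). (if Q ?A k then 1 else 0) * wt c (V - ?A) k)"
      by (rule sum_fiber[OF V f(1)])
    also have "(\<Sum>k\<in>forests nb (V - ?A). (if Q ?A k then 1 else 0) * wt c (V - ?A) k) = mass nb c (V - ?A) (Q ?A)"
      unfolding mass_def using fB by (intro sum.mono_neutral_cong_right) auto
    also have "wt c ?A f * \<dots> \<le> wt c ?A f * (b * Z nb c (V - ?A))"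
      using Q[OF f] wA by (intro mult_left_mono) auto
    also have "\<dots> = b * (wt c ?A f * (\<Sum>k\<in>forests nb (V - ?A). 1 * wt c (V - ?A) k))"
      by (simp add: mass_def)
    also have "\<dots> = b * (\<Sum>g\<in>{g\<in>S. D g = y}. wt c V g)"
      unfolding eq using sum_fiber[OF V f(1), where W=W and \<phi>="\<lambda>_. 1" and c=c] by simp
    finally show ?thesis .
  qed
  have "mass nb c V (\<lambda>f. P f \<and> Q (trail f V W) (restrict f (V - trail f V W))) = (\<Sum>f\<in>S. ?w f)"
    unfolding mass_def using fin by (intro sum.mono_neutral_cong_left) (auto simp: S_def)
  also have "\<dots> = (\<Sum>y\<in>D ` S. \<Sum>g\<in>{g\<in>S. D g = y}. ?w g)"
    by (rule sum.image_gen[OF fin])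
  also have "\<dots> \<le> (\<Sum>y\<in>D ` S. b * (\<Sum>g\<in>{g\<in>S. D g = y}. wt c V g))"
    by (rule sum_mono) (rule fib)
  also have "\<dots> = b * (\<Sum>f\<in>S. wt c V f)"
    by (simp add: sum_distrib_left[symmetric] sum.image_gen[OF fin, of "wt c V" D, symmetric])
  also have "\<dots> = b * mass nb c V P" by (simp add: mass_def S_def)
  finally show ?thesis .
qed

text \<open>Here \<open>z\<close> is a root, by the definition of \<open>leads\<close>, and trails
  contain no roots: the two groups of paths are disjoint except for their common end
  \<open>z\<close>.\<close>

definition meets :: "('v \<Rightarrow> 'v) \<Rightarrow> 'v set \<Rightarrow> 'v set \<Rightarrow> 'v set \<Rightarrow> 'v \<Rightarrow> bool" where
  "meets f V W1 W2 z \<longleftrightarrow> (\<forall>w\<in>W1 \<union> W2. leads f V w z) \<and> trail f V W1 \<inter> trail f V W2 = {}"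

lemma avoid_trail:
  assumes "leads f V w z" "w \<in> W2" "trail f V W1 \<inter> trail f V W2 = {}"
  shows "leads (restrict f (V - trail f V W1)) (V - trail f V W1) w z"
proof -
  let ?B = "V - trail f V W1"
  have "(w, u) \<in> (steps f V)\<^sup>* \<Longrightarrow> (w, u) \<in> (steps f ?B)\<^sup>*" for u
  proof (induction rule: rtrancl_induct)
    case (step y z)
    then have "y \<in> trail f V W2" using assms(2) by (auto simp: trail_def steps_iff)
    then have "(y, z) \<in> steps f ?B" using step(2) assms(3) by (auto simp: steps_iff)
    then show ?case using step.IH by simp
  qed simp
  then show ?thesis using assms(1) steps_cong[of ?B f "restrict f ?B"] by (auto simp: leads_def)
qed

text \<open>After the paths from \<open>W1\<close> are revealed, those from \<open>W2\<close> avoid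
  them and still lead to \<open>z\<close> in the complement. The complement is not under control,
  which is why the bound for \<open>W2\<close> is assumed for every finite \<open>B\<close>.\<close>

lemma mass_meets:
  assumes V: "finite V" and nn: "\<And>x y. c x y \<ge> 0" and z: "z \<notin> V" and b2: "b2 \<ge> 0"
    and 1: "mass nb c V (\<lambda>f. \<forall>w\<in>W1. leads f V w z) \<le> b1 * Z nb c V"
    and 2: "\<And>B. finite B \<Longrightarrow> z \<notin> B \<Longrightarrow> mass nb c B (\<lambda>f. \<forall>w\<in>W2. leads f B w z) \<le> b2 * Z nb c B"
  shows "mass nb c V (\<lambda>f. meets f V W1 W2 z) \<le> b1 * b2 * Z nb c V"
proof -
  have "mass nb c V (\<lambda>f. meets f V W1 W2 z)
     \<le> mass nb c V (\<lambda>f. (\<forall>w\<in>W1. leads f V w z) \<and>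
         (\<lambda>A k. \<forall>w\<in>W2. leads k (V - A) w z) (trail f V W1) (restrict f (V - trail f V W1)))"
    by (intro mass_mono V nn) (auto simp: meets_def intro: avoid_trail)
  also have "\<dots> \<le> b2 * mass nb c V (\<lambda>f. \<forall>w\<in>W1. leads f V w z)"
  proof (rule mass_reveal[OF V nn])
    fix f g assume "\<forall>w\<in>W1. leads f V w z" "\<And>v. v \<in> trail f V W1 \<Longrightarrow> f v = g v"
    then show "\<forall>w\<in>W1. leads g V w z"
      using trail_agree_steps_iff[where f=f and g=g and W=W1 and V=V] by (simp add: leads_def)
  next
    fix f show "mass nb c (V - trail f V W1) (\<lambda>k. \<forall>w\<in>W2. leads k (V - trail f V W1) w z)
        \<le> b2 * Z nb c (V - trail f V W1)"
      using V z by (intro 2) auto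
  qed
  also have "\<dots> \<le> b2 * (b1 * Z nb c V)" using 1 b2 by (rule mult_left_mono)
  finally show ?thesis by (simp add: mult_ac)
qed

text \<open>The point \<open>z\<close> is the earliest vertex common to all paths from
  \<open>W\<close>. Once the path from \<open>z\<close> onward is removed, \<open>z\<close> becomes
  a root, and the remaining path pieces can be grouped so that the two groups meet only
  there.\<close>

lemma last_common_ancestor:
  assumes V: "finite V" and f: "f \<in> forests nb V" and W: "finite W" "card W \<ge> 2"
    and z0: "\<And>w. w \<in> W \<Longrightarrow> (w, z0) \<in> (steps f V)\<^sup>*"
  shows "\<exists>z W1. (z, z0) \<in> (steps f V)\<^sup>* \<and> W1 \<subset> W \<and> W1 \<noteq> {} \<and>
    meets (restrict f (V - trail f V {z})) (V - trail f V {z}) W1 (W - W1) z"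
proof -
  define Cm where "Cm z \<longleftrightarrow> (\<forall>w\<in>W. (w, z) \<in> (steps f V)\<^sup>*)" for z
  \<comment> \<open>The number of vertices of \<open>V\<close> on the path from \<open>z\<close>;
    its maximum over common vertices selects the earliest one.\<close>
  define ht where "ht z = card (trail f V {z})" for z
  have "Cm z0" using z0 by (simp add: Cm_def)
  moreover have "\<forall>y. Cm y \<longrightarrow> ht y < Suc (card V)"
    unfolding ht_def less_Suc_eq_le using card_mono[OF V trail_subset] by blast
  ultimately have "\<exists>z. Cm z \<and> (\<forall>y. Cm y \<longrightarrow> ht y \<le> ht z)" by (rule ex_has_greatest_nat)
  then obtain z where z: "Cm z" and zmax: "\<And>y. Cm y \<Longrightarrow> ht y \<le> ht z" by blast
  have first: "(z, y) \<in> (steps f V)\<^sup>*" if "Cm y" for y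
  proof (rule ccontr)
    assume n: "(z, y) \<notin> (steps f V)\<^sup>*"
    have "W \<noteq> {}" using W by auto
    then obtain w where "w \<in> W" by blast
    then have yz: "(y, z) \<in> (steps f V)\<^sup>*"
      using z that n steps_linear[of w z f V y] unfolding Cm_def by blast
    then have yV: "y \<in> V" using steps_first[OF yz] n by (cases "y = z") auto
    have "trail f V {z} \<subset> trail f V {y}"
    proof
      show "trail f V {z} \<subseteq> trail f V {y}" using yz by (auto simp: trail_def intro: rtrancl_trans)
      show "trail f V {z} \<noteq> trail f V {y}" using n yV by (auto simp: trail_def)
    qed
    then have "ht z < ht y" unfolding ht_def
      by (rule psubset_card_mono[OF finite_subset[OF trail_subset V]])
    then show False using zmax[OF that] by simp
  qed
  let ?A = "trail f V {z}" let ?B = "V - ?A" let ?k = "restrict f ?B"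
  have zB: "z \<notin> ?B" by (auto simp: trail_def)
  have sk: "steps ?k ?B = steps f ?B" by (rule steps_cong) auto
  have inB: "(w, z) \<in> (steps f ?B)\<^sup>*" if "(w, z) \<in> (steps f V)\<^sup>*" for w
    using that
  proof (induction rule: converse_rtrancl_induct)
    case (step u v)
    have "u \<notin> ?A"
    proof
      assume "u \<in> ?A"
      then have "(z, u) \<in> (steps f V)\<^sup>*" by (simp add: trail_def)
      then have "(v, u) \<in> (steps f V)\<^sup>*" using step(2) by (meson rtrancl_trans)
      then show False using forest_no_return[OF f, of u] step(1) by (auto simp: steps_iff)
    qed
    then have "(u, v) \<in> steps f ?B" using step(1) by (auto simp: steps_iff)
    then show ?case using step.IH by (rule converse_rtrancl_into_rtrancl)
  qed simp
  have lead: "leads ?k ?B w z" if "w \<in> W" for w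
    using inB[of w] that z zB unfolding leads_def sk Cm_def by blast
  have up: "(x, y) \<in> (steps f V)\<^sup>*" if "(x, y) \<in> (steps ?k ?B)\<^sup>*" for x y
    using that steps_rtrancl_mono[of ?B V] unfolding sk by blast
  have zz0: "(z, z0) \<in> (steps f V)\<^sup>*" using first \<open>Cm z0\<close> .
  show ?thesis
  proof (cases "z \<in> W")
    case True
    have "trail ?k ?B {z} = {}" using zB steps_stuck[OF _ zB] by (auto simp: trail_def)
    \<comment> \<open>If \<open>z\<close> itself belongs to \<open>W\<close>, the split is into
      \<open>{z}\<close> and the rest: the path from the root \<open>z\<close> is empty, so
      disjointness is automatic.\<close>
    moreover have "W - {z} \<noteq> {}" 
    proof
      assume "W - {z} = {}"
      then have "card W \<le> card {z}" by (intro card_mono) auto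
      then show False using W by simp
    qed
    moreover have "W - (W - {z}) = {z}" using True by auto
    ultimately show ?thesis using zz0 lead True
      by (intro exI[of _ z] exI[of _ "W - {z}"]) (auto simp: meets_def)
  next
    case False
    have "W \<noteq> {}" using W by auto
    then obtain w0 where w0: "w0 \<in> W" by blast
    then have "(w0, z) \<in> (steps f V)\<^sup>*" "w0 \<noteq> z" using z False by (auto simp: Cm_def)
    then obtain y where y: "(w0, y) \<in> (steps f V)\<^sup>*" "y \<in> V" "f y = z"
      by (auto elim!: rtranclE[of w0 z] simp: steps_iff)
    \<comment> \<open>All points whose paths enter \<open>z\<close> through the same vertex
      \<open>y\<close>. This is a proper part of \<open>W\<close>, because otherwise
      \<open>y\<close> would be an earlier common vertex.\<close>
    define W1 where "W1 = {w \<in> W. (w, y) \<in> (steps f V)\<^sup>*}"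
    have yz: "(y, z) \<in> (steps f V)\<^sup>*" using y by (auto simp: steps_iff)
    have nzy: "(z, y) \<notin> (steps f V)\<^sup>*" using forest_no_return[OF f y(2)] y(3) by simp
    have "W1 \<noteq> W"
    proof
      assume "W1 = W"
      then have "Cm y" by (auto simp: W1_def Cm_def)
      then show False using first nzy by blast
    qed
    moreover have "w0 \<in> W1" using w0 y by (simp add: W1_def)
    moreover have "trail ?k ?B W1 \<inter> trail ?k ?B (W - W1) = {}"
    proof (rule equals0I)
      fix v assume v: "v \<in> trail ?k ?B W1 \<inter> trail ?k ?B (W - W1)"
      from v obtain w1 where w1: "w1 \<in> W1" "(w1, v) \<in> (steps ?k ?B)\<^sup>*" "v \<in> ?B"
        unfolding trail_def by blast
      from v obtain w2 where w2: "w2 \<in> W - W1" "(w2, v) \<in> (steps ?k ?B)\<^sup>*"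
        unfolding trail_def by blast
      note w = w1(1) w2(1) up[OF w1(2)] up[OF w2(2)] w1(3)
      have "(v, y) \<in> (steps f V)\<^sup>*"
      proof (rule ccontr)
        assume n: "(v, y) \<notin> (steps f V)\<^sup>*"
        then have "(y, v) \<in> (steps f V)\<^sup>*" using steps_linear[OF w(3), of y] w(1) by (auto simp: W1_def)
        then have "(z, v) \<in> (steps f V)\<^sup>*" using n y(3) steps_first[of y v f V] by (cases "y = v") auto
        then show False using w(5) by (auto simp: trail_def)
      qed
      then have "(w2, y) \<in> (steps f V)\<^sup>*" using w(4) by (meson rtrancl_trans)
      then show False using w(2) by (simp add: W1_def)
    qed
    moreover have W1W: "W1 \<subseteq> W" by (auto simp: W1_def)
    moreover have "\<forall>w\<in>W1 \<union> (W - W1). leads ?k ?B w z" using lead W1W by blast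
    ultimately show ?thesis using zz0 unfolding meets_def by blast
  qed
qed

end

text \<open>The inputs of the combinatorial induction, detached from the lattice. For the lattice
  \<open>p\<close> is d, \<open>D\<close> is the bracket of the difference, and \<open>S\<close> is
  the power -(d-2) of the spread, for which \<open>S_join\<close> expresses that two trees can be
  joined by an edge. The exponent p - 2 in \<open>two_point\<close> and in \<open>S_join\<close> is
  the same, and this makes the induction close.\<close>

locale tree_kernel = loc_finite nb for nb :: "'v \<Rightarrow> 'v set" +
  fixes c :: "'v \<Rightarrow> 'v \<Rightarrow> real" and D :: "'v \<Rightarrow> 'v \<Rightarrow> real" and p :: nat and Cg C2 :: real
    and S :: "'v set \<Rightarrow> real"
  assumes nn: "c x y \<ge> 0"
    and p3: "p \<ge> 3" and D_ge_1: "D x y \<ge> 1" and D_sym: "D x y = D y x"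
    and D_triangle: "D x z \<le> D x y + D y z"
    and Cg: "Cg \<ge> 0" and C2: "C2 \<ge> 0"
    and hit: "finite V \<Longrightarrow> r \<notin> V \<Longrightarrow> mass nb c V (\<lambda>f. leads f V x r) \<le> Cg / D x r ^ p * Z nb c V"
    and two_point: "finite V \<Longrightarrow> (\<Sum>z\<in>V. 1 / D a z ^ p * (1 / D b z ^ p)) \<le> C2 / D a b ^ (p - 2)"
    and S_nonneg: "S W \<ge> 0" and S_single: "S {w} \<ge> 1"
    and S_join: "finite W1 \<Longrightarrow> finite W2 \<Longrightarrow> W1 \<inter> W2 = {} \<Longrightarrow> w1 \<in> W1 \<Longrightarrow> w2 \<in> W2 \<Longrightarrow>
      S W1 * S W2 / D w1 w2 ^ (p - 2) \<le> S (W1 \<union> W2)"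
begin

abbreviation F where "F x y \<equiv> 1 / D x y ^ p"

lemma D_pos: "D x y > 0" using D_ge_1[of x y] by simp

lemma F_nonneg: "F x y \<ge> 0" using D_pos by (simp add: less_imp_le)

lemma inverse_power_le: "0 < a \<Longrightarrow> a \<le> 2 * b \<Longrightarrow> 1 / b ^ n \<le> 2 ^ n / (a::real) ^ n"
proof -
  assume a: "0 < a" "a \<le> 2 * b"
  then have "a ^ n \<le> (2 * b) ^ n" by (intro power_mono) auto
  then show ?thesis using a by (simp add: field_simps power_mult_distrib)
qed

text \<open>At least one of \<open>D a z\<close> and \<open>D z r\<close> is half of
  \<open>D a r\<close> or more, so \<open>F a r\<close> can be pulled out and a two-point sum
  remains. The outcome is again of the form \<open>F a r + F b r\<close>, so the induction
  reproduces its own hypothesis.\<close>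

lemma three_point:
  assumes V: "finite V"
  shows "(\<Sum>z\<in>V. F a z * F b z * F z r) \<le> 2 ^ (2 * p + 1) * C2 * (F a r + F b r) / D a b ^ (p - 2)"
proof -
  have 1: "F a z * F z r \<le> 2 ^ p * F a r * (F a z + F r z)" for z
  proof -
    have t: "D a r \<le> D a z + D z r" by (rule D_triangle)
    consider "D a r \<le> 2 * D a z" | "D a r \<le> 2 * D z r" using t by linarith
    then show ?thesis
    proof cases
      case 1
      then have "F a z \<le> 2 ^ p / D a r ^ p" by (rule inverse_power_le[OF D_pos])
      then have "F a z * F z r \<le> (2 ^ p / D a r ^ p) * F z r" using F_nonneg by (rule mult_right_mono)
      also have "\<dots> \<le> 2 ^ p * F a r * (F a z + F r z)"
        using F_nonneg[of a r] F_nonneg[of a z] D_sym[of z r] by (simp add: distrib_left)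
      finally show ?thesis .
    next
      case 2
      then have "F z r \<le> 2 ^ p / D a r ^ p" by (rule inverse_power_le[OF D_pos])
      then have "F a z * F z r \<le> F a z * (2 ^ p / D a r ^ p)" using F_nonneg by (intro mult_left_mono)
      also have "\<dots> \<le> 2 ^ p * F a r * (F a z + F r z)"
        using mult_nonneg_nonneg[OF F_nonneg[of a r] F_nonneg[of r z]] by (simp add: distrib_left mult.commute)
      finally show ?thesis .
    qed
  qed
  have "(\<Sum>z\<in>V. F a z * F b z * F z r) \<le> (\<Sum>z\<in>V. 2 ^ p * F a r * (F a z * F b z + F r z * F b z))"
  proof (rule sum_mono)
    fix z
    have "F a z * F b z * F z r = (F a z * F z r) * F b z" by simp
    also have "\<dots> \<le> (2 ^ p * F a r * (F a z + F r z)) * F b z" using 1 F_nonneg by (rule mult_right_mono)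
    finally show "F a z * F b z * F z r \<le> 2 ^ p * F a r * (F a z * F b z + F r z * F b z)"
      by (simp only: mult.assoc distrib_right)
  qed
  also have "\<dots> = 2 ^ p * F a r * ((\<Sum>z\<in>V. F a z * F b z) + (\<Sum>z\<in>V. F r z * F b z))"
    by (simp only: sum_distrib_left sum.distrib distrib_left)
  also have "\<dots> \<le> 2 ^ p * F a r * (C2 / D a b ^ (p - 2) + C2 / D r b ^ (p - 2))"
    using two_point[OF V] F_nonneg by (intro mult_left_mono add_mono) auto
  also have "\<dots> = 2 ^ p * C2 * (F a r / D a b ^ (p - 2) + F a r * (1 / D b r ^ (p - 2)))"
    using D_sym[of r b] by (simp add: algebra_simps)
  also have "\<dots> \<le> 2 ^ p * C2 * (F a r / D a b ^ (p - 2) + 2 ^ p * (F a r + F b r) / D a b ^ (p - 2))"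
  proof -
    have 22: "(2::real) ^ (p - 2) \<le> 2 ^ p" by (rule power_increasing) auto
    have "F a r * (1 / D b r ^ (p - 2)) \<le> 2 ^ p * (F a r + F b r) / D a b ^ (p - 2)"
    proof (cases "D a b \<le> 2 * D b r")
      case True
      then have "1 / D b r ^ (p - 2) \<le> 2 ^ (p - 2) / D a b ^ (p - 2)" by (rule inverse_power_le[OF D_pos])
      also have "\<dots> \<le> 2 ^ p / D a b ^ (p - 2)" using 22 D_pos[of a b] by (simp add: divide_right_mono)
      finally have "F a r * (1 / D b r ^ (p - 2)) \<le> F a r * (2 ^ p / D a b ^ (p - 2))"
        using F_nonneg by (intro mult_left_mono)
      also have "\<dots> \<le> (F a r + F b r) * (2 ^ p / D a b ^ (p - 2))"
        using F_nonneg[of b r] D_pos[of a b] by (intro mult_right_mono) auto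
      finally show ?thesis by (simp add: mult.commute)
    next
      \<comment> \<open>Now \<open>b\<close> is much closer to \<open>r\<close> than to
        \<open>a\<close>. Of the \<open>p\<close> powers of \<open>D a r\<close>, two are given to
        \<open>D b r\<close> to complete \<open>F b r\<close>; the other \<open>p - 2\<close> supply
        the power of \<open>D a b\<close>.\<close>
      case False
      have t: "D a b \<le> D a r + D b r" using D_triangle[of a b r] D_sym[of r b] by simp
      then have ar: "D a b \<le> 2 * D a r" "D b r \<le> D a r" using False by linarith+
      have pp: "x ^ p = x ^ (p - 2) * x ^ 2" for x :: real 
      proof -
        have "p = (p - 2) + 2" using p3 by simp
        then show ?thesis by (metis power_add)
      qed
      have "F a r * (1 / D b r ^ (p - 2)) = 1 / D a r ^ (p - 2) * (1 / D b r ^ (p - 2) * (1 / D a r ^ 2))"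
        by (simp add: pp)
      also have "\<dots> \<le> 1 / D a r ^ (p - 2) * (1 / D b r ^ (p - 2) * (1 / D b r ^ 2))"
        using ar(2) D_pos[of b r] D_pos[of a r]
        by (intro mult_left_mono divide_left_mono power_mono) (auto simp: less_imp_le)
      also have "\<dots> = 1 / D a r ^ (p - 2) * F b r" by (simp add: pp)
      also have "\<dots> \<le> 2 ^ (p - 2) / D a b ^ (p - 2) * F b r"
        using inverse_power_le[OF D_pos ar(1)] F_nonneg by (rule mult_right_mono)
      also have "\<dots> \<le> 2 ^ p / D a b ^ (p - 2) * (F a r + F b r)"
        using 22 D_pos[of a b] F_nonneg by (intro mult_mono divide_right_mono) auto
      finally show ?thesis by (simp add: mult.commute)
    qed
    then show ?thesis using C2 by (intro mult_left_mono add_left_mono) auto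
  qed
  also have "\<dots> \<le> 2 ^ p * C2 * (2 ^ p * (F a r + F b r) / D a b ^ (p - 2) + 2 ^ p * (F a r + F b r) / D a b ^ (p - 2))"
  proof -
    have "F a r \<le> F a r + F b r" using F_nonneg by simp
    also have "\<dots> \<le> 2 ^ p * (F a r + F b r)"

    proof -
      have "1 * (F a r + F b r) \<le> 2 ^ p * (F a r + F b r)"
        by (rule mult_right_mono) (use F_nonneg[of a r] F_nonneg[of b r] in simp_all)
      then show ?thesis by simp
    qed
    finally have "F a r / D a b ^ (p - 2) \<le> 2 ^ p * (F a r + F b r) / D a b ^ (p - 2)"
      by (rule divide_right_mono) (use D_pos[of a b] in simp)
    then show ?thesis using C2 by (intro mult_left_mono add_right_mono) simp_all
  qed
  also have "\<dots> = 2 ^ (2 * p + 1) * C2 * (F a r + F b r) / D a b ^ (p - 2)"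
  proof -
    have *: "A * C * (A * X / Y + A * X / Y) = (2 * (A * A)) * C * X / Y" for A C X Y :: real
      unfolding mult_2[symmetric] by (simp only: times_divide_eq_right mult_ac)
    have "2 * p + 1 = Suc (p + p)" by simp
    then have "(2::real) ^ (2 * p + 1) = 2 * (2 ^ p * 2 ^ p)" by (simp only: power_Suc power_add)
    show ?thesis unfolding * \<open>(2::real) ^ (2 * p + 1) = 2 * (2 ^ p * 2 ^ p)\<close> ..
  qed
  finally show ?thesis .
qed

abbreviation FS where "FS W r \<equiv> \<Sum>w\<in>W. F w r"

lemma FS_nonneg: "FS W r \<ge> 0" by (intro sum_nonneg F_nonneg)

lemma Z_nonneg: "Z nb c V \<ge> 0" by (rule mass_nonneg) (rule nn)

lemma sum_split_le:
  fixes g :: "'v \<Rightarrow> real"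
  assumes W: "finite W" "W1 \<subseteq> W" and b: "\<And>w. w \<in> W \<Longrightarrow> g w \<ge> 0"
  shows "(\<Sum>w1\<in>W1. \<Sum>w2\<in>W - W1. g w1 + g w2) \<le> 2 * card W * (\<Sum>w\<in>W. g w)"
proof -
  have fin: "finite W1" "finite (W - W1)" using W finite_subset by auto
  have "(\<Sum>w1\<in>W1. \<Sum>w2\<in>W - W1. g w1 + g w2) = card (W - W1) * sum g W1 + card W1 * sum g (W - W1)"
    by (simp add: sum.distrib sum_distrib_right mult.commute)
  also have "\<dots> \<le> card W * sum g W + card W * sum g W"
    using W b fin by (intro add_mono mult_mono sum_mono2 sum_nonneg of_nat_mono card_mono) auto
  finally show ?thesis by (simp add: mult.commute)
qed

text \<open>The common core of the next two estimates: a union bound over the last common ancestor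
  \<open>z\<close> and the split of \<open>W\<close>, then revealing the path from \<open>z\<close>,
  then \<open>mass_meets\<close>. The event \<open>P z\<close> and its bound \<open>G z\<close>
  record what is still demanded of the path from \<open>z\<close>: to reach a given root, or nothing
  at all.\<close>

lemma last_ancestor_sum_bound:
  assumes V: "finite V" and W: "finite W" and I: "finite I" and K: "K \<ge> 0"
    and lead: "\<And>B r X. finite B \<Longrightarrow> r \<notin> B \<Longrightarrow> X \<subset> W \<Longrightarrow> X \<noteq> {} \<Longrightarrow>
      mass nb c B (\<lambda>f. \<forall>w\<in>X. leads f B w r) \<le> K * S X * FS X r * Z nb c B"
    and E: "\<And>f. f \<in> forests nb V \<Longrightarrow> E f \<Longrightarrow> \<exists>z\<in>I. \<exists>X. P z f \<and> X \<subset> W \<and> X \<noteq> {} \<and>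
      meets (restrict f (V - trail f V {z})) (V - trail f V {z}) X (W - X) z"
    and P: "\<And>z f g. P z f \<Longrightarrow> (\<And>v. v \<in> trail f V {z} \<Longrightarrow> f v = g v) \<Longrightarrow> P z g"
    and G: "\<And>z. z \<in> I \<Longrightarrow> mass nb c V (P z) \<le> G z * Z nb c V"
    and H: "\<And>a b. H a b \<ge> 0" "\<And>a b. (\<Sum>z\<in>I. F a z * F b z * G z) \<le> H a b / D a b ^ (p - 2)"
    and M: "M \<ge> 0" "\<And>X. X \<subset> W \<Longrightarrow> (\<Sum>a\<in>X. \<Sum>b\<in>W - X. H a b) \<le> M"
  shows "mass nb c V E \<le> 2 ^ card W * (K * K * S W * M * Z nb c V)"
proof -
  let ?X = "{X. X \<subset> W \<and> X \<noteq> {}}"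
  let ?Q = "\<lambda>(z, X) f. P z f \<and>
    (\<lambda>A k. z \<notin> V - A \<and> meets k (V - A) X (W - X) z) (trail f V {z}) (restrict f (V - trail f V {z}))"
  let ?b = "\<lambda>z X. K * K * (S X * S (W - X)) * (FS X z * FS (W - X) z)"
  have finX: "finite ?X" using W by (rule finite_subset[rotated, OF finite_Pow_iff[THEN iffD2]]) auto
  have "mass nb c V E \<le> (\<Sum>i\<in>I \<times> ?X. mass nb c V (?Q i))"
  proof (rule mass_Un_le[OF V nn])
    show "finite (I \<times> ?X)" using I finX by simp
    fix f assume "f \<in> forests nb V" "E f"
    then obtain z X where "z \<in> I" "P z f" "X \<subset> W" "X \<noteq> {}"
      "meets (restrict f (V - trail f V {z})) (V - trail f V {z}) X (W - X) z" using E by blast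
    moreover have "z \<notin> V - trail f V {z}" by (auto simp: trail_def)
    ultimately show "\<exists>i\<in>I \<times> ?X. ?Q i f" by (intro bexI[of _ "(z, X)"]) auto
  qed
  also have "\<dots> \<le> (\<Sum>(z, X)\<in>I \<times> ?X. ?b z X * (G z * Z nb c V))"
  proof (rule sum_mono)
    fix i assume "i \<in> I \<times> ?X"
    then obtain z X where i: "i = (z, X)" "z \<in> I" and X: "X \<subset> W" "X \<noteq> {}" by auto
    have X': "W - X \<subset> W" "W - X \<noteq> {}" and fin: "finite X" "finite (W - X)" using X W finite_subset by auto
    have b: "0 \<le> K * S X * FS X z" for X using K S_nonneg FS_nonneg by simp
    have b0: "0 \<le> (K * S X * FS X z) * (K * S (W - X) * FS (W - X) z)" by (intro mult_nonneg_nonneg b)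
    have "mass nb c V (?Q i) \<le> ((K * S X * FS X z) * (K * S (W - X) * FS (W - X) z)) * mass nb c V (P z)"
      unfolding i split
    proof (rule mass_reveal[OF V nn])
      fix f
      let ?B = "V - trail f V {z}"
      have fB: "finite ?B" using V by simp
      show "mass nb c ?B (\<lambda>k. z \<notin> ?B \<and> meets k ?B X (W - X) z)
          \<le> (K * S X * FS X z) * (K * S (W - X) * FS (W - X) z) * Z nb c ?B"
      proof (cases "z \<in> ?B")
        case True
        then show ?thesis using mult_nonneg_nonneg[OF b0 Z_nonneg] by (simp add: mass_def)
      next
        case False
        show ?thesis
          using mass_meets[OF fB nn False b lead[OF fB False X] lead[OF _ _ X']] False fin by simp
      qed
    qed (use P in blast)
    also have "\<dots> \<le> ((K * S X * FS X z) * (K * S (W - X) * FS (W - X) z)) * (G z * Z nb c V)"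
      using G[OF i(2)] b0 by (rule mult_left_mono)
    finally show "mass nb c V (?Q i) \<le> (case i of (z, X) \<Rightarrow> ?b z X * (G z * Z nb c V))"
      by (simp add: i mult_ac)
  qed
  also have "\<dots> = (\<Sum>X\<in>?X. \<Sum>z\<in>I. ?b z X * (G z * Z nb c V))"
    by (subst sum.swap) (simp add: sum.cartesian_product)
  also have "\<dots> \<le> (\<Sum>X\<in>?X. K * K * S W * M * Z nb c V)"
  proof (rule sum_mono)
    fix X assume "X \<in> ?X"
    then have X: "X \<subset> W" and fin: "finite X" "finite (W - X)" and un: "X \<union> (W - X) = W"
      using W finite_subset by auto
    have "(\<Sum>z\<in>I. FS X z * FS (W - X) z * G z) = (\<Sum>z\<in>I. \<Sum>a\<in>X. \<Sum>b\<in>W - X. F a z * F b z * G z)"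
      unfolding sum_product unfolding sum_distrib_right ..
    also have "\<dots> = (\<Sum>a\<in>X. \<Sum>b\<in>W - X. \<Sum>z\<in>I. F a z * F b z * G z)"
      by (subst sum.swap, rule sum.cong[OF refl], rule sum.swap)
    also have "\<dots> \<le> (\<Sum>a\<in>X. \<Sum>b\<in>W - X. H a b / D a b ^ (p - 2))"
      by (intro sum_mono H)
    finally have "(S X * S (W - X)) * (\<Sum>z\<in>I. FS X z * FS (W - X) z * G z)
        \<le> (S X * S (W - X)) * (\<Sum>a\<in>X. \<Sum>b\<in>W - X. H a b / D a b ^ (p - 2))"
      using S_nonneg by (intro mult_left_mono) auto
    also have "\<dots> = (\<Sum>a\<in>X. \<Sum>b\<in>W - X. (S X * S (W - X) / D a b ^ (p - 2)) * H a b)"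
      by (simp add: sum_distrib_left mult_ac)
    \<comment> \<open>\<open>S_join\<close> absorbs the factor \<open>D a b ^ (p - 2)\<close>, as
      the cost of the edge from \<open>a\<close> to \<open>b\<close> joining trees on the two
      parts.\<close>
    also have "\<dots> \<le> (\<Sum>a\<in>X. \<Sum>b\<in>W - X. S W * H a b)"
    proof (intro sum_mono mult_right_mono H(1))
      fix a b assume "a \<in> X" "b \<in> W - X"
      then show "S X * S (W - X) / D a b ^ (p - 2) \<le> S W"
        using S_join[of X "W - X" a b] fin un by auto
    qed
    also have "\<dots> \<le> S W * M" unfolding sum_distrib_left[symmetric]
      by (intro mult_left_mono M X S_nonneg)
    finally have "(K * K * Z nb c V) * ((S X * S (W - X)) * (\<Sum>z\<in>I. FS X z * FS (W - X) z * G z))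
        \<le> (K * K * Z nb c V) * (S W * M)" using K Z_nonneg by (intro mult_left_mono) auto
    then show "(\<Sum>z\<in>I. ?b z X * (G z * Z nb c V)) \<le> K * K * S W * M * Z nb c V"
      by (simp only: sum_distrib_left mult_ac)
  qed
  also have "\<dots> = real (card ?X) * (K * K * S W * M * Z nb c V)" by simp
  also have "\<dots> \<le> 2 ^ card W * (K * K * S W * M * Z nb c V)"
  proof (rule mult_right_mono)
    have "card ?X \<le> card (Pow W)" using W by (intro card_mono) auto
    also have "\<dots> = 2 ^ card W" using W by (simp add: card_Pow)
    finally show "real (card ?X) \<le> 2 ^ card W" by (metis of_nat_le_iff of_nat_numeral of_nat_power)
    show "0 \<le> K * K * S W * M * Z nb c V" using K M(1) S_nonneg Z_nonneg by simp
  qed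
  finally show ?thesis .
qed

text \<open>Induction on the size of \<open>W\<close>: both parts of the split at the last common
  ancestor are smaller. The constant depends on \<open>k\<close> alone, as the hypothesis is applied
  to arbitrary finite sets and arbitrary roots.\<close>

lemma all_lead_bound:
  "\<exists>K\<ge>0. \<forall>V r W. finite V \<longrightarrow> r \<notin> V \<longrightarrow> finite W \<longrightarrow> W \<noteq> {} \<longrightarrow> card W \<le> k \<longrightarrow>
     mass nb c V (\<lambda>f. \<forall>w\<in>W. leads f V w r) \<le> K * S W * FS W r * Z nb c V"
proof (induction k)
  case 0
  show ?case by (rule exI[of _ 0]) auto
next
  case (Suc k)
  then obtain K where K: "K \<ge> 0" and IH: "\<And>V r W. finite V \<Longrightarrow> r \<notin> V \<Longrightarrow> finite W \<Longrightarrow> W \<noteq> {} \<Longrightarrow> card W \<le> k \<Longrightarrow>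
     mass nb c V (\<lambda>f. \<forall>w\<in>W. leads f V w r) \<le> K * S W * FS W r * Z nb c V" by blast
  define K3 where "K3 = Cg * (2 ^ (2 * p + 1) * C2)"
  have K3: "K3 \<ge> 0" using C2 Cg by (simp add: K3_def)
  \<comment> \<open>At most \<open>2 ^ Suc k\<close> splits, a factor \<open>K\<close> for each
    part, \<open>K3\<close> from the hitting bound and \<open>three_point\<close>, and
    \<open>2 * real (Suc k)\<close> from summing over pairs with one point in each part.\<close>
  define K' where "K' = 2 ^ Suc k * (K * K * K3 * (2 * real (Suc k)))"
  have K': "K' \<ge> 0" using K K3 by (simp add: K'_def)
  have main: "mass nb c V (\<lambda>f. \<forall>w\<in>W. leads f V w r) \<le> K' * S W * FS W r * Z nb c V"
    if V: "finite V" and r: "r \<notin> V" and W: "finite W" "card W = Suc k" "card W \<ge> 2" for V r W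
  proof -
    have "mass nb c V (\<lambda>f. \<forall>w\<in>W. leads f V w r)
        \<le> 2 ^ card W * (K * K * S W * (K3 * (2 * card W * FS W r)) * Z nb c V)"
    \<comment> \<open>The index set includes \<open>r\<close>, since the paths may merge only at the
      root.\<close>
    proof (rule last_ancestor_sum_bound[where I = "insert r V" and P = "\<lambda>z f. leads f V z r"
          and G = "\<lambda>z. Cg * F z r" and H = "\<lambda>a b. K3 * (F a r + F b r)", OF V W(1) _ K])
      fix B :: "'v set" and r' and X assume "finite B" "r' \<notin> B" and X: "X \<subset> W" "X \<noteq> {}"
      then show "mass nb c B (\<lambda>f. \<forall>w\<in>X. leads f B w r') \<le> K * S X * FS X r' * Z nb c B"
        using IH[of B r' X] V W psubset_card_mono[OF W(1) X(1)] finite_subset[of X W] by auto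
    next
      fix f assume f: "f \<in> forests nb V" and l: "\<forall>w\<in>W. leads f V w r"
      obtain z X where z: "(z, r) \<in> (steps f V)\<^sup>*" and X: "X \<subset> W" "X \<noteq> {}"
        "meets (restrict f (V - trail f V {z})) (V - trail f V {z}) X (W - X) z"
        using last_common_ancestor[OF V f W(1,3), of r] l by (auto simp: leads_def)
      have lz: "leads f V z r" using z r by (simp add: leads_def)
      moreover have "z \<in> insert r V" using leads_outside[of z V f r] lz by auto
      ultimately show "\<exists>z\<in>insert r V. \<exists>X. leads f V z r \<and> X \<subset> W \<and> X \<noteq> {} \<and>
        meets (restrict f (V - trail f V {z})) (V - trail f V {z}) X (W - X) z" using X by blast
    next
      fix z f g assume "leads f V z r" "\<And>v. v \<in> trail f V {z} \<Longrightarrow> f v = g v"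
      then show "leads g V z r"
        using trail_agree_steps_iff[where f=f and g=g and W="{z}" and V=V] by (simp add: leads_def)
    next
      fix a b
      have "(\<Sum>z\<in>insert r V. F a z * F b z * (Cg * F z r)) = Cg * (\<Sum>z\<in>insert r V. F a z * F b z * F z r)"
        by (simp only: sum_distrib_left mult_ac)
      also have "\<dots> \<le> Cg * (2 ^ (2 * p + 1) * C2 * (F a r + F b r) / D a b ^ (p - 2))"
        using V Cg by (intro mult_left_mono three_point) auto
      finally show "(\<Sum>z\<in>insert r V. F a z * F b z * (Cg * F z r)) \<le> K3 * (F a r + F b r) / D a b ^ (p - 2)"
        by (simp add: K3_def mult_ac)
    next
      fix X assume "X \<subset> W"
      then have "K3 * (\<Sum>a\<in>X. \<Sum>b\<in>W - X. F a r + F b r) \<le> K3 * (2 * card W * FS W r)"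
        using sum_split_le[of W X "\<lambda>w. F w r"] W(1) F_nonneg K3 by (intro mult_left_mono) auto
      then show "(\<Sum>a\<in>X. \<Sum>b\<in>W - X. K3 * (F a r + F b r)) \<le> K3 * (2 * card W * FS W r)"
        by (simp only: sum_distrib_left)
    next
      show "0 \<le> K3 * (2 * card W * FS W r)" using K3 FS_nonneg by simp
      show "0 \<le> K3 * (F a r + F b r)" for a b using K3 F_nonneg by simp
      show "mass nb c V (\<lambda>f. leads f V z r) \<le> Cg * F z r * Z nb c V" for z using hit[OF V r, of z] by simp
    qed (use V in simp)
    then show ?thesis by (simp add: K'_def W(2) mult_ac)
  qed
  have mono: "mass nb c V P \<le> K1 * S W * FS W r * Z nb c V \<Longrightarrow> K1 \<le> K2 \<Longrightarrow> mass nb c V P \<le> K2 * S W * FS W r * Z nb c V"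
    for V P W r K1 K2
    using S_nonneg FS_nonneg Z_nonneg by (meson mult_right_mono order_trans)
  have single: "mass nb c V (\<lambda>f. \<forall>w\<in>W. leads f V w r) \<le> Cg * S W * FS W r * Z nb c V"
    if V: "finite V" and r: "r \<notin> V" and W: "card W = 1" for V r W
  proof -
    obtain w where w: "W = {w}" using W by (auto simp: card_1_singleton_iff)
    have "mass nb c V (\<lambda>f. leads f V w r) \<le> Cg * 1 * F w r * Z nb c V" using hit[OF V r, of w] by simp
    also have "\<dots> \<le> Cg * S {w} * F w r * Z nb c V"
      using S_single Cg F_nonneg Z_nonneg by (intro mult_right_mono mult_left_mono) auto
    finally show ?thesis by (simp add: w)
  qed
  show ?case
  proof (intro exI[of _ "K + K' + Cg"] conjI allI impI)
    show "0 \<le> K + K' + Cg" using K K' Cg by simp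
    fix V :: "'v set" and r and W :: "'v set"
    assume a: "finite V" "r \<notin> V" "finite W" "W \<noteq> {}" "card W \<le> Suc k"
    then have "card W > 0" by (simp add: card_gt_0_iff)
    then consider "card W \<le> k" | "card W = 1" | "card W = Suc k" "card W \<ge> 2" using a(5) by linarith
    then show "mass nb c V (\<lambda>f. \<forall>w\<in>W. leads f V w r) \<le> (K + K' + Cg) * S W * FS W r * Z nb c V"
    proof cases
      case 1 show ?thesis by (rule mono[OF IH[OF a(1-4) 1]]) (use K' Cg in simp)
    next
      case 2 show ?thesis by (rule mono[OF single[OF a(1,2) 2]]) (use K K' in simp)
    next
      case 3 show ?thesis by (rule mono[OF main[OF a(1-3) 3]]) (use K Cg in simp)
    qed
  qed
qed

text \<open>With no root prescribed, nothing is asked of the path from \<open>z\<close>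
  (\<open>G\<close> is 1), and the two-point sum replaces the three-point sum. No decay factor in a
  root remains, only \<open>S W\<close>.\<close>

lemma common_descendant_bound:
  "\<exists>K\<ge>0. \<forall>V W. finite V \<longrightarrow> finite W \<longrightarrow> 2 \<le> card W \<longrightarrow> card W \<le> k \<longrightarrow>
     mass nb c V (\<lambda>f. \<exists>z\<in>V. \<forall>w\<in>W. (w, z) \<in> (steps f V)\<^sup>*) \<le> K * S W * Z nb c V"
proof -
  obtain K where K: "K \<ge> 0" and lead: "\<And>V r W. finite V \<Longrightarrow> r \<notin> V \<Longrightarrow> finite W \<Longrightarrow> W \<noteq> {} \<Longrightarrow> card W \<le> k \<Longrightarrow>
     mass nb c V (\<lambda>f. \<forall>w\<in>W. leads f V w r) \<le> K * S W * FS W r * Z nb c V"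
    using all_lead_bound[of k] by blast
  have "mass nb c V (\<lambda>f. \<exists>z\<in>V. \<forall>w\<in>W. (w, z) \<in> (steps f V)\<^sup>*) \<le> (2 ^ k * (K * K * (C2 * (k * k)))) * S W * Z nb c V"
    if V: "finite V" and W: "finite W" "2 \<le> card W" "card W \<le> k" for V W
  proof -
    have "mass nb c V (\<lambda>f. \<exists>z\<in>V. \<forall>w\<in>W. (w, z) \<in> (steps f V)\<^sup>*) \<le> 2 ^ card W * (K * K * S W * (C2 * (k * k)) * Z nb c V)"
    proof (rule last_ancestor_sum_bound[where I = V and P = "\<lambda>z f. True" and G = "\<lambda>z. 1" and H = "\<lambda>a b. C2", OF V W(1) V K])
      fix B :: "'v set" and r and X assume "finite B" "r \<notin> B" and X: "X \<subset> W" "X \<noteq> {}"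
      then show "mass nb c B (\<lambda>f. \<forall>w\<in>X. leads f B w r) \<le> K * S X * FS X r * Z nb c B"
        using lead[of B r X] V W psubset_card_mono[OF W(1) X(1)] finite_subset[of X W] by auto
    next
      fix f assume f: "f \<in> forests nb V" and "\<exists>z\<in>V. \<forall>w\<in>W. (w, z) \<in> (steps f V)\<^sup>*"
      then obtain z0 where z0: "z0 \<in> V" "\<And>w. w \<in> W \<Longrightarrow> (w, z0) \<in> (steps f V)\<^sup>*" by blast
      obtain z X where z: "(z, z0) \<in> (steps f V)\<^sup>*" and X: "X \<subset> W" "X \<noteq> {}"
        "meets (restrict f (V - trail f V {z})) (V - trail f V {z}) X (W - X) z"
        using last_common_ancestor[OF V f W(1,2) z0(2)] by blast
      then show "\<exists>z\<in>V. \<exists>X. True \<and> X \<subset> W \<and> X \<noteq> {} \<and>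
        meets (restrict f (V - trail f V {z})) (V - trail f V {z}) X (W - X) z"
        using steps_source[OF z z0(1)] by blast
    next
      fix X assume "X \<subset> W"
      then have "card X \<le> k" "card (W - X) \<le> k"
        using W card_mono[OF W(1), of X] card_mono[OF W(1), of "W - X"] by fastforce+
      then have "(real (card X) * real (card (W - X))) * C2 \<le> (real k * real k) * C2"
        using C2 by (intro mult_right_mono mult_mono) auto
      then show "(\<Sum>a\<in>X. \<Sum>b\<in>W - X. C2) \<le> C2 * (k * k)" by (simp add: mult_ac)
    next
      show "(\<Sum>z\<in>V. F a z * F b z * 1) \<le> C2 / D a b ^ (p - 2)" for a b using two_point[OF V, of a b] by simp
    qed (use C2 in simp_all)
    also have "\<dots> \<le> 2 ^ k * (K * K * S W * (C2 * (k * k)) * Z nb c V)"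
      using W(3) K C2 S_nonneg Z_nonneg by (intro mult_right_mono power_increasing) auto
    finally show ?thesis by (simp add: mult_ac)
  qed
  then show ?thesis using K C2 by (intro exI[of _ "2 ^ k * (K * K * (C2 * (k * k)))"]) simp
qed

end

section \<open>Convergence of local events\<close>

text \<open>Conditioning on the out-edges in \<open>X\<close> by deleting their competitors. The
  conditioned model is again a weighted forest, so harmonicity and the maximum principle apply to it
  unchanged.\<close>

definition fix_arcs :: "('v \<Rightarrow> 'v \<Rightarrow> real) \<Rightarrow> 'v set \<Rightarrow> ('v \<Rightarrow> 'v) \<Rightarrow> 'v \<Rightarrow> 'v \<Rightarrow> real" where
  "fix_arcs c X \<phi> x y = (if x \<in> X \<and> y \<noteq> \<phi> x then 0 else c x y)"

lemma fix_arcs_nonneg: "(\<And>x y. c x y \<ge> 0) \<Longrightarrow> fix_arcs c X \<phi> x y \<ge> 0"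
  by (simp add: fix_arcs_def)

context loc_finite
begin

lemma mass_fix_arcs:
  assumes V: "finite V" "X \<subseteq> V"
  shows "mass nb (fix_arcs c X \<phi>) V P = mass nb c V (\<lambda>f. (\<forall>x\<in>X. f x = \<phi> x) \<and> P f)"
proof -
  have 1: "wt (fix_arcs c X \<phi>) V f = (if \<forall>x\<in>X. f x = \<phi> x then wt c V f else 0)" for f
  proof (cases "\<forall>x\<in>X. f x = \<phi> x")
    case True
    then show ?thesis by (auto simp: wt_def fix_arcs_def intro!: prod.cong)
  next
    case False
    then obtain x where "x \<in> X" "f x \<noteq> \<phi> x" by blast
    then have "fix_arcs c X \<phi> x (f x) = 0" "x \<in> V" using V by (auto simp: fix_arcs_def)
    then have "wt (fix_arcs c X \<phi>) V f = 0" unfolding wt_def by (intro prod_zero[OF V(1)]) auto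
    then show ?thesis using False by auto
  qed
  show ?thesis unfolding mass_def 1 using finite_forests[OF V(1)]
    by (intro sum.mono_neutral_cong_right) auto
qed

text \<open>Without its out-edge \<open>x\<close> is a root; adding the out-edge to \<open>y\<close>
  closes a cycle precisely when \<open>y\<close> leads to \<open>x\<close>.\<close>

lemma mass_arc:
  assumes V: "finite V" and x: "x \<in> V" and y: "y \<in> nb x"
  shows "mass nb c V (\<lambda>f. f x = y) = c x y * mass nb c (V - {x}) (\<lambda>k. \<not> leads k (V - {x}) y x)"
proof -
  let ?B = "V - {x}"
  have sB: "steps (k(x := y)) ?B = steps k ?B" for k by (rule steps_cong) auto
  have F: "k(x := y) \<in> forests nb V" if k: "k \<in> forests nb ?B" and n: "\<not> leads k ?B y x" for k
  proof (rule forestsI)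
    let ?f = "k(x := y)"
    have up: "(a, b) \<in> (steps ?f V)\<^sup>*" if "(a, b) \<in> (steps k ?B)\<^sup>*" for a b
      using that steps_rtrancl_mono[of ?B V a b ?f] by (simp add: sB)
    obtain r where r: "leads k ?B y r" using forestsD(3)[OF k] by blast
    then have "r \<noteq> x" using n by blast
    then have "leads ?f V y r" using r up by (auto simp: leads_def)
    moreover have "(x, y) \<in> (steps ?f V)\<^sup>*" using x by (auto simp: steps_iff)
    ultimately have xr: "leads ?f V x r" by (metis leads_trans)
    fix v assume "v \<in> V"
    obtain r' where r': "leads k ?B v r'" using forestsD(3)[OF k] by blast
    show "\<exists>r. leads ?f V v r"
    proof (cases "r' = x")
      case True then show ?thesis using r' up xr leads_trans by (metis leads_def)
    next
      case False then show ?thesis using r' up by (auto simp: leads_def)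
    qed
  qed (use x y forestsD[OF k] in auto)
  have "mass nb c V (\<lambda>f. f x = y) = (\<Sum>k | k \<in> forests nb ?B \<and> \<not> leads k ?B y x. c x y * wt c ?B k)"
    unfolding mass_def
  proof (rule sum.reindex_bij_witness[of _ "\<lambda>k. k(x := y)" "\<lambda>f. restrict f ?B"])
    fix f assume "f \<in> {f. f \<in> forests nb V \<and> f x = y}"
    then have f: "f \<in> forests nb V" "f x = y" by auto
    show "(restrict f ?B)(x := y) = f" using f forestsD(2)[OF f(1)] by (auto simp: fun_eq_iff)
    have "\<not> leads (restrict f ?B) ?B y x"
    proof
      assume "leads (restrict f ?B) ?B y x"
      then have "(y, x) \<in> (steps f ?B)\<^sup>*" using steps_cong[of ?B "restrict f ?B" f] by (auto simp: leads_def)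
      then have "(f x, x) \<in> (steps f V)\<^sup>*" using steps_rtrancl_mono[of ?B V] f(2) by blast
      then show False using forest_no_return[OF f(1) x] by blast
    qed
    then show "restrict f ?B \<in> {k. k \<in> forests nb ?B \<and> \<not> leads k ?B y x}"
      using forest_restrict[OF f(1), of ?B] by auto
    have "wt c ?B (restrict f ?B) = wt c ?B f" by (auto simp: wt_def)
    then show "c x y * wt c ?B (restrict f ?B) = wt c V f"
      using f(2) V x by (simp add: wt_def prod.remove[of V x])
  next
    fix k assume "k \<in> {k. k \<in> forests nb ?B \<and> \<not> leads k ?B y x}"
    then have k: "k \<in> forests nb ?B" "\<not> leads k ?B y x" by auto
    show "restrict (k(x := y)) ?B = k" using forestsD(2)[OF k(1)] by (auto simp: fun_eq_iff restrict_def)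
    show "k(x := y) \<in> {f. f \<in> forests nb V \<and> f x = y}" using F[OF k] by simp
  qed
  then show ?thesis by (simp add: mass_def sum_distrib_left)
qed

lemma mass_not:
  assumes "finite V"
  shows "mass nb c V (\<lambda>f. \<not> P f) = Z nb c V - mass nb c V P"
proof -
  have "Z nb c V = (\<Sum>f | f \<in> forests nb V \<and> P f. wt c V f) + (\<Sum>f | f \<in> forests nb V \<and> \<not> P f. wt c V f)"
    unfolding mass_def using finite_forests[OF assms]
    by (subst sum.union_disjoint[symmetric]) (auto intro!: sum.cong)
  then show ?thesis by (simp add: mass_def)
qed

lemma Z_arcs:
  assumes V: "finite V" and x: "x \<in> V"
  shows "Z nb c V = (\<Sum>y\<in>nb x. mass nb c V (\<lambda>f. f x = y))"
proof -
  have fin: "finite (forests nb V)" by (rule finite_forests[OF V])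
  have "Z nb c V = (\<Sum>f\<in>forests nb V. \<Sum>y\<in>nb x. if f x = y then wt c V f else 0)"
    unfolding mass_def using forestsD(1)[OF _ x] finite_nb by (intro sum.cong) auto
  also have "\<dots> = (\<Sum>y\<in>nb x. \<Sum>f\<in>forests nb V. if f x = y then wt c V f else 0)" by (rule sum.swap)
  also have "\<dots> = (\<Sum>y\<in>nb x. mass nb c V (\<lambda>f. f x = y))"
    unfolding mass_def using fin by (simp add: sum.If_cases Int_def conj_commute)
  finally show ?thesis .
qed

text \<open>By harmonicity in \<open>y\<close>, this is the probability that the network walk from
  \<open>y\<close> visits \<open>x\<close> before any vertex outside \<open>V\<close>.\<close>

definition hits where "hits c V x y = mass nb c (V - {x}) (\<lambda>k. leads k (V - {x}) y x) / Z nb c (V - {x})"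

context
  fixes c :: "'v \<Rightarrow> 'v \<Rightarrow> real" assumes nn: "\<And>x y. c x y \<ge> 0"
begin

lemma Z_minus_pos:
  assumes V: "finite V" and x: "x \<in> V" and pos: "Z nb c V > 0"
  shows "Z nb c (V - {x}) > 0"
proof (rule ccontr)
  assume "\<not> ?thesis"
  then have z: "Z nb c (V - {x}) = 0" using mass_nonneg[of c "V - {x}"] nn by (metis less_eq_real_def)
  have "mass nb c V (\<lambda>f. f x = y) = 0" if "y \<in> nb x" for y
  proof -
    have "mass nb c (V - {x}) (\<lambda>k. \<not> leads k (V - {x}) y x) \<le> Z nb c (V - {x})"
      using V nn by (intro mass_mono) auto
    then have "mass nb c (V - {x}) (\<lambda>k. \<not> leads k (V - {x}) y x) = 0"
      using z mass_nonneg[of c] nn by (metis antisym)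
    then show ?thesis using mass_arc[OF V x that] by simp
  qed
  then show False using pos Z_arcs[OF V x, of c] by simp
qed

lemma mass_arc_hits:
  assumes V: "finite V" and x: "x \<in> V" and y: "y \<in> nb x" and pos: "Z nb c V > 0"
  shows "mass nb c V (\<lambda>f. f x = y) = c x y * (1 - hits c V x y) * Z nb c (V - {x})"
  using Z_minus_pos[OF V x pos] V unfolding mass_arc[OF V x y] hits_def
  by (simp add: mass_not field_simps)

lemma hits_nonneg: "hits c V x y \<ge> 0"
  unfolding hits_def using mass_nonneg[of c] nn by (intro divide_nonneg_nonneg) auto

lemma hits_le_1: "finite V \<Longrightarrow> hits c V x y \<le> 1"
  unfolding hits_def using mass_mono[of "V - {x}" c "\<lambda>k. leads k (V - {x}) y x" "\<lambda>_. True"] nn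
    mass_nonneg[of c "V - {x}" "\<lambda>_. True"] by (auto simp: divide_le_eq_1 less_eq_real_def)

lemma hits_le:
  assumes V: "finite V" and x: "x \<in> V" and pos: "Z nb c V > 0"
    and super: "\<And>v. v \<in> V - {x} \<Longrightarrow> (\<Sum>y\<in>nb v. c v y * g y) \<le> (\<Sum>y\<in>nb v. c v y) * g v"
    and g: "\<And>v. g v \<ge> 0" "g x \<ge> 1"
  shows "hits c V x y \<le> g y"
proof -
  have "mass nb c (V - {x}) (\<lambda>k. leads k (V - {x}) y x) \<le> g y * Z nb c (V - {x})"
    using V nn super g by (intro hit_bound) auto
  then show ?thesis unfolding hits_def using Z_minus_pos[OF V x pos] by (simp add: pos_divide_le_eq)
qed

text \<open>The function for the larger set is harmonic on \<open>V - {x}\<close>, nonnegative, and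
  1 at \<open>x\<close>, hence an admissible majorant in \<open>hits_le\<close>.\<close>

lemma hits_mono:
  assumes V': "finite V'" and sub: "V \<subseteq> V'" and x: "x \<in> V" and pos: "Z nb c V > 0" "Z nb c V' > 0"
  shows "hits c V x y \<le> hits c V' x y"
proof (rule hits_le)
  have xV': "x \<in> V'" using x sub by auto
  fix v assume v: "v \<in> V - {x}"
  let ?m = "\<lambda>y. mass nb c (V' - {x}) (\<lambda>k. leads k (V' - {x}) y x)"
  have "(\<Sum>y\<in>nb v. c v y * ?m y) = (\<Sum>y\<in>nb v. c v y) * ?m v"
    using v sub V' by (intro harmonic_leads) auto
  then show "(\<Sum>y\<in>nb v. c v y * hits c V' x y) \<le> (\<Sum>y\<in>nb v. c v y) * hits c V' x v"
    by (simp add: hits_def flip: sum_divide_distrib)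
next
  have "mass nb c (V' - {x}) (\<lambda>k. leads k (V' - {x}) x x) = Z nb c (V' - {x})"
    by (rule mass_cong) (simp add: leads_outside)
  then show "1 \<le> hits c V' x x" using Z_minus_pos[OF V' _ pos(2), of x] x sub by (auto simp: hits_def)
qed (use assms finite_subset hits_nonneg in auto)

text \<open>Convergence along the net of finite sets, so that the limit will be the same for all
  exhaustions.\<close>

lemma mono_converges:
  fixes h :: "'a set \<Rightarrow> real"
  assumes V0: "finite V0" and mono: "\<And>V V'. V0 \<subseteq> V \<Longrightarrow> V \<subseteq> V' \<Longrightarrow> finite V' \<Longrightarrow> h V \<le> h V'"
    and bd: "\<And>V. finite V \<Longrightarrow> h V \<le> B"
  shows "\<exists>L. (h \<longlongrightarrow> L) (finite_subsets_at_top UNIV)"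
proof -
  define A where "A = h ` {V. finite V \<and> V0 \<subseteq> V}"
  have A: "A \<noteq> {}" "bdd_above A" using V0 bd by (auto simp: A_def intro!: bdd_aboveI[of _ B])
  have up: "h V \<le> Sup A" if "finite V" "V0 \<subseteq> V" for V
    using that A by (intro cSup_upper) (auto simp: A_def)
  have "(h \<longlongrightarrow> Sup A) (finite_subsets_at_top UNIV)"
  proof (rule order_tendstoI)
    fix a assume "a < Sup A"
    then obtain V where V: "finite V" "V0 \<subseteq> V" "a < h V" using less_cSup_iff[OF A, of a] by (auto simp: A_def)
    show "eventually (\<lambda>V. a < h V) (finite_subsets_at_top UNIV)"
      unfolding eventually_finite_subsets_at_top
    proof (intro exI[of _ V] conjI allI impI)
      fix Y assume "finite Y \<and> V \<subseteq> Y \<and> Y \<subseteq> (UNIV :: 'a set)"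
      then show "a < h Y" using mono[of V Y] V by auto
    qed (use V in auto)
  next
    fix a assume a: "Sup A < a"
    show "eventually (\<lambda>V. h V < a) (finite_subsets_at_top UNIV)"
      unfolding eventually_finite_subsets_at_top
      by (intro exI[of _ V0] conjI allI impI) (use up a V0 in \<open>auto intro: le_less_trans\<close>)
  qed
  then show ?thesis by blast
qed

text \<open>The probability that \<open>f x = y\<close> is \<open>c x y * (1 - hits c V x y)\<close>
  divided by its sum over the neighbours of \<open>x\<close>, the mass of \<open>V - {x}\<close>
  cancelling. Each hitting probability is monotone in \<open>V\<close>, and
  \<open>\<epsilon>\<close> keeps the denominator from tending to 0.\<close>

lemma arc_probability_converges:
  assumes V0: "finite V0" and pos: "\<And>V. finite V \<Longrightarrow> V0 \<subseteq> V \<Longrightarrow> Z nb c V > 0"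
    and eps: "\<epsilon> > 0" "\<And>V. finite V \<Longrightarrow> V0 \<subseteq> V \<Longrightarrow> x \<in> V \<Longrightarrow> \<epsilon> \<le> (\<Sum>y\<in>nb x. c x y * (1 - hits c V x y))"
  shows "\<exists>L. ((\<lambda>V. mass nb c V (\<lambda>f. f x = y) / Z nb c V) \<longlongrightarrow> L) (finite_subsets_at_top UNIV)"
proof (cases "y \<in> nb x")
  case True
  let ?V0 = "insert x V0" let ?F = "finite_subsets_at_top (UNIV :: 'v set)"
  have "\<exists>L. ((\<lambda>V. hits c V x y) \<longlongrightarrow> L) ?F" for y
  proof (rule mono_converges[of ?V0 _ 1])
    fix V V' assume a: "?V0 \<subseteq> V" "V \<subseteq> V'" "finite V'"
    then have "Z nb c V > 0" "Z nb c V' > 0" by (intro pos; use a finite_subset in blast)+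
    then show "hits c V x y \<le> hits c V' x y" using a by (intro hits_mono) auto
  qed (use V0 hits_le_1 in auto)
  then obtain H where H: "\<And>y. ((\<lambda>V. hits c V x y) \<longlongrightarrow> H y) ?F" by metis
  let ?S = "\<lambda>h. \<Sum>y\<in>nb x. c x y * (1 - h y)"
  have ev: "eventually (\<lambda>V. finite V \<and> ?V0 \<subseteq> V) ?F"
    unfolding eventually_finite_subsets_at_top by (rule exI[of _ ?V0]) (use V0 in auto)
  have S: "((\<lambda>V. ?S (hits c V x)) \<longlongrightarrow> ?S H) ?F" by (intro tendsto_intros H)
  moreover have "eventually (\<lambda>V. \<epsilon> \<le> ?S (hits c V x)) ?F" using ev by eventually_elim (use eps in auto)
  ultimately have "\<epsilon> \<le> ?S H" by (rule tendsto_lowerbound) simp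
  then have "?S H \<noteq> 0" using eps by linarith
  then have "((\<lambda>V. c x y * (1 - hits c V x y) / ?S (hits c V x)) \<longlongrightarrow> c x y * (1 - H y) / ?S H) ?F"
    by (intro tendsto_intros H S)
  moreover have "eventually (\<lambda>V. c x y * (1 - hits c V x y) / ?S (hits c V x) = mass nb c V (\<lambda>f. f x = y) / Z nb c V) ?F"
    using ev
  proof eventually_elim
    case (elim V)
    then have V: "finite V" "x \<in> V" "Z nb c V > 0" using pos by auto
    have "Z nb c V = ?S (hits c V x) * Z nb c (V - {x})"
      unfolding Z_arcs[OF V(1,2)] sum_distrib_right by (rule sum.cong) (auto simp: mass_arc_hits V)
    then show ?case using Z_minus_pos[OF V] by (simp add: mass_arc_hits[OF V(1,2) True V(3)])
  qed
  ultimately show ?thesis by - (rule exI, erule (1) Lim_transform_eventually)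
next
  case False
  have "eventually (\<lambda>V. mass nb c V (\<lambda>f. f x = y) / Z nb c V = 0) (finite_subsets_at_top UNIV)"
    unfolding eventually_finite_subsets_at_top
  proof (intro exI[of _ "{x}"] conjI allI impI)
    fix V assume "finite V \<and> {x} \<subseteq> V \<and> V \<subseteq> UNIV"
    then have "mass nb c V (\<lambda>f. f x = y) = mass nb c V (\<lambda>f. False)"
      by (intro mass_cong) (use False forestsD(1)[of _ nb V x] in auto)
    then show "mass nb c V (\<lambda>f. f x = y) / Z nb c V = 0" by (simp add: mass_def)
  qed auto
  then show ?thesis by - (rule exI, erule tendsto_eventually)
qed

end

end

text \<open>
  Exposing the out-edges of a finite set of vertices from the lowest to the highest, the walk can
  always escape upwards from the vertex under consideration; \<open>\<psi> x\<close> bounds the probability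
  of a visit to \<open>x\<close>.
\<close>

locale drifted_network = loc_finite nb for nb :: "'v \<Rightarrow> 'v set" +
  fixes c :: "'v \<Rightarrow> 'v \<Rightarrow> real" and ht :: "'v \<Rightarrow> int" and up :: "'v \<Rightarrow> 'v" and \<psi> :: "'v \<Rightarrow> 'v \<Rightarrow> real"
  assumes c_nonneg: "c x y \<ge> 0" and up: "up x \<in> nb x" "c x (up x) > 0" "ht (up x) > ht x"
    and psi: "0 \<le> \<psi> x v" "\<psi> x v \<le> 1" "ht v \<le> ht x \<Longrightarrow> \<psi> x v = 1" "\<psi> x (up x) < 1"
    and psi_super: "(\<Sum>y\<in>nb v. c v y * \<psi> x y) \<le> (\<Sum>y\<in>nb v. c v y) * \<psi> x v"
begin

text \<open>Heights are bounded on a finite set, so going straight up leaves it. This supplies a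
  forest of positive weight on every finite set.\<close>

lemma up_forest: "finite V \<Longrightarrow> restrict up V \<in> forests nb V"
proof (rule forestsI)
  assume V: "finite V"
  define m where "m = Max (ht ` V)"
  have m: "v \<in> V \<Longrightarrow> ht v \<le> m" for v using V by (simp add: m_def)
  show "v \<in> V \<Longrightarrow> \<exists>r. leads (restrict up V) V v r" for v
  proof (induction "nat (m - ht v)" arbitrary: v rule: less_induct)
    case less
    have s: "(v, up v) \<in> (steps (restrict up V) V)\<^sup>*" using less.prems by (auto simp: steps_iff)
    show ?case
    proof (cases "up v \<in> V")
      case True
      then have "nat (m - ht (up v)) < nat (m - ht v)" using m[OF True] up(3)[of v] by auto
      then show ?thesis using less.hyps[OF _ True] leads_trans[OF s] by blast
    next
      case False then show ?thesis using s by (auto simp: leads_def)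
    qed
  qed
qed (use up in auto)

lemma Z_pos: "finite V \<Longrightarrow> Z nb c V > 0"
  using forest_Z_pos[OF _ c_nonneg up_forest] up by simp

abbreviation "top_filter \<equiv> finite_subsets_at_top (UNIV :: 'v set)"

lemma arcs_probability_converges:
  assumes "finite X"
  shows "\<exists>L. ((\<lambda>V. mass nb c V (\<lambda>f. \<forall>x\<in>X. f x = \<phi> x) / Z nb c V) \<longlongrightarrow> L) top_filter"
  using assms
proof (induction "card X" arbitrary: X rule: less_induct)
  case less
  show ?case
  proof (cases "X = {}")
    case True
    have "eventually (\<lambda>V. mass nb c V (\<lambda>f. \<forall>x\<in>X. f x = \<phi> x) / Z nb c V = 1) top_filter"
    proof (rule eventually_finite_subsets_at_top_weakI)
      fix V :: "'v set" assume "finite V"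
      then show "mass nb c V (\<lambda>f. \<forall>x\<in>X. f x = \<phi> x) / Z nb c V = 1" using True Z_pos[of V] by simp
    qed
    then show ?thesis by - (rule exI, erule tendsto_eventually)
  next
    case False
    have "Max (ht ` X) \<in> ht ` X" using less.prems False by (intro Max_in) auto
    \<comment> \<open>The highest vertex is exposed last, so all out-edges already fixed sit at its
      height or below.\<close>
    then obtain x where x: "x \<in> X" "ht x = Max (ht ` X)" by auto
    have hx: "ht v \<le> ht x" if "v \<in> X" for v using that less.prems x(2) by simp
    define X' where "X' = X - {x}"
    have X': "finite X'" "card X' < card X" "X = insert x X'" "x \<notin> X'"
      using less.prems x card_Diff1_less[OF less.prems x(1)] by (auto simp: X'_def)
    let ?p = "\<lambda>X V. mass nb c V (\<lambda>f. \<forall>x\<in>X. f x = \<phi> x) / Z nb c V"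
    obtain L' where L': "(?p X' \<longlongrightarrow> L') top_filter" using less.hyps[OF X'(2,1)] by blast
    have pn: "?p X V \<ge> 0" for X V using mass_nonneg[of c V] c_nonneg by (intro divide_nonneg_nonneg) auto
    have L'0: "L' \<ge> 0" using L' by (rule tendsto_lowerbound) (auto simp: pn)
    show ?thesis
    \<comment> \<open>If the limit for the remaining arcs is 0, conditioning on them is meaningless
      in the limit; the joint probability is squeezed to 0 instead.\<close>
    proof (cases "L' = 0")
      case True
      have "(?p X \<longlongrightarrow> 0) top_filter"
      proof (rule tendsto_sandwich[of "\<lambda>_. 0" _ _ "?p X'"])
        show "eventually (\<lambda>V. ?p X V \<le> ?p X' V) top_filter"
        proof (rule eventually_finite_subsets_at_top_weakI)
          fix V :: "'v set" assume V: "finite V"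
          show "?p X V \<le> ?p X' V" using Z_pos[OF V] X'(3)
            by (intro divide_right_mono mass_mono[OF V c_nonneg]) auto
        qed
      qed (use pn L' True in auto)
      then show ?thesis by blast
    next
      case False
      let ?c = "fix_arcs c X' \<phi>"
      have cn: "?c x y \<ge> 0" for x y by (rule fix_arcs_nonneg) (rule c_nonneg)
      have "eventually (\<lambda>V. 0 < ?p X' V) top_filter" using order_tendstoD(1)[OF L', of 0] False L'0 by auto
      then obtain V1 where V1: "finite V1" "\<And>V. finite V \<Longrightarrow> V1 \<subseteq> V \<Longrightarrow> 0 < ?p X' V"
        by (auto simp: eventually_finite_subsets_at_top)
      define V0 where "V0 = V1 \<union> X"
      have fix_eq: "mass nb ?c V P = mass nb c V (\<lambda>f. (\<forall>x\<in>X'. f x = \<phi> x) \<and> P f)" if "finite V" "V0 \<subseteq> V" for V P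
        using that X' by (intro mass_fix_arcs) (auto simp: V0_def)
      have pos: "Z nb ?c V > 0" if V: "finite V" "V0 \<subseteq> V" for V
        using V1(2)[of V] V Z_pos[OF V(1)] by (auto simp: fix_eq[OF V] V0_def zero_less_divide_iff)
      define \<epsilon> where "\<epsilon> = c x (up x) * (1 - \<psi> x (up x))"
      have e0: "\<epsilon> > 0" using up(2)[of x] psi(4)[of x] by (simp add: \<epsilon>_def)
      have e: "\<epsilon> \<le> (\<Sum>y\<in>nb x. ?c x y * (1 - hits ?c V x y))" if V: "finite V" "V0 \<subseteq> V" "x \<in> V" for V
      proof -
        have "hits ?c V x y \<le> \<psi> x y" for y
        proof (rule hits_le[OF cn V(1,3) pos[OF V(1,2)]])
          fix v
          show "(\<Sum>y\<in>nb v. ?c v y * \<psi> x y) \<le> (\<Sum>y\<in>nb v. ?c v y) * \<psi> x v"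
          proof (cases "v \<in> X'")
            case True
            \<comment> \<open>Fixing an out-edge changes the averages at \<open>v\<close>, but at
              these vertices \<open>\<psi> x\<close> attains its maximum 1, so it stays
              superharmonic for whatever weights are left.\<close>
            then have "\<psi> x v = 1" using hx X'(3) psi(3) by auto
            moreover have "(\<Sum>y\<in>nb v. ?c v y * \<psi> x y) \<le> (\<Sum>y\<in>nb v. ?c v y * 1)"
              using psi(2) cn by (intro sum_mono mult_left_mono) auto
            ultimately show ?thesis by simp
          next
            case False
            then have "?c v = c v" by (auto simp: fix_arcs_def)
            then show ?thesis using psi_super by simp
          qed
        qed (use psi in auto)
        then have "\<epsilon> \<le> ?c x (up x) * (1 - hits ?c V x (up x))"
          using X'(4) c_nonneg by (simp add: \<epsilon>_def fix_arcs_def mult_left_mono)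
        also have "\<dots> \<le> (\<Sum>y\<in>nb x. ?c x y * (1 - hits ?c V x y))"
          using up(1) finite_nb cn hits_le_1[of ?c V x, OF cn V(1)]
          by (intro member_le_sum[of "up x" "nb x" "\<lambda>y. ?c x y * (1 - hits ?c V x y)"]) auto
        finally show ?thesis .
      qed
      obtain L where L: "((\<lambda>V. mass nb ?c V (\<lambda>f. f x = \<phi> x) / Z nb ?c V) \<longlongrightarrow> L) top_filter"
        using arc_probability_converges[of ?c V0, OF cn _ pos e0 e] V1 less.prems by (auto simp: V0_def)
      have "((\<lambda>V. ?p X' V * (mass nb ?c V (\<lambda>f. f x = \<phi> x) / Z nb ?c V)) \<longlongrightarrow> L' * L) top_filter"
        by (intro tendsto_mult L' L)
      moreover have "eventually (\<lambda>V. ?p X' V * (mass nb ?c V (\<lambda>f. f x = \<phi> x) / Z nb ?c V) = ?p X V) top_filter"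
        unfolding eventually_finite_subsets_at_top
      proof (intro exI[of _ V0] conjI allI impI)
        fix V assume "finite V \<and> V0 \<subseteq> V \<and> V \<subseteq> (UNIV :: 'v set)"
        then have V: "finite V" "V0 \<subseteq> V" by auto
        have "mass nb ?c V (\<lambda>f. f x = \<phi> x) = mass nb c V (\<lambda>f. \<forall>x\<in>X. f x = \<phi> x)"
          unfolding fix_eq[OF V] X'(3) by (rule mass_cong) auto
        moreover have "Z nb ?c V = mass nb c V (\<lambda>f. \<forall>x\<in>X'. f x = \<phi> x)" unfolding fix_eq[OF V] by simp
        ultimately show "?p X' V * (mass nb ?c V (\<lambda>f. f x = \<phi> x) / Z nb ?c V) = ?p X V"
          using pos[OF V] by simp
      qed (use V1 less.prems in \<open>auto simp: V0_def\<close>)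
      ultimately show ?thesis by - (rule exI, erule (1) Lim_transform_eventually)
    qed
  qed
qed

lemma local_event_converges:
  assumes X: "finite X"
  shows "\<exists>L. ((\<lambda>V. mass nb c V (\<lambda>f. R (restrict f X)) / Z nb c V) \<longlongrightarrow> L) top_filter"
proof -
  define \<Phi> where "\<Phi> = {\<phi> \<in> PiE X nb. R \<phi>}"
  have fin: "finite \<Phi>" unfolding \<Phi>_def
    by (rule finite_subset[OF _ finite_PiE[OF X finite_nb]]) auto
  have "\<forall>\<phi>. \<exists>L. ((\<lambda>V. mass nb c V (\<lambda>f. \<forall>x\<in>X. f x = \<phi> x) / Z nb c V) \<longlongrightarrow> L) top_filter"
    using arcs_probability_converges[OF X] by blast
  from choice[OF this] obtain L
    where L: "\<And>\<phi>. ((\<lambda>V. mass nb c V (\<lambda>f. \<forall>x\<in>X. f x = \<phi> x) / Z nb c V) \<longlongrightarrow> L \<phi>) top_filter" by blast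
  have "((\<lambda>V. \<Sum>\<phi>\<in>\<Phi>. mass nb c V (\<lambda>f. \<forall>x\<in>X. f x = \<phi> x) / Z nb c V) \<longlongrightarrow> (\<Sum>\<phi>\<in>\<Phi>. L \<phi>)) top_filter"
    by (intro tendsto_sum L)
  moreover have "eventually (\<lambda>V. (\<Sum>\<phi>\<in>\<Phi>. mass nb c V (\<lambda>f. \<forall>x\<in>X. f x = \<phi> x) / Z nb c V)
      = mass nb c V (\<lambda>f. R (restrict f X)) / Z nb c V) top_filter"
    unfolding eventually_finite_subsets_at_top
  proof (intro exI[of _ X] conjI allI impI)
    fix V assume "finite V \<and> X \<subseteq> V \<and> V \<subseteq> (UNIV :: 'v set)"
    then have V: "finite V" "X \<subseteq> V" by auto
    let ?F = "forests nb V"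
    have fF: "finite ?F" by (rule finite_forests[OF V(1)])
    have iff: "(\<forall>x\<in>X. f x = \<phi> x) \<longleftrightarrow> restrict f X = \<phi>" if "\<phi> \<in> \<Phi>" for f \<phi>
      using that by (auto simp: \<Phi>_def PiE_iff extensional_def restrict_def fun_eq_iff)
    have "mass nb c V (\<lambda>f. R (restrict f X)) = (\<Sum>f | f \<in> ?F \<and> R (restrict f X). wt c V f)" by (simp add: mass_def)
    also have "\<dots> = (\<Sum>\<phi>\<in>\<Phi>. \<Sum>f\<in>{f. f \<in> {f. f \<in> ?F \<and> R (restrict f X)} \<and> restrict f X = \<phi>}. wt c V f)"
    proof (rule sum.group[symmetric])
      show "(\<lambda>f. restrict f X) ` {f. f \<in> ?F \<and> R (restrict f X)} \<subseteq> \<Phi>"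
        using forestsD(1)[of _ nb V] V(2) by (auto simp: \<Phi>_def)
    qed (use fF fin in auto)
    also have "\<dots> = (\<Sum>\<phi>\<in>\<Phi>. mass nb c V (\<lambda>f. \<forall>x\<in>X. f x = \<phi> x))"
    proof (rule sum.cong[OF refl])
      fix \<phi> assume p: "\<phi> \<in> \<Phi>"
      have "{f. f \<in> {f. f \<in> ?F \<and> R (restrict f X)} \<and> restrict f X = \<phi>} = {f. f \<in> ?F \<and> (\<forall>x\<in>X. f x = \<phi> x)}"
        unfolding iff[OF p] using p by (auto simp: \<Phi>_def)
      then show "(\<Sum>f\<in>{f. f \<in> {f. f \<in> ?F \<and> R (restrict f X)} \<and> restrict f X = \<phi>}. wt c V f) = mass nb c V (\<lambda>f. \<forall>x\<in>X. f x = \<phi> x)"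
        by (simp add: mass_def)
    qed
    finally show "(\<Sum>\<phi>\<in>\<Phi>. mass nb c V (\<lambda>f. \<forall>x\<in>X. f x = \<phi> x) / Z nb c V) = mass nb c V (\<lambda>f. R (restrict f X)) / Z nb c V"
      by (simp add: sum_divide_distrib)
  qed (use X in auto)
  ultimately show ?thesis by - (rule exI, erule (1) Lim_transform_eventually)
qed

end

section \<open>Spanning trees of the wired network as oriented forests\<close>

definition tree_of :: "('v \<Rightarrow> 'v) \<Rightarrow> 'v set \<Rightarrow> 'v uprod set" where
  "tree_of f V = (\<lambda>v. Upair v (f v)) ` V"

definition contract :: "'v set \<Rightarrow> 'v \<Rightarrow> 'v option" where
  "contract V x = (if x \<in> V then Some x else None)"

locale simple_network = loc_finite nb for nb :: "'v \<Rightarrow> 'v set" +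
  fixes N :: "('v, 'v uprod) network" and c :: "'v \<Rightarrow> 'v \<Rightarrow> real"
  assumes Ends_N: "Ends N = (\<lambda>e. e)" and edge_iff: "Upair x y \<in> Edges N \<longleftrightarrow> y \<in> nb x"
    and Cond_N: "Cond N (Upair x y) = c x y" and c_nonneg: "c x y \<ge> 0"
begin

abbreviation wadj where "wadj V T \<equiv> adjacency (map_uprod (contract V)) T"

lemma tree_of_inj: "f \<in> forests nb V \<Longrightarrow> inj_on (\<lambda>v. Upair v (f v)) V"
proof (rule inj_onI, rule ccontr)
  fix v w assume f: "f \<in> forests nb V" and vw: "v \<in> V" "w \<in> V" "Upair v (f v) = Upair w (f w)" "v \<noteq> w"
  then have "f v = w" "f w = v" by auto
  then have "(f v, v) \<in> (steps f V)\<^sup>*" using vw(2) by (auto simp: steps_iff)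
  then show False using forest_no_return[OF f vw(1)] by simp
qed

lemma steps_wadj:
  assumes f: "f \<in> forests nb V" and p: "(x, y) \<in> (steps f V)\<^sup>*" and w: "w \<in> V" "(x, w) \<notin> (steps f V)\<^sup>*"
  shows "(contract V x, contract V y) \<in> (wadj V (tree_of f V - {Upair w (f w)}))\<^sup>*"
  using p w(2)
proof (induction rule: converse_rtrancl_induct)
  case (step u z)
  then have u: "u \<in> V" "z = f u" "u \<noteq> w" "(z, w) \<notin> (steps f V)\<^sup>*"
    by (auto simp: steps_iff intro: converse_rtrancl_into_rtrancl)
  have "Upair u (f u) \<noteq> Upair w (f w)" using inj_onD[OF tree_of_inj[OF f] _ u(1) w(1)] u(3) by blast
  then have "(contract V u, contract V z) \<in> wadj V (tree_of f V - {Upair w (f w)})"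
    using u unfolding adjacency_def tree_of_def by (auto intro!: bexI[of _ "Upair u (f u)"])
  then show ?case using step.IH u(4) by (meson converse_rtrancl_into_rtrancl)
qed simp

text \<open>The vertices whose paths run through \<open>v\<close> are attached to the rest only by
  the out-edge of \<open>v\<close>: any other edge of the tree has both ends among them or neither.
  This shows that every edge is a bridge.\<close>

lemma descendants_closed:
  assumes f: "f \<in> forests nb V" and v: "v \<in> V" and p: "(x, y) \<in> wadj V (tree_of f V - {Upair v (f v)})"
  shows "x \<in> Some ` {u \<in> V. (u, v) \<in> (steps f V)\<^sup>*} \<longleftrightarrow> y \<in> Some ` {u \<in> V. (u, v) \<in> (steps f V)\<^sup>*}"
proof -
  let ?D = "Some ` {u \<in> V. (u, v) \<in> (steps f V)\<^sup>*}"
  obtain u where u: "u \<in> V" "u \<noteq> v" "Upair (Some u) (contract V (f u)) = Upair x y"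
  proof -
    obtain e where e: "e \<in> tree_of f V" "e \<noteq> Upair v (f v)" "map_uprod (contract V) e = Upair x y"
      using p by (auto simp: adjacency_def)
    then obtain u where u: "u \<in> V" "e = Upair u (f u)" by (auto simp: tree_of_def)
    have "u \<noteq> v" using u(2) e(2) by blast
    moreover have "Upair (Some u) (contract V (f u)) = Upair x y" using e(3) u by (simp add: contract_def)
    ultimately show ?thesis using that u(1) by blast
  qed
  have "Some u \<in> ?D \<longleftrightarrow> contract V (f u) \<in> ?D"
  proof
    assume "Some u \<in> ?D"
    then have "(f u, v) \<in> (steps f V)\<^sup>*" using u(2) steps_first[of u v f V] by auto
    then show "contract V (f u) \<in> ?D" using steps_source[OF _ v] by (auto simp: contract_def)
  next
    assume "contract V (f u) \<in> ?D"
    then have "(f u, v) \<in> (steps f V)\<^sup>*" by (auto simp: contract_def split: if_splits)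
    moreover have "(u, f u) \<in> steps f V" using u(1) by (simp add: steps_iff)
    ultimately show "Some u \<in> ?D" using u(1) by (auto intro: converse_rtrancl_into_rtrancl)
  qed
  then show ?thesis using u(3) by auto
qed

lemma descendants_closed_rtrancl:
  assumes "f \<in> forests nb V" "v \<in> V" "(x, y) \<in> (wadj V (tree_of f V - {Upair v (f v)}))\<^sup>*"
  shows "x \<in> Some ` {u \<in> V. (u, v) \<in> (steps f V)\<^sup>*} \<longleftrightarrow> y \<in> Some ` {u \<in> V. (u, v) \<in> (steps f V)\<^sup>*}"
  using assms(3)
proof (induction rule: rtrancl_induct)
  case (step y z)
  then show ?case using descendants_closed[OF assms(1,2) step(2)] by simp
qed simp

lemma forest_connected:
  assumes f: "f \<in> forests nb V"
  shows "(contract V v, None) \<in> (wadj V (tree_of f V))\<^sup>*"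
proof -
  obtain r where r: "leads f V v r" using forestsD(3)[OF f] by blast
  then have "(v, r) \<in> (steps f V)\<^sup>*" "contract V r = None" by (auto simp: leads_def contract_def)
  have "(v, r) \<in> (steps f V)\<^sup>* \<Longrightarrow> (contract V v, contract V r) \<in> (wadj V (tree_of f V))\<^sup>*" for v r
  proof (induction rule: rtrancl_induct)
    case (step y z)
    then have "(contract V y, contract V z) \<in> wadj V (tree_of f V)"
      unfolding adjacency_def tree_of_def by (auto simp: steps_iff intro!: bexI[of _ "Upair y (f y)"])
    then show ?case using step.IH by simp
  qed simp
  then show ?thesis using \<open>(v, r) \<in> (steps f V)\<^sup>*\<close> \<open>contract V r = None\<close> by metis
qed

lemma wired_simps:
  "Verts (wired N V) = insert None (Some ` V)" "Edges (wired N V) = {e \<in> Edges N. set_uprod e \<inter> V \<noteq> {}}"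
  "Ends (wired N V) = map_uprod (contract V)" "Cond (wired N V) = Cond N"
  by (simp_all add: wired_def Ends_N contract_def[abs_def] fun_eq_iff)

lemma spanning_tree_iff:
  "T \<in> spanning_trees (wired N V) \<longleftrightarrow> T \<subseteq> {e \<in> Edges N. set_uprod e \<inter> V \<noteq> {}} \<and>
     joins (map_uprod (contract V)) T (insert None (Some ` V)) \<and>
     (\<forall>e\<in>T. \<forall>a b. map_uprod (contract V) e = Upair a b \<longrightarrow> (a, b) \<notin> (wadj V (T - {e}))\<^sup>*)"
proof -
  have "set_uprod (map_uprod (contract V) e) \<subseteq> insert None (Some ` V)" for e
    by (cases e) (auto simp: contract_def)
  then show ?thesis unfolding spanning_trees_def is_tree_iff_bridges wired_simps by blast
qed

lemma forest_spanning_tree: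
  assumes f: "f \<in> forests nb V" shows "tree_of f V \<in> spanning_trees (wired N V)"
  unfolding spanning_tree_iff
proof (intro conjI ballI allI impI)
  show "tree_of f V \<subseteq> {e \<in> Edges N. set_uprod e \<inter> V \<noteq> {}}"
    using forestsD(1)[OF f] by (auto simp: tree_of_def edge_iff)
  have root: "(x, None) \<in> (wadj V (tree_of f V))\<^sup>*" if "x \<in> insert None (Some ` V)" for x
    using that forest_connected[OF f] by (auto simp: contract_def split: if_splits) (metis)
  show "joins (map_uprod (contract V)) (tree_of f V) (insert None (Some ` V))"
    unfolding joins_def using root sym_adjacency_rtrancl by (metis rtrancl_trans symE)
next
  fix e a b assume e: "e \<in> tree_of f V" and ab: "map_uprod (contract V) e = Upair a b"
  obtain v where v: "v \<in> V" "e = Upair v (f v)" using e by (auto simp: tree_of_def)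
  let ?D = "Some ` {u \<in> V. (u, v) \<in> (steps f V)\<^sup>*}"
  have "Some v \<in> ?D" "contract V (f v) \<notin> ?D"
    using v(1) forest_no_return[OF f v(1)] by (auto simp: contract_def)
  moreover have "Upair (Some v) (contract V (f v)) = Upair a b" using ab v by (simp add: contract_def)
  ultimately have "a \<in> ?D \<longleftrightarrow> b \<notin> ?D" by auto
  then show "(a, b) \<notin> (wadj V (tree_of f V - {e}))\<^sup>*"
    using descendants_closed_rtrancl[OF f v(1), of a b] v(2) by blast
qed

lemma spanning_tree_forest:
  assumes T: "T \<in> spanning_trees (wired N V)"
  shows "\<exists>f\<in>forests nb V. T = tree_of f V"
proof -
  define dst where "dst x = (LEAST n. (x, None) \<in> wadj V T ^^ n)" for x
  have conn: "(Some v, None) \<in> (wadj V T)\<^sup>*" if "v \<in> V" for v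
    using T that by (auto simp: spanning_tree_iff joins_def)
  have "\<exists>u. Upair v u \<in> T \<and> dst (contract V u) < dst (Some v)" if v: "v \<in> V" for v
  proof -
    have "\<exists>n. (Some v, None) \<in> wadj V T ^^ n" using conn[OF v] by (simp add: rtrancl_power)
    then have d: "(Some v, None) \<in> wadj V T ^^ dst (Some v)" unfolding dst_def by (rule LeastI_ex)
    then obtain n where n: "dst (Some v) = Suc n" by (cases "dst (Some v)") auto
    then obtain y where y: "(Some v, y) \<in> wadj V T" "(y, None) \<in> wadj V T ^^ n"
      using d by (metis relpow_Suc_E2)
    have "dst y \<le> n" unfolding dst_def by (rule Least_le) (rule y(2))
    moreover obtain e where e: "e \<in> T" "map_uprod (contract V) e = Upair (Some v) y"
      using y(1) by (auto simp: adjacency_def)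
    moreover obtain a b where ab: "e = Upair a b" by (cases e)
    have "(a = v \<and> contract V b = y) \<or> (b = v \<and> contract V a = y)"
      using e(2) ab by (auto simp: contract_def split: if_splits)
    then have "\<exists>u. e = Upair v u \<and> contract V u = y" using ab by auto
    ultimately show ?thesis using n by auto
  qed
  then obtain h where h: "\<And>v. v \<in> V \<Longrightarrow> Upair v (h v) \<in> T \<and> dst (contract V (h v)) < dst (Some v)" by metis
  define f where "f = restrict h V"
  have lead: "\<exists>r. leads f V v r" if "v \<in> V" for v
    using that
  proof (induction "dst (Some v)" arbitrary: v rule: less_induct)
    case less
    have s: "(v, f v) \<in> (steps f V)\<^sup>*" using less.prems by (auto simp: steps_iff)
    show ?case
    proof (cases "f v \<in> V")
      case True
      then have "dst (Some (f v)) < dst (Some v)" using h[OF less.prems] less.prems by (simp add: f_def contract_def)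
      then show ?thesis using less.hyps[OF _ True] leads_trans[OF s] by blast
    next
      case False
      then show ?thesis using s by (auto simp: leads_def)
    qed
  qed
  have f: "f \<in> forests nb V"
  proof (rule forestsI)
    fix v assume v: "v \<in> V"
    then have "Upair v (h v) \<in> Edges N" using h T by (auto simp: spanning_tree_iff)
    then show "f v \<in> nb v" using v by (simp add: edge_iff f_def)
  qed (use lead in \<open>auto simp: f_def\<close>)
  have sub: "tree_of f V \<subseteq> T" using h by (auto simp: tree_of_def f_def)
  moreover have "T \<subseteq> tree_of f V"
  proof (rule subsetI, rule ccontr)
    fix e assume e: "e \<in> T" "e \<notin> tree_of f V"
    obtain a b where ab: "e = Upair a b" by (cases e)
    have "contract V x \<in> insert None (Some ` V)" for x by (simp add: contract_def)
    moreover have "joins (map_uprod (contract V)) (tree_of f V) (insert None (Some ` V))"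
      using forest_spanning_tree[OF f] unfolding spanning_tree_iff by blast
    ultimately have "(contract V a, contract V b) \<in> (wadj V (tree_of f V))\<^sup>*"
      unfolding joins_def by blast
    moreover have "(wadj V (tree_of f V))\<^sup>* \<subseteq> (wadj V (T - {e}))\<^sup>*"
      by (intro rtrancl_mono adjacency_mono) (use sub e in auto)
    ultimately have "(contract V a, contract V b) \<in> (wadj V (T - {e}))\<^sup>*" by blast
    moreover have "map_uprod (contract V) e = Upair (contract V a) (contract V b)" using ab by simp
    ultimately show False using T e(1) unfolding spanning_tree_iff by blast
  qed
  ultimately show ?thesis using f by blast
qed

text \<open>If \<open>f\<close> and \<open>g\<close> differ at \<open>v\<close>, the edge from
  \<open>v\<close> to \<open>f v\<close> is oriented the other way by \<open>g\<close>. Then the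
  \<open>g\<close>-path from \<open>v\<close> reaches the boundary without this edge, whereas for
  \<open>f\<close> deleting it separates \<open>v\<close> from the boundary.\<close>

lemma tree_of_inj_on: "inj_on (\<lambda>f. tree_of f V) (forests nb V)"
proof (rule inj_onI)
  fix f g assume f: "f \<in> forests nb V" and g: "g \<in> forests nb V" and eq: "tree_of f V = tree_of g V"
  have "f v = g v" if v: "v \<in> V" for v
  proof (rule ccontr)
    assume ne: "f v \<noteq> g v"
    have "Upair v (f v) \<in> tree_of g V" using v eq[symmetric] by (auto simp: tree_of_def)
    then obtain w where w: "w \<in> V" "Upair v (f v) = Upair w (g w)" by (auto simp: tree_of_def)
    then have w2: "f v = w" "g w = v" using ne by auto
    have "(v, w) \<notin> (steps g V)\<^sup>*" using forest_no_return[OF g w(1)] w2 by simp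
    moreover obtain r where r: "leads g V v r" using forestsD(3)[OF g] by blast
    ultimately have "(contract V v, contract V r) \<in> (wadj V (tree_of g V - {Upair w (g w)}))\<^sup>*"
      using steps_wadj[OF g _ w(1)] by (auto simp: leads_def)
    then have "(Some v, None) \<in> (wadj V (tree_of f V - {Upair v (f v)}))\<^sup>*"
      unfolding w(2) eq using v r by (simp add: contract_def leads_def)
    from descendants_closed_rtrancl[OF f v this] show False using v by auto
  qed
  then show "f = g" using forestsD(2)[OF f] forestsD(2)[OF g] by (metis ext)
qed

lemma spanning_trees_eq: "spanning_trees (wired N V) = (\<lambda>f. tree_of f V) ` forests nb V"
  using forest_spanning_tree spanning_tree_forest by blast

lemma tree_weight_forest:
  assumes f: "f \<in> forests nb V"
  shows "tree_weight (wired N V) (tree_of f V) = wt c V f"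
  using forest_spanning_tree[OF f] prod.reindex[OF tree_of_inj[OF f], of "Cond N"]
  by (simp add: tree_weight_def wired_simps wt_def tree_of_def Cond_N)

lemma sum_spanning_trees:
  "(\<Sum>T | T \<in> spanning_trees (wired N V) \<and> P T. tree_weight (wired N V) T) = mass nb c V (\<lambda>f. P (tree_of f V))"
proof -
  have "{T. T \<in> spanning_trees (wired N V) \<and> P T} = (\<lambda>f. tree_of f V) ` {f. f \<in> forests nb V \<and> P (tree_of f V)}"
    by (auto simp: spanning_trees_eq)
  then show ?thesis unfolding mass_def
    by (simp add: sum.reindex[OF inj_on_subset[OF tree_of_inj_on]] tree_weight_forest subset_iff)
qed

context
  fixes V assumes V: "finite V" and Z: "Z nb c V > 0"
begin

lemma finite_spanning_trees: "finite (spanning_trees (wired N V))"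
  unfolding spanning_trees_eq using finite_forests[OF V] by simp

lemma total_tree_weight: "(\<Sum>T\<in>spanning_trees (wired N V). tree_weight (wired N V) T) = Z nb c V"
  using sum_spanning_trees[of V "\<lambda>_. True"] by simp

lemma tree_weight_nonneg: "tree_weight (wired N V) T \<ge> 0"
proof (cases "T \<in> spanning_trees (wired N V)")
  case True
  then obtain f where "f \<in> forests nb V" "T = tree_of f V" by (auto simp: spanning_trees_eq)
  then show ?thesis by (auto simp: tree_weight_forest wt_def c_nonneg intro!: prod_nonneg)
qed (simp add: tree_weight_def)

lemma pmf_ust: "pmf (ust (wired N V)) T = tree_weight (wired N V) T / Z nb c V"
  unfolding ust_def total_tree_weight
proof (rule pmf_embed_pmf)
  show "0 \<le> tree_weight (wired N V) T / Z nb c V" for T using tree_weight_nonneg Z by simp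
  have "(\<integral>\<^sup>+ T. ennreal (tree_weight (wired N V) T / Z nb c V) \<partial>count_space UNIV)
     = (\<Sum>T\<in>spanning_trees (wired N V). ennreal (tree_weight (wired N V) T / Z nb c V))"
    by (rule nn_integral_count_space'[OF finite_spanning_trees]) (auto simp: tree_weight_def)
  also have "\<dots> = ennreal (\<Sum>T\<in>spanning_trees (wired N V). tree_weight (wired N V) T / Z nb c V)"
    using tree_weight_nonneg Z by (intro sum_ennreal) simp
  also have "\<dots> = 1" using Z by (simp add: total_tree_weight flip: sum_divide_distrib)
  finally show "(\<integral>\<^sup>+ T. ennreal (tree_weight (wired N V) T / Z nb c V) \<partial>count_space UNIV) = 1" .
qed

lemma measure_ust:
  assumes A: "A \<in> sets borel"
  shows "measure (ust_measure (wired N V)) A = mass nb c V (\<lambda>f. (\<lambda>e. e \<in> tree_of f V) \<in> A) / Z nb c V"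
proof -
  let ?p = "ust (wired N V)" let ?h = "\<lambda>(T :: 'v uprod set) e. e \<in> T" let ?S = "spanning_trees (wired N V)"
  have "measure (ust_measure (wired N V)) A = measure (measure_pmf ?p) (?h -` A)"
    unfolding ust_measure_def by (subst measure_distr) (use A in auto)
  also have "\<dots> = measure (measure_pmf ?p) {T. T \<in> ?S \<and> ?h T \<in> A}"
  proof (rule measure_eq_AE)
    have "set_pmf ?p \<subseteq> ?S" using pmf_ust by (auto simp: set_pmf_iff tree_weight_def split: if_splits)
    then show "AE T in measure_pmf ?p. T \<in> ?h -` A \<longleftrightarrow> T \<in> {T. T \<in> ?S \<and> ?h T \<in> A}"
      by (auto simp: AE_measure_pmf_iff)
  qed auto
  also have "\<dots> = (\<Sum>T | T \<in> ?S \<and> ?h T \<in> A. pmf ?p T)"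
    by (rule measure_measure_pmf_finite) (use finite_spanning_trees in auto)
  also have "\<dots> = mass nb c V (\<lambda>f. ?h (tree_of f V) \<in> A) / Z nb c V"
    by (simp add: pmf_ust sum_spanning_trees flip: sum_divide_distrib)
  finally show ?thesis .
qed

end

lemma prob_space_ust: "prob_space (ust_measure (wired N V))"
  unfolding ust_measure_def by (rule prob_space.prob_space_distr[OF prob_space_measure_pmf]) simp

lemma sets_ust: "sets (ust_measure (wired N V)) = sets borel"
  by (simp add: ust_measure_def)

text \<open>The wired tree is connected as a whole, but connections by edges inside \<open>V\<close>
  cannot pass through the wired vertex. Along such an edge the last vertex \<open>l\<close> before
  the exit from \<open>V\<close> does not change, so all paths from \<open>W\<close> visit the same
  \<open>l\<close>.\<close>

lemma same_component_common:
  assumes f: "f \<in> forests nb V" and W: "W \<noteq> {}" "W \<subseteq> V" and B: "\<And>e. e \<in> B \<Longrightarrow> set_uprod e \<subseteq> V"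
    and j: "joins (\<lambda>e. e) {e \<in> B. e \<in> tree_of f V} W"
  shows "\<exists>z\<in>V. \<forall>w\<in>W. (w, z) \<in> (steps f V)\<^sup>*"
proof -
  obtain w0 where w0: "w0 \<in> W" using W by blast
  obtain r where "(w0, r) \<in> (steps f V)\<^sup>*" "r \<notin> V" using forestsD(3)[OF f] by (auto simp: leads_def)
  then obtain l where l: "(w0, l) \<in> (steps f V)\<^sup>*" "l \<in> V" "f l \<notin> V"
    using w0 W by (auto elim!: rtranclE[of w0 r] simp: steps_iff)
  have st: "(a, l) \<in> (steps f V)\<^sup>* \<longleftrightarrow> (f a, l) \<in> (steps f V)\<^sup>*" if "a \<in> V" "f a \<in> V" for a
  proof
    assume "(a, l) \<in> (steps f V)\<^sup>*"
    then show "(f a, l) \<in> (steps f V)\<^sup>*" using that l steps_first[of a l f V] by (cases "a = l") auto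
  next
    have "(a, f a) \<in> steps f V" using that by (simp add: steps_iff)
    then show "(f a, l) \<in> (steps f V)\<^sup>* \<Longrightarrow> (a, l) \<in> (steps f V)\<^sup>*" by (rule converse_rtrancl_into_rtrancl)
  qed
  have "(w0, w) \<in> (adjacency (\<lambda>e. e) {e \<in> B. e \<in> tree_of f V})\<^sup>* \<Longrightarrow> (w, l) \<in> (steps f V)\<^sup>*" for w
  proof (induction rule: rtrancl_induct)
    case (step x y)
    then have e: "Upair x y \<in> B" "Upair x y \<in> tree_of f V" by (auto simp: adjacency_def)
    then have V: "x \<in> V" "y \<in> V" using B by fastforce+
    obtain a where a: "a \<in> V" "Upair x y = Upair a (f a)" using e(2) by (auto simp: tree_of_def)
    then show ?case using st[of a] V step.IH by auto
  qed (rule l(1))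
  then show ?thesis using j w0 l(2) by (auto simp: joins_def intro!: bexI[of _ l])
qed

end

section \<open>Topology and countability for edge configurations\<close>

lemma open_bool: "open (S :: bool set)"
proof -
  have "{True} = {False<..}" "{False} = {..<True}" by auto
  then have "open {b}" for b :: bool by (cases b) (metis open_greaterThan, metis open_lessThan)
  then have "open (\<Union>b\<in>S. {b})" by (intro open_UN) auto
  then show ?thesis by simp
qed

text \<open>Together with countability of the index type, this identifies the product sigma-algebra
  with the Borel sets of the product topology.\<close>

instance bool :: second_countable_topology
proof
  have "open = (\<lambda>S :: bool set. generate_topology UNIV S)"
    by (auto simp: fun_eq_iff open_bool intro: generate_topology.Basis)
  then show "\<exists>B::bool set set. countable B \<and> open = generate_topology B"
    by (intro exI[of _ UNIV]) (auto simp: countable_finite)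
qed

instance uprod :: (countable) countable
proof
  define g where "g e = (SOME p. e = Upair (fst p) (snd p))" for e :: "'a uprod"
  have g: "e = Upair (fst (g e)) (snd (g e))" for e
    unfolding g_def by (rule someI_ex) (cases e, auto)
  have "inj (\<lambda>e. to_nat (g e))"
    by (rule injI) (metis g to_nat_split)
  then show "\<exists>f :: 'a uprod \<Rightarrow> nat. inj f" by blast
qed

section \<open>Measures on edge configurations\<close>

definition cyl :: "'e set \<Rightarrow> ('e \<Rightarrow> bool) \<Rightarrow> ('e \<Rightarrow> bool) set" where
  "cyl J \<eta> = {\<omega>. \<forall>e\<in>J. \<omega> e = \<eta> e}"

lemma cyl_cong: "(\<And>e. e \<in> J \<Longrightarrow> \<eta> e = \<eta>' e) \<Longrightarrow> cyl J \<eta> = cyl J \<eta>'"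
  by (auto simp: cyl_def)

lemma open_cyl: "finite J \<Longrightarrow> open (cyl J \<eta>)"
proof -
  assume "finite J"
  then have "open {\<omega>. \<forall>e\<in>J. \<omega> (id e) \<in> {\<eta> e}}"
    by (rule product_topology_basis') (rule open_bool)
  then show ?thesis by (simp add: cyl_def)
qed

lemma borel_cyl [measurable]: "finite J \<Longrightarrow> cyl J \<eta> \<in> sets borel"
  by (simp add: open_cyl)

lemma closed_cyl:
  assumes J: "finite J" shows "closed (cyl J \<eta>)"
proof -
  have "- cyl J \<eta> = (\<Union>e\<in>J. cyl {e} (\<lambda>e. \<not> \<eta> e))" by (auto simp: cyl_def)
  then show ?thesis unfolding closed_def by (auto intro!: open_UN open_cyl)
qed

lemma continuous_indicator_clopen:
  assumes C: "open C" "closed C"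
  shows "continuous_on UNIV (indicator C :: _ \<Rightarrow> real)"
  unfolding continuous_on_open_vimage[OF open_UNIV]
proof (intro allI impI)
  fix B :: "real set"
  have "indicator C -` B = (if 1 \<in> B then C else {}) \<union> (if 0 \<in> B then - C else {})"
    by (auto simp: indicator_def of_bool_def split: if_splits)
  then show "open (indicator C -` B \<inter> UNIV)" using C by (auto simp: closed_def)
qed

lemma continuous_indicator_cyl: "finite J \<Longrightarrow> continuous_on UNIV (indicator (cyl J \<eta>) :: _ \<Rightarrow> real)"
  by (intro continuous_indicator_clopen open_cyl closed_cyl)

lemma measure_eqI_cyl:
  fixes M N :: "('e::countable \<Rightarrow> bool) measure"
  assumes M: "prob_space M" "sets M = sets borel" and N: "prob_space N" "sets N = sets borel"
    and eq: "\<And>J \<eta>. finite J \<Longrightarrow> measure M (cyl J \<eta>) = measure N (cyl J \<eta>)"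
  shows "M = N"
proof -
  \<comment> \<open>Two cylinders with conflicting prescriptions are disjoint, so the empty set is
    added to obtain a family stable under intersection.\<close>
  let ?E = "insert {} {cyl J \<eta> | J \<eta>. finite J} :: ('e \<Rightarrow> bool) set set"
  interpret M: prob_space M by fact
  interpret N: prob_space N by fact
  have gen: "sigma_sets UNIV ?E = sets (borel :: ('e \<Rightarrow> bool) measure)"
  proof
    show "sigma_sets UNIV ?E \<subseteq> sets (borel :: ('e \<Rightarrow> bool) measure)"
      using sets.sigma_sets_subset[of ?E borel] borel_cyl by force
    have c: "{f. f i \<in> A} \<in> sigma_sets UNIV ?E" for i :: 'e and A
    proof -
      have "{f. f i \<in> A} = (if True \<in> A then cyl {i} (\<lambda>_. True) else {}) \<union> (if False \<in> A then cyl {i} (\<lambda>_. False) else {})"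
        by (auto simp: cyl_def) (metis (full_types))+
      moreover have "cyl {i} \<eta> \<in> sigma_sets UNIV ?E" for \<eta> by (rule sigma_sets.Basic) blast
      ultimately show ?thesis by (auto intro!: sigma_sets_Un sigma_sets.Empty)
    qed
    have "sets (PiM UNIV (\<lambda>_::'e. borel :: bool measure)) = sigma_sets UNIV {{f. f i \<in> A} | i A. A \<in> sets borel}"
      by (simp add: sets_PiM_single)
    also have "\<dots> \<subseteq> sigma_sets UNIV ?E"
      by (rule sigma_sets_mono) (use c in blast)
    finally have "sets (PiM UNIV (\<lambda>_::'e. borel :: bool measure)) \<subseteq> sigma_sets UNIV ?E" .
    then show "sets (borel :: ('e \<Rightarrow> bool) measure) \<subseteq> sigma_sets UNIV ?E"
      by (simp add: sets_PiM_equal_borel)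
  qed
  have stable: "cyl J \<eta> \<inter> cyl J' \<eta>' \<in> ?E" if "finite J" "finite J'" for J J' :: "'e set" and \<eta> \<eta>'
  proof (cases "cyl J \<eta> \<inter> cyl J' \<eta>' = {}")
    case False
    then obtain \<omega> where w: "\<omega> \<in> cyl J \<eta>" "\<omega> \<in> cyl J' \<eta>'" by blast
    then have "cyl J \<eta> \<inter> cyl J' \<eta>' = cyl (J \<union> J') \<omega>" by (auto simp: cyl_def)
    then show ?thesis using that by blast
  qed auto
  show ?thesis
  proof (rule measure_eqI_generator_eq[where E = ?E and \<Omega> = UNIV and A = "\<lambda>_::nat. UNIV"])
    show "Int_stable ?E"
    proof (rule Int_stableI)
      fix A B :: "('e \<Rightarrow> bool) set" assume AB: "A \<in> ?E" "B \<in> ?E"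
      show "A \<inter> B \<in> ?E"
      proof (cases "A = {} \<or> B = {}")
        case False
        then obtain J \<eta> J' \<eta>' where "A = cyl J \<eta>" "B = cyl J' \<eta>'" "finite J" "finite J'"
          using AB by blast
        then show ?thesis using stable by simp
      qed auto
    qed
    show "emeasure M X = emeasure N X" if "X \<in> ?E" for X
      using that eq by (auto simp: M.emeasure_eq_measure N.emeasure_eq_measure)
    have "UNIV = cyl {} (\<lambda>_. True)" by (simp add: cyl_def)
    then show "range (\<lambda>_::nat. UNIV :: ('e \<Rightarrow> bool) set) \<subseteq> ?E" by auto
  qed (use M N gen in \<open>auto simp: M.emeasure_eq_measure\<close>)
qed

text \<open>Cylinders are both open and closed, so their indicators are continuous test functions,
  and cylinders determine the measure.\<close>

lemma weak_limit_unique: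
  fixes Ms :: "nat \<Rightarrow> ('e::countable \<Rightarrow> bool) measure"
  assumes M: "weak_limit Ms M" and N: "weak_limit Ms N"
  shows "M = N"
proof (rule measure_eqI_cyl)
  fix J :: "'e set" and \<eta> assume J: "finite J"
  have "integral\<^sup>L M (indicator (cyl J \<eta>) :: _ \<Rightarrow> real) = integral\<^sup>L N (indicator (cyl J \<eta>))"
  proof (rule LIMSEQ_unique)
    have "bounded (range (indicator (cyl J \<eta>) :: _ \<Rightarrow> real))"
      by (rule boundedI[of _ 1]) (auto simp: indicator_def)
    then show "(\<lambda>q. integral\<^sup>L (Ms q) (indicator (cyl J \<eta>) :: _ \<Rightarrow> real)) \<longlonglongrightarrow> integral\<^sup>L M (indicator (cyl J \<eta>))"
      "(\<lambda>q. integral\<^sup>L (Ms q) (indicator (cyl J \<eta>) :: _ \<Rightarrow> real)) \<longlonglongrightarrow> integral\<^sup>L N (indicator (cyl J \<eta>))"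
      using M N continuous_indicator_cyl[OF J] unfolding weak_limit_def by blast+
  qed
  moreover have "integral\<^sup>L K (indicator (cyl J \<eta>) :: _ \<Rightarrow> real) = measure K (cyl J \<eta>)"
    if "sets K = sets borel" for K
  proof -
    have "space K = UNIV" using sets_eq_imp_space_eq[OF that] by simp
    then show ?thesis by simp
  qed
  ultimately show "measure M (cyl J \<eta>) = measure N (cyl J \<eta>)" using M N by (simp add: weak_limit_def)
qed (use M N in \<open>auto simp: weak_limit_def\<close>)

lemma compact_configurations: "compact (UNIV :: ('e \<Rightarrow> bool) set)"
proof -
  have "compactin (product_topology (\<lambda>_. euclidean) UNIV) (PiE (UNIV :: 'e set) (\<lambda>_. UNIV :: bool set))"
    unfolding compactin_PiE by (auto intro: finite_imp_compact)
  then show ?thesis by (simp add: euclidean_product_topology)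
qed

text \<open>By compactness finitely many cylinders, on each of which \<open>f\<close> stays within
  \<open>\<epsilon> / 2\<close> of its value at the centre, cover all configurations; the union of
  their coordinate sets serves as \<open>J\<close>.\<close>

lemma continuous_almost_local:
  fixes f :: "('e \<Rightarrow> bool) \<Rightarrow> real"
  assumes f: "continuous_on UNIV f" and e: "\<epsilon> > 0"
  shows "\<exists>J. finite J \<and> (\<forall>\<omega> \<omega>'. (\<forall>e\<in>J. \<omega> e = \<omega>' e) \<longrightarrow> \<bar>f \<omega> - f \<omega>'\<bar> < \<epsilon>)"
proof -
  have "\<exists>J. finite J \<and> (\<forall>\<omega>'\<in>cyl J \<omega>. \<bar>f \<omega>' - f \<omega>\<bar> < \<epsilon> / 2)" for \<omega>
  proof -
    define B where "B = f -` ball (f \<omega>) (\<epsilon> / 2)"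
    have "open B" unfolding B_def using f open_ball by (metis continuous_on_open_vimage inf_top.right_neutral open_UNIV)
    moreover have "\<omega> \<in> B" using e by (simp add: B_def)
    ultimately have "\<exists>X. \<omega> \<in> PiE UNIV X \<and> (\<forall>i. openin euclidean (X i)) \<and> finite {i. X i \<noteq> topspace euclidean} \<and> PiE UNIV X \<subseteq> B"
      by (intro product_topology_open_contains_basis) (simp_all only: euclidean_product_topology open_openin)
    then obtain X where X: "\<omega> \<in> PiE UNIV X" "finite {i. X i \<noteq> UNIV}" "PiE UNIV X \<subseteq> B"
      by (auto simp only: topspace_euclidean)
    then have "cyl {i. X i \<noteq> UNIV} \<omega> \<subseteq> B" 
    proof -
      have "x \<in> PiE UNIV X" if "x \<in> cyl {i. X i \<noteq> UNIV} \<omega>" for x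
      proof -
        have "x i \<in> X i" for i using that X(1) by (cases "X i = UNIV") (auto simp: cyl_def PiE_iff)
        then show ?thesis by (simp add: PiE_iff)
      qed
      then show ?thesis using X(3) by blast
    qed
    then show ?thesis using X(2) by (intro exI[of _ "{i. X i \<noteq> UNIV}"]) (auto simp: B_def dist_real_def abs_minus_commute subset_iff)
  qed
  then obtain J where J: "\<And>\<omega>. finite (J \<omega>)" "\<And>\<omega> \<omega>'. \<omega>' \<in> cyl (J \<omega>) \<omega> \<Longrightarrow> \<bar>f \<omega>' - f \<omega>\<bar> < \<epsilon> / 2" by metis
  have "(UNIV :: ('e \<Rightarrow> bool) set) \<subseteq> (\<Union>\<omega>\<in>UNIV. cyl (J \<omega>) \<omega>)" by (auto simp: cyl_def)
  then obtain C where "C \<subseteq> UNIV" "finite C" and C2: "(UNIV :: ('e \<Rightarrow> bool) set) \<subseteq> (\<Union>\<omega>\<in>C. cyl (J \<omega>) \<omega>)"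
    by (rule compactE_image[OF compact_configurations, rotated]) (auto intro: open_cyl J(1))
  then have C: "finite C" "\<And>\<omega>. \<exists>\<omega>0\<in>C. \<omega> \<in> cyl (J \<omega>0) \<omega>0" by auto
  show ?thesis
  proof (intro exI[of _ "\<Union>\<omega>\<in>C. J \<omega>"] conjI allI impI)
    show "finite (\<Union>\<omega>\<in>C. J \<omega>)" using C J by auto
    fix \<omega> \<omega>' :: "'e \<Rightarrow> bool" assume a: "\<forall>e\<in>(\<Union>\<omega>\<in>C. J \<omega>). \<omega> e = \<omega>' e"
    obtain \<omega>0 where w: "\<omega>0 \<in> C" "\<omega> \<in> cyl (J \<omega>0) \<omega>0" using C(2)[of \<omega>] by blast
    then have "\<omega>' \<in> cyl (J \<omega>0) \<omega>0" using a by (auto simp: cyl_def)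
    then show "\<bar>f \<omega> - f \<omega>'\<bar> < \<epsilon>" using J(2) w(2) by (smt (verit) field_sum_of_halves)
  qed
qed

lemma weak_limitI_cyl:
  fixes Ms :: "nat \<Rightarrow> ('e::countable \<Rightarrow> bool) measure"
  assumes M: "prob_space M" "sets M = sets borel" and Ms: "\<And>q. prob_space (Ms q)" "\<And>q. sets (Ms q) = sets borel"
    and lim: "\<And>J \<eta>. finite J \<Longrightarrow> (\<lambda>q. measure (Ms q) (cyl J \<eta>)) \<longlonglongrightarrow> measure M (cyl J \<eta>)"
  shows "weak_limit Ms M"
  unfolding weak_limit_def
proof (intro conjI allI impI M)
  fix f :: "('e \<Rightarrow> bool) \<Rightarrow> real"
  assume f: "continuous_on UNIV f \<and> bounded (range f)"
  then obtain B where B: "\<And>x. \<bar>f x\<bar> \<le> B" by (auto simp: bounded_iff)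
  have fm: "f \<in> borel_measurable borel" using f by (auto intro: borel_measurable_continuous_onI)
  \<comment> \<open>The local approximation of \<open>f\<close>: all coordinates off
    \<open>J\<close> are set to False. It is a finite combination of cylinder indicators.\<close>
  define g where "g J \<omega> = (\<Sum>S\<in>Pow J. f (\<lambda>e. e \<in> S) * indicator (cyl J (\<lambda>e. e \<in> S)) \<omega>)" for J \<omega>
  have g_eq: "g J \<omega> = f (\<lambda>e. e \<in> J \<and> \<omega> e)" if J: "finite J" for J \<omega>
  proof -
    have "g J \<omega> = (\<Sum>S\<in>Pow J. if S = {e\<in>J. \<omega> e} then f (\<lambda>e. e \<in> S) else 0)"
      unfolding g_def
    proof (rule sum.cong[OF refl])
      fix S assume "S \<in> Pow J"
      then have "\<omega> \<in> cyl J (\<lambda>e. e \<in> S) \<longleftrightarrow> S = {e\<in>J. \<omega> e}" unfolding cyl_def by blast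
      then show "f (\<lambda>e. e \<in> S) * indicator (cyl J (\<lambda>e. e \<in> S)) \<omega> = (if S = {e\<in>J. \<omega> e} then f (\<lambda>e. e \<in> S) else 0)"
        by (simp add: indicator_def)
    qed
    then show ?thesis using J by simp
  qed
  have int_g: "integral\<^sup>L K (g J) = (\<Sum>S\<in>Pow J. f (\<lambda>e. e \<in> S) * measure K (cyl J (\<lambda>e. e \<in> S)))"
    and close: "(\<And>\<omega> \<omega>'. (\<forall>e\<in>J. \<omega> e = \<omega>' e) \<Longrightarrow> \<bar>f \<omega> - f \<omega>'\<bar> < \<epsilon>) \<Longrightarrow> \<bar>integral\<^sup>L K f - integral\<^sup>L K (g J)\<bar> \<le> \<epsilon>"
    if K: "prob_space K" "sets K = sets borel" and J: "finite J" for K J \<epsilon>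
  proof -
    interpret K: prob_space K by fact
    have sp: "space K = UNIV" using sets_eq_imp_space_eq[OF K(2)] by simp
    have ci: "cyl J \<eta> \<in> sets K" for \<eta> using K(2) J by simp
    have ig: "integrable K (\<lambda>\<omega>. f (\<lambda>e. e \<in> S) * indicator (cyl J (\<lambda>e. e \<in> S)) \<omega> :: real)" for S
      using ci by (intro integrable_mult_right) (simp add: K.emeasure_eq_measure)
    then show "integral\<^sup>L K (g J) = (\<Sum>S\<in>Pow J. f (\<lambda>e. e \<in> S) * measure K (cyl J (\<lambda>e. e \<in> S)))"
      unfolding g_def using ci by (subst Bochner_Integration.integral_sum) (auto simp: sp)
    have gi: "integrable K (g J)" unfolding g_def using ig by (intro Bochner_Integration.integrable_sum)
    have fi: "integrable K f"
      by (rule K.integrable_const_bound[of _ B]) (use B fm K(2) in \<open>auto simp: measurable_cong_sets[OF K(2) refl]\<close>)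
    assume cl: "\<And>\<omega> \<omega>'. (\<forall>e\<in>J. \<omega> e = \<omega>' e) \<Longrightarrow> \<bar>f \<omega> - f \<omega>'\<bar> < \<epsilon>"
    have "\<bar>f \<omega> - g J \<omega>\<bar> \<le> \<epsilon>" for \<omega> using cl[of \<omega> "\<lambda>e. e \<in> J \<and> \<omega> e"] g_eq[OF J] by (simp add: less_imp_le)
    then have "integral\<^sup>L K (\<lambda>\<omega>. \<bar>f \<omega> - g J \<omega>\<bar>) \<le> integral\<^sup>L K (\<lambda>_. \<epsilon>)"
      using fi gi by (intro integral_mono) auto
    moreover have "\<bar>integral\<^sup>L K f - integral\<^sup>L K (g J)\<bar> \<le> integral\<^sup>L K (\<lambda>\<omega>. \<bar>f \<omega> - g J \<omega>\<bar>)"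
      using fi gi integral_abs_bound[of K "\<lambda>\<omega>. f \<omega> - g J \<omega>"] by simp
    ultimately show "\<bar>integral\<^sup>L K f - integral\<^sup>L K (g J)\<bar> \<le> \<epsilon>" by (simp add: K.prob_space)
  qed
  show "(\<lambda>q. integral\<^sup>L (Ms q) f) \<longlonglongrightarrow> integral\<^sup>L M f"
  proof (rule LIMSEQ_I)
    fix r :: real assume r: "r > 0"
    obtain J where J: "finite J" and c: "\<And>\<omega> \<omega>'. (\<forall>e\<in>J. \<omega> e = \<omega>' e) \<Longrightarrow> \<bar>f \<omega> - f \<omega>'\<bar> < r / 4"
      using continuous_almost_local[of f "r / 4"] f r by auto
    have "(\<lambda>q. integral\<^sup>L (Ms q) (g J)) \<longlonglongrightarrow> integral\<^sup>L M (g J)"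
      unfolding int_g[OF M J] int_g[OF Ms J] by (intro tendsto_intros lim J)
    then obtain q0 where q0: "\<And>q. q \<ge> q0 \<Longrightarrow> \<bar>integral\<^sup>L (Ms q) (g J) - integral\<^sup>L M (g J)\<bar> < r / 4"
      using LIMSEQ_D[of _ _ "r / 4"] r by (metis real_norm_def divide_pos_pos zero_less_numeral)
    have "\<bar>integral\<^sup>L (Ms q) f - integral\<^sup>L M f\<bar> < r" if "q \<ge> q0" for q
      using q0[OF that] close[OF M J c] close[OF Ms J c, of q] r by linarith
    then show "\<exists>no. \<forall>n\<ge>no. norm (integral\<^sup>L (Ms n) f - integral\<^sup>L M f) < r" by auto
  qed
qed

section \<open>Existence of the limit measure\<close>

text \<open>Kolmogorov's extension theorem. Configurations are encoded as functions with real values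
  0 and 1, so that the theorem applies with the real line as Polish state space; \<open>b\<close>
  and \<open>T\<close> decode them.\<close>

lemma limit_measure_exists:
  fixes Ms :: "nat \<Rightarrow> ('e::countable \<Rightarrow> bool) measure"
  assumes Ms: "\<And>q. prob_space (Ms q)" "\<And>q. sets (Ms q) = sets borel"
    and lim: "\<And>J \<eta>. finite J \<Longrightarrow> (\<lambda>q. measure (Ms q) (cyl J \<eta>)) \<longlonglongrightarrow> p J \<eta>"
  shows "\<exists>M. prob_space M \<and> sets M = sets borel \<and> (\<forall>J \<eta>. finite J \<longrightarrow> measure M (cyl J \<eta>) = p J \<eta>)"
proof -
  define \<Phi> where "\<Phi> J = PiE J (\<lambda>_. {0, 1 :: real})" for J :: "'e set"
  define b where "b x e = (x e = (1::real))" for x and e :: 'e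
  have fin\<Phi>: "finite J \<Longrightarrow> finite (\<Phi> J)" for J by (auto simp: \<Phi>_def intro: finite_PiE)
  have p_nonneg: "p J \<eta> \<ge> 0" if "finite J" for J \<eta>
    by (rule LIMSEQ_le_const[OF lim[OF that]]) auto
  have p_cong: "p J \<eta> = p J \<eta>'" if "finite J" "\<And>e. e \<in> J \<Longrightarrow> \<eta> e = \<eta>' e" for J \<eta> \<eta>'
  proof -
    have "cyl J \<eta> = cyl J \<eta>'" by (rule cyl_cong) (rule that(2))
    then show ?thesis using lim[OF that(1), of \<eta>] lim[OF that(1), of \<eta>'] LIMSEQ_unique by metis
  qed
  \<comment> \<open>Consistency: a cylinder over \<open>J\<close> splits into finitely many disjoint
    cylinders over \<open>H\<close>, and finite sums pass to the limit.\<close>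
  have part: "p J (b x) = (\<Sum>y | y \<in> \<Phi> H \<and> restrict y J = x. p H (b y))"
    if H: "finite H" "J \<subseteq> H" and x: "x \<in> \<Phi> J" for J H x
  proof -
    let ?Y = "{y. y \<in> \<Phi> H \<and> restrict y J = x}"
    have J: "finite J" using H finite_subset by blast
    have fY: "finite ?Y" using fin\<Phi>[OF H(1)] by auto
    have un: "cyl J (b x) = (\<Union>y\<in>?Y. cyl H (b y))"
    proof (intro equalityI subsetI)
      fix \<omega> assume w: "\<omega> \<in> cyl J (b x)"
      define y where "y = restrict (\<lambda>e. if \<omega> e then 1 else 0 :: real) H"
      have "restrict y J = x"
        using w x H(2) by (fastforce simp: y_def cyl_def b_def \<Phi>_def PiE_def extensional_def restrict_def fun_eq_iff)
      then have "y \<in> ?Y" by (auto simp: y_def \<Phi>_def)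
      moreover have "\<omega> \<in> cyl H (b y)" by (auto simp: y_def cyl_def b_def)
      ultimately show "\<omega> \<in> (\<Union>y\<in>?Y. cyl H (b y))" by blast
    next
      fix \<omega> assume "\<omega> \<in> (\<Union>y\<in>?Y. cyl H (b y))"
      then show "\<omega> \<in> cyl J (b x)" using H(2) by (auto simp: cyl_def b_def)
    qed
    have disj: "cyl H (b y) \<inter> cyl H (b y') = {}" if "y \<in> ?Y" "y' \<in> ?Y" "y \<noteq> y'" for y y'
    proof (rule equals0I)
      fix \<omega> assume "\<omega> \<in> cyl H (b y) \<inter> cyl H (b y')"
      then have "\<And>e. e \<in> H \<Longrightarrow> y e = 1 \<longleftrightarrow> y' e = 1" by (auto simp: cyl_def b_def)
      then have "y = y'" using that(1,2) unfolding \<Phi>_def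
        by (intro PiE_ext[of y H _ y']) (auto simp: PiE_iff, metis+)
      then show False using that(3) by simp
    qed
    have "measure (Ms q) (cyl J (b x)) = (\<Sum>y\<in>?Y. measure (Ms q) (cyl H (b y)))" for q
    proof -
      interpret prob_space "Ms q" by (rule Ms)
      show ?thesis unfolding un
        by (rule finite_measure_finite_Union[OF fY]) (use H Ms(2) disj in \<open>auto simp: disjoint_family_on_def\<close>)
    qed
    moreover have "(\<lambda>q. \<Sum>y\<in>?Y. measure (Ms q) (cyl H (b y))) \<longlonglongrightarrow> (\<Sum>y\<in>?Y. p H (b y))"
      by (intro tendsto_sum lim H)
    ultimately show ?thesis using lim[OF J, of "b x"] LIMSEQ_unique by auto
  qed
  have p_empty: "p {} \<eta> = 1" for \<eta>
  proof -
    have "measure (Ms q) (cyl {} \<eta>) = 1" for q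
    proof -
      interpret prob_space "Ms q" by (rule Ms)
      have "space (Ms q) = UNIV" using sets_eq_imp_space_eq[OF Ms(2)] by simp
      then show ?thesis using prob_space by (simp add: cyl_def)
    qed
    then show ?thesis using lim[of "{}" \<eta>] by (simp add: LIMSEQ_const_iff)
  qed
  define P where "P J = embed_pmf (\<lambda>x. if x \<in> \<Phi> J then p J (b x) else 0)" for J
  have pmfP: "pmf (P J) x = (if x \<in> \<Phi> J then p J (b x) else 0)" if J: "finite J" for J x
    unfolding P_def
  proof (rule pmf_embed_pmf)
    have "(\<Sum>x\<in>\<Phi> J. p J (b x)) = 1"
    proof -
      have "{y. y \<in> \<Phi> J \<and> restrict y {} = (\<lambda>_. undefined)} = \<Phi> J" by (auto simp: restrict_def)
      then show ?thesis using part[OF J, of "{}" "\<lambda>_. undefined"] p_empty by (simp add: \<Phi>_def)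
    qed
    then show "(\<integral>\<^sup>+ x. ennreal (if x \<in> \<Phi> J then p J (b x) else 0) \<partial>count_space UNIV) = 1"
      using fin\<Phi>[OF J] p_nonneg[OF J]
      by (subst nn_integral_count_space'[of "\<Phi> J"]) (auto simp: sum_ennreal)
  qed (use p_nonneg[OF J] in auto)
  have setP: "set_pmf (P J) \<subseteq> \<Phi> J" if "finite J" for J
    using pmfP[OF that] by (auto simp: set_pmf_iff split: if_splits)
  have mapP: "P J = map_pmf (\<lambda>x. restrict x J) (P H)" if H: "finite H" "J \<subseteq> H" for J H
  proof (rule pmf_eqI)
    fix x
    have J: "finite J" using H finite_subset by blast
    have "pmf (map_pmf (\<lambda>x. restrict x J) (P H)) x = measure (measure_pmf (P H)) ((\<lambda>y. restrict y J) -` {x})"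
      by (simp add: pmf_map)
    also have "\<dots> = measure (measure_pmf (P H)) {y. y \<in> \<Phi> H \<and> restrict y J = x}"
      by (rule measure_eq_AE) (use setP[OF H(1)] in \<open>auto simp: AE_measure_pmf_iff\<close>)
    also have "\<dots> = (\<Sum>y | y \<in> \<Phi> H \<and> restrict y J = x. pmf (P H) y)"
      using fin\<Phi>[OF H(1)] by (intro measure_measure_pmf_finite) auto
    also have "\<dots> = (\<Sum>y | y \<in> \<Phi> H \<and> restrict y J = x. p H (b y))"
      by (rule sum.cong) (auto simp: pmfP[OF H(1)])
    also have "\<dots> = pmf (P J) x"
    proof (cases "x \<in> \<Phi> J")
      case True then show ?thesis using part[OF H True] by (simp add: pmfP[OF J])
    next
      case False
      then have e: "{y. y \<in> \<Phi> H \<and> restrict y J = x} = {}" using H(2) by (auto simp: \<Phi>_def PiE_iff)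
      show ?thesis using False unfolding e by (simp add: pmfP[OF J])
    qed
    finally show "pmf (P J) x = pmf (map_pmf (\<lambda>x. restrict x J) (P H)) x" by simp
  qed
  define Q where "Q J = distr (measure_pmf (P J)) (PiM J (\<lambda>_. borel :: real measure)) (\<lambda>x. restrict x J)" for J
  have rm: "(\<lambda>x. restrict x J) \<in> measurable (count_space UNIV) (PiM J (\<lambda>_. borel :: real measure))" for J :: "'e set"
    by (auto simp: space_PiM)
  have rm': "(\<lambda>x. restrict x J) \<in> measurable (measure_pmf K) (PiM J (\<lambda>_. borel :: real measure))" for J :: "'e set" and K
    using rm by (simp cong: measurable_cong_sets)
  interpret polish_projective UNIV Q
  proof (intro polish_projective.intro projective_family.intro)
    fix J H :: "'e set" assume JH: "J \<subseteq> H" "finite H" "H \<subseteq> UNIV"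
    have rHJ: "(\<lambda>f. restrict f J) \<in> measurable (PiM H (\<lambda>_. borel :: real measure)) (PiM J (\<lambda>_. borel))"
      by (rule measurable_restrict_subset[OF JH(1)])
    have "Q J = distr (measure_pmf (P H)) (PiM J (\<lambda>_. borel)) ((\<lambda>x. restrict x J) \<circ> (\<lambda>x. restrict x J))"
      unfolding Q_def mapP[OF JH(2,1)] map_pmf_rep_eq by (rule distr_distr) (use rm in auto)
    also have "((\<lambda>x. restrict x J) \<circ> (\<lambda>x. restrict x J)) = ((\<lambda>x. restrict x J) \<circ> (\<lambda>x. restrict x H :: 'e \<Rightarrow> real))"
      using JH(1) by (auto simp: fun_eq_iff restrict_def)
    also have "distr (measure_pmf (P H)) (PiM J (\<lambda>_. borel)) \<dots> = distr (Q H) (PiM J (\<lambda>_. borel)) (\<lambda>f. restrict f J)"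
      unfolding Q_def by (rule distr_distr[symmetric]) (use rm' rHJ in auto)
    finally show "Q J = distr (Q H) (PiM J (\<lambda>_. borel)) (\<lambda>f. restrict f J)" .
  next
    fix J :: "'e set" assume "finite J" "J \<subseteq> UNIV"
    show "prob_space (Q J)" unfolding Q_def by (rule prob_space.prob_space_distr[OF prob_space_measure_pmf rm'])
  qed
  define T where "T x = (\<lambda>e. x e = (1::real))" for x :: "'e \<Rightarrow> real"
  have Tm: "T \<in> measurable lim borel"
  proof -
    have "(\<lambda>x. x e = 1) \<in> measurable (PiM UNIV (\<lambda>_. borel :: real measure)) (borel :: bool measure)" for e :: 'e
    proof (rule measurableI)
      fix A :: "bool set"
      have m: "{x :: 'e \<Rightarrow> real. x e = 1} \<in> sets (PiM UNIV (\<lambda>_. borel))"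
        using measurable_sets[OF measurable_component_singleton[of e UNIV "\<lambda>_. borel :: real measure"], of "{1}"]
        by (simp add: space_PiM vimage_def)
      have "(\<lambda>x. x e = 1) -` A \<inter> space (PiM UNIV (\<lambda>_. borel :: real measure))
        = (if True \<in> A then {x. x e = 1} else {}) \<union> (if False \<in> A then - {x. x e = 1} else {})"
      proof (rule set_eqI)
        fix x :: "'e \<Rightarrow> real"
        show "x \<in> (\<lambda>x. x e = 1) -` A \<inter> space (PiM UNIV (\<lambda>_. borel :: real measure))
          \<longleftrightarrow> x \<in> (if True \<in> A then {x. x e = 1} else {}) \<union> (if False \<in> A then - {x. x e = 1} else {})"
          by (cases "x e = 1") (auto simp: space_PiM)
      qed
      moreover have "UNIV \<in> sets (PiM UNIV (\<lambda>_::'e. borel :: real measure))"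
        using sets.top[of "PiM UNIV (\<lambda>_::'e. borel :: real measure)"] by (simp add: space_PiM)
      moreover from sets.compl_sets[OF m] have "- {x. x e = 1} \<in> sets (PiM UNIV (\<lambda>_::'e. borel :: real measure))"
        by (simp add: space_PiM Compl_eq_Diff_UNIV)
      ultimately show "(\<lambda>x. x e = 1) -` A \<inter> space (PiM UNIV (\<lambda>_. borel :: real measure)) \<in> sets (PiM UNIV (\<lambda>_. borel))"
        using m by auto
    qed auto
    then have "T \<in> measurable (PiM UNIV (\<lambda>_. borel :: real measure)) (PiM UNIV (\<lambda>_. borel :: bool measure))"
      unfolding T_def by (intro measurable_PiM_single') (auto simp: space_PiM)
    then show ?thesis by (subst measurable_cong_sets[OF sets_lim sets_PiM_equal_borel[symmetric]])
  qed
  have cylT: "measure lim (T -` cyl J \<eta> \<inter> space lim) = p J \<eta>" if J: "finite J" for J \<eta>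
  proof -
    define X where "X = {x \<in> PiE J (\<lambda>_. UNIV :: real set). \<forall>e\<in>J. (x e = 1) = \<eta> e}"
    define x0 where "x0 = restrict (\<lambda>e. if \<eta> e then 1 else 0 :: real) J"
    have "X = PiE J (\<lambda>e. if \<eta> e then {1} else - {1})" by (auto simp: X_def PiE_def Pi_def extensional_def split: if_splits)
    then have XS: "X \<in> sets (PiM J (\<lambda>_. borel))" using J by (auto intro!: sets_PiM_I_finite)
    have "T -` cyl J \<eta> \<inter> space lim = emb UNIV J X"
      by (auto simp: T_def cyl_def X_def prod_emb_def space_PiM)
    then have "measure lim (T -` cyl J \<eta> \<inter> space lim) = measure (Q J) X"
      using measure_lim_emb[OF _ J XS] by simp
    also have "\<dots> = measure (measure_pmf (P J)) ((\<lambda>x. restrict x J) -` X)"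
      unfolding Q_def by (subst measure_distr[OF rm' XS]) simp
    also have "\<dots> = measure (measure_pmf (P J)) {x0}"
    proof (rule measure_eq_AE)
      have "x \<in> (\<lambda>x. restrict x J) -` X \<longleftrightarrow> x \<in> {x0}" if "x \<in> \<Phi> J" for x
      proof
        assume "x \<in> (\<lambda>x. restrict x J) -` X"
        then have "\<And>e. e \<in> J \<Longrightarrow> (x e = 1) = \<eta> e" by (auto simp: X_def)
        then show "x \<in> {x0}" using that unfolding \<Phi>_def x0_def by (auto intro!: ext simp: PiE_iff restrict_def extensional_def)
      qed (auto simp: X_def x0_def)
      then show "AE x in measure_pmf (P J). x \<in> (\<lambda>x. restrict x J) -` X \<longleftrightarrow> x \<in> {x0}"
        using setP[OF J] by (auto simp: AE_measure_pmf_iff)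
    qed auto
    also have "\<dots> = p J (b x0)" using pmfP[OF J, of x0] by (simp add: measure_pmf_single x0_def \<Phi>_def)
    also have "\<dots> = p J \<eta>" by (rule p_cong[OF J]) (simp add: b_def x0_def)
    finally show ?thesis .
  qed
  show ?thesis
  proof (intro exI[of _ "distr lim borel T"] conjI allI impI)
    show "prob_space (distr lim borel T)" by (rule P.prob_space_distr[OF Tm])
    fix J :: "'e set" and \<eta> :: "'e \<Rightarrow> bool" assume J: "finite J"
    have "measure (distr lim borel T) (cyl J \<eta>) = measure lim (T -` cyl J \<eta> \<inter> space lim)"
      by (rule measure_distr[OF Tm]) (use J in simp)
    also have "\<dots> = p J \<eta>" by (rule cylT[OF J])
    finally show "measure (distr lim borel T) (cyl J \<eta>) = p J \<eta>" .
  qed simp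
qed

section \<open>Symmetric binomial steps\<close>

text \<open>The law of a walk on the integers that holds with probability 1/2 and otherwise makes a
  step of size 1. Each such step is the sum of two fair steps of size 1/2, whence the binomial form
  with \<open>2 * m\<close> trials and no parity constraint.\<close>

primrec bin :: "nat \<Rightarrow> int \<Rightarrow> real" where
  "bin 0 k = (if k = 0 then 1 else 0)"
| "bin (Suc m) k = (bin m (k + 1) + 2 * bin m k + bin m (k - 1)) / 4"

definition int_binomial :: "nat \<Rightarrow> int \<Rightarrow> real" where
  "int_binomial n j = (if j \<ge> 0 then real (n choose nat j) else 0)"

lemma int_binomial_Suc: "int_binomial (Suc n) j = int_binomial n j + int_binomial n (j - 1)"
proof -
  consider "j < 0" | "j = 0" | "j > 0" by linarith
  then show ?thesis
  proof cases
    case 3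
    then have "nat j = Suc (nat (j - 1))" by simp
    then show ?thesis using 3 by (simp add: int_binomial_def)
  qed (auto simp: int_binomial_def)
qed

lemma bin_eq: "bin m k = int_binomial (2 * m) (int m + k) / 4 ^ m"
proof (induction m arbitrary: k)
  case 0 show ?case by (auto simp: int_binomial_def binomial_eq_0)
next
  case (Suc m)
  have "int_binomial (2 * Suc m) (int (Suc m) + k)
    = int_binomial (2 * m) (int m + (k + 1)) + 2 * int_binomial (2 * m) (int m + k) + int_binomial (2 * m) (int m + (k - 1))"
    by (simp add: int_binomial_Suc algebra_simps)
  then show ?case by (simp add: Suc.IH field_simps)
qed

lemma bin_nonneg: "bin m k \<ge> 0"
  by (induction m arbitrary: k) auto

lemma central_binomial_le: "real (2 * m choose m) / 4 ^ m \<le> 1 / sqrt (real m + 1)"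
proof -
  let ?c = "\<lambda>m. real (2 * m choose m) / 4 ^ m"
  \<comment> \<open>In squared form the induction closes: the ratio of consecutive values is
    (2m+1)/(2m+2), and (2m+1)^2 (m+2) <= 4 (m+1)^3.\<close>
  have "(?c m)\<^sup>2 * (real m + 1) \<le> 1"
  proof (induction m)
    case (Suc m)
    have 1: "Suc m * (2 * Suc m choose Suc m) = Suc (2 * m + 1) * (2 * m + 1 choose m)"
      using Suc_times_binomial[of m "2 * m + 1"] by simp
    have 2: "Suc m * (2 * m + 1 choose m) = Suc (2 * m) * (2 * m choose m)"
      using Suc_times_binomial[of m "2 * m"] binomial_symmetric[of m "2 * m + 1"] by simp
    have "real (Suc m * (2 * Suc m choose Suc m)) = 2 * real (Suc m * (2 * m + 1 choose m))"
      unfolding 1 by simp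
    also have "\<dots> = 2 * (2 * real m + 1) * real (2 * m choose m)" unfolding 2 by (simp add: algebra_simps)
    finally have 3: "(real m + 1) * real (2 * Suc m choose Suc m) = 2 * (2 * real m + 1) * real (2 * m choose m)"
      by (simp only: of_nat_mult of_nat_Suc add.commute)
    have pos: "real m + 1 > 0" by simp
    have 4: "?c (Suc m) = ?c m * ((2 * real m + 1) / (2 * (real m + 1)))"
    proof -
      have gen: "(2 * P * B / Q) / (4 * E) = B / E * (P / (2 * Q))" for P B Q E :: real by simp
      have "real (2 * Suc m choose Suc m) = 2 * (2 * real m + 1) * real (2 * m choose m) / (real m + 1)"
        using 3 pos by (simp only: eq_divide_eq mult.commute) simp
      then show ?thesis unfolding power_Suc by (simp only: gen)
    qed
    have 5: "((2 * real m + 1) / (2 * (real m + 1)))\<^sup>2 * (real (Suc m) + 1) \<le> real m + 1"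
    proof -
      have "(2 * real m + 1)\<^sup>2 * (real m + 2) \<le> (real m + 1) * (2 * (real m + 1))\<^sup>2"
        by (simp add: power2_eq_square algebra_simps)
      then show ?thesis using pos by (simp add: power_divide divide_simps add.commute)
    qed
    have "(?c (Suc m))\<^sup>2 * (real (Suc m) + 1)
       = (?c m)\<^sup>2 * (((2 * real m + 1) / (2 * (real m + 1)))\<^sup>2 * (real (Suc m) + 1))"
      unfolding 4 power_mult_distrib by simp
    also have "\<dots> \<le> (?c m)\<^sup>2 * (real m + 1)" using 5 by (intro mult_left_mono) auto
    also have "\<dots> \<le> 1" by (rule Suc.IH)
    finally show ?case .
  qed simp
  then have "(?c m)\<^sup>2 \<le> 1 / (real m + 1)" by (simp add: field_simps)
  then have "?c m \<le> sqrt (1 / (real m + 1))" by (rule real_le_rsqrt)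
  then show ?thesis by (simp add: real_sqrt_divide)
qed

text \<open>Consecutive coefficients have ratio 1 - (2k+1)/(m+k+1), which is at most
  exp(-(2k+1)/(2m+1)) for k < m; the odd numbers add up to the square.\<close>

lemma binomial_decay:
  "real (2 * m choose (m + k)) \<le> real (2 * m choose m) * exp (- (real k)\<^sup>2 / (2 * real m + 1))"
proof (induction k)
  case (Suc k)
  show ?case
  proof (cases "k < m")
    case False
    then show ?thesis by (simp add: binomial_eq_0)
  next
    case True
    define b where "b = m - Suc k"
    have b: "Suc (m + k + b) = 2 * m" "real b = real m - real k - 1" using True by (auto simp: b_def)
    have "Suc (m + k) * (2 * m choose Suc (m + k)) = Suc b * (2 * m choose (m + k))"
      using Suc_times_binomial_add[of "m + k" b] unfolding b(1) .
    then have "real (Suc (m + k)) * real (2 * m choose Suc (m + k)) = real (Suc b) * real (2 * m choose (m + k))"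
      by (metis of_nat_mult)
    then have eq: "real (2 * m choose (m + Suc k)) = real (2 * m choose (m + k)) * ((real m - real k) / (real m + real k + 1))"
      using b(2) by (simp add: field_simps)
    have "(real m - real k) / (real m + real k + 1) = 1 + (- (2 * real k + 1) / (real m + real k + 1))"
      by (simp add: field_simps)
    also have "\<dots> \<le> exp (- (2 * real k + 1) / (real m + real k + 1))" by (rule exp_ge_add_one_self)
    also have "\<dots> \<le> exp (- (2 * real k + 1) / (2 * real m + 1))"
      using True by (simp add: divide_simps)
    finally have r: "(real m - real k) / (real m + real k + 1) \<le> exp (- (2 * real k + 1) / (2 * real m + 1))" .
    have "real (2 * m choose (m + Suc k))
       \<le> (real (2 * m choose m) * exp (- (real k)\<^sup>2 / (2 * real m + 1))) * exp (- (2 * real k + 1) / (2 * real m + 1))"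
      unfolding eq using Suc.IH r True by (intro mult_mono) auto
    also have "\<dots> = real (2 * m choose m) * exp (- (real (Suc k))\<^sup>2 / (2 * real m + 1))"

    proof -
      have "- (real k)\<^sup>2 / (2 * real m + 1) + - (2 * real k + 1) / (2 * real m + 1) = - (real (Suc k))\<^sup>2 / (2 * real m + 1)"
        unfolding add_divide_distrib[symmetric] by (simp add: power2_eq_square algebra_simps)
      then show ?thesis by (simp only: mult.assoc exp_add[symmetric])
    qed
    finally show ?thesis .
  qed
qed simp

lemma bin_le: "bin m k \<le> exp (- (real_of_int k)\<^sup>2 / (2 * real m + 1)) / sqrt (real m + 1)"
proof -
  have "int_binomial (2 * m) (int m + k) \<le> real (2 * m choose (m + nat \<bar>k\<bar>))"
  proof (cases "k \<ge> 0")
    case True then show ?thesis by (simp add: int_binomial_def nat_add_distrib)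
  next
    case False
    show ?thesis
    proof (cases "int m + k \<ge> 0")
      case True
      define j where "j = nat (int m + k)"
      have j: "j \<le> 2 * m" "2 * m - j = m + nat \<bar>k\<bar>" using True False by (auto simp: j_def)
      then show ?thesis using True binomial_symmetric[OF j(1)] by (simp add: int_binomial_def j_def)
    qed (simp add: int_binomial_def)
  qed
  also have "\<dots> \<le> real (2 * m choose m) * exp (- (real (nat \<bar>k\<bar>))\<^sup>2 / (2 * real m + 1))" by (rule binomial_decay)
  finally have "bin m k \<le> (real (2 * m choose m) / 4 ^ m) * exp (- (real_of_int k)\<^sup>2 / (2 * real m + 1))"
    by (simp add: bin_eq divide_right_mono)
  also have "\<dots> \<le> (1 / sqrt (real m + 1)) * exp (- (real_of_int k)\<^sup>2 / (2 * real m + 1))"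
    by (intro mult_right_mono central_binomial_le) auto
  finally show ?thesis by simp
qed

section \<open>Averaging over the coordinates in which the steps are made\<close>

abbreviation incr :: "('d \<Rightarrow> nat) \<Rightarrow> 'd \<Rightarrow> 'd \<Rightarrow> nat" where
  "incr M l \<equiv> M(l := Suc (M l))"

text \<open>Expectation under the multinomial law: \<open>h\<close> steps are assigned independently
  and uniformly to the coordinates, and \<open>M l\<close> counts those assigned to
  \<open>l\<close>.\<close>

primrec avg :: "nat \<Rightarrow> (('d::finite \<Rightarrow> nat) \<Rightarrow> real) \<Rightarrow> real" where
  "avg 0 F = F (\<lambda>_. 0)"
| "avg (Suc h) F = (\<Sum>l\<in>UNIV. avg h (\<lambda>M. F (incr M l))) / CARD('d)"

lemma avg_add: "avg h (\<lambda>M. F M + F' M) = avg h F + avg h F'"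
  by (induction h arbitrary: F F') (auto simp: sum.distrib add_divide_distrib)

lemma avg_cmult: "avg h (\<lambda>M. r * F M) = r * avg h F"
  by (induction h arbitrary: F) (auto simp: sum_distrib_left)

lemma avg_mono: "(\<And>M. (\<And>l. M l \<le> h) \<Longrightarrow> F M \<le> F' M) \<Longrightarrow> avg h F \<le> avg h F'"
proof (induction h arbitrary: F F')
  case (Suc h)
  have "avg h (\<lambda>M. F (incr M l)) \<le> avg h (\<lambda>M. F' (incr M l))" for l
    by (intro Suc) (auto simp: le_SucI)
  then show ?case by (auto intro!: divide_right_mono sum_mono)
qed auto

lemma avg_const: "avg h (\<lambda>_::'d::finite \<Rightarrow> nat. r) = r"
  by (induction h) auto

lemma incr_commute: "incr (incr M l) k = incr (incr M k) l"
  by (auto simp: fun_eq_iff)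

text \<open>Size biasing: \<open>M l\<close> is a sum over the \<open>Suc h\<close> steps, each
  falls on \<open>l\<close> with probability \<open>1 / CARD('d)\<close>, and the other
  \<open>h\<close> steps are then free.\<close>

lemma avg_size_bias:
  fixes l :: "'d::finite"
  shows "avg (Suc h) (\<lambda>M. real (M l) * F M) = real (Suc h) / CARD('d) * avg h (\<lambda>M. F (incr M l))"
proof (induction h arbitrary: F)
  case 0
  have "(\<Sum>k\<in>UNIV. real ((incr (\<lambda>_. 0) k) l) * F (incr (\<lambda>_. 0) k)) = (\<Sum>k\<in>UNIV. if k = l then F (incr (\<lambda>_. 0) l) else 0)"
    by (rule sum.cong) auto
  then show ?case unfolding avg.simps by (simp only:) simp
next
  case (Suc h)
  have "avg (Suc (Suc h)) (\<lambda>M. real (M l) * F M) = (\<Sum>k\<in>UNIV. avg (Suc h) (\<lambda>M. real ((incr M k) l) * F (incr M k))) / CARD('d)"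
    by (subst avg.simps(2)) simp
  also have "(\<Sum>k\<in>UNIV. avg (Suc h) (\<lambda>M. real ((incr M k) l) * F (incr M k)))
    = (\<Sum>k\<in>UNIV. avg (Suc h) (\<lambda>M. real (M l) * F (incr M k)) + (if k = l then avg (Suc h) (\<lambda>M. F (incr M l)) else 0))"
    by (rule sum.cong) (auto simp: distrib_right avg_add[symmetric] simp del: avg.simps(2) intro!: arg_cong[where f="avg (Suc h)"])
  also have "\<dots> = (\<Sum>k\<in>UNIV. real (Suc h) / CARD('d) * avg h (\<lambda>M. F (incr (incr M l) k))) + avg (Suc h) (\<lambda>M. F (incr M l))"
    by (simp only: sum.distrib Suc.IH) simp
  also have "\<dots> = real (Suc h) * avg (Suc h) (\<lambda>M. F (incr M l)) + avg (Suc h) (\<lambda>M. F (incr M l))"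
  proof -
    have "(\<lambda>M. F (incr (incr M l) k)) = (\<lambda>M. F (incr (incr M k) l))" for k
      by (intro ext arg_cong[where f=F] incr_commute)
    then show ?thesis unfolding avg.simps sum_distrib_left[symmetric] by (simp only:) simp
  qed
  also have "(real (Suc h) * avg (Suc h) (\<lambda>M. F (incr M l)) + avg (Suc h) (\<lambda>M. F (incr M l))) / CARD('d)
    = real (Suc (Suc h)) / CARD('d) * avg (Suc h) (\<lambda>M. F (incr M l))"
  proof -
    have "(r * X + X) / D = (1 + r) / D * X" for r X D :: real
      by (simp add: distrib_right add_divide_distrib)
    then show ?thesis unfolding of_nat_Suc[of "Suc h"] .
  qed
  finally show ?case .
qed

text \<open>Size biasing read backwards trades a factor \<open>1 / (real (M l) + 1)\<close> for
  \<open>CARD('d) / (real h + 1)\<close>, one coordinate at a time. Each trade raises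
  \<open>h\<close> by one, which only improves the bound.\<close>

lemma avg_prod_inverse:
  fixes A :: "'d::finite set"
  shows "avg h (\<lambda>M. \<Prod>l\<in>A. 1 / (real (M l) + 1)) \<le> (CARD('d) / (real h + 1)) ^ card A"
proof (induction A arbitrary: h rule: finite_induct[OF finite])
  case (2 l A)
  define F where "F M = (\<Prod>i\<in>A. 1 / (real (M i) + 1))" for M :: "'d \<Rightarrow> nat"
  have F: "F (incr M l) = F M" "F M \<ge> 0" for M
    using 2 by (auto simp: F_def intro!: prod.cong prod_nonneg)
  have "avg h (\<lambda>M. \<Prod>i\<in>insert l A. 1 / (real (M i) + 1)) = avg h (\<lambda>M. (\<lambda>M. F M / real (M l)) (incr M l))"
  proof (intro arg_cong[where f="avg h"] ext)
    fix M :: "'d \<Rightarrow> nat"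
    have "(\<Prod>i\<in>insert l A. 1 / (real (M i) + 1)) = F M / (real (M l) + 1)"
      using 2 by (simp add: F_def)
    then show "(\<Prod>i\<in>insert l A. 1 / (real (M i) + 1)) = F (incr M l) / real (incr M l l)"
      by (simp only: F(1)) (simp add: add.commute)
  qed
  also have "\<dots> = CARD('d) / (real h + 1) * (real (Suc h) / CARD('d) * avg h (\<lambda>M. (\<lambda>M. F M / real (M l)) (incr M l)))"
    by (simp add: add.commute)
  also have "\<dots> = CARD('d) / (real h + 1) * avg (Suc h) (\<lambda>M. real (M l) * (F M / real (M l)))"
    by (subst avg_size_bias) (rule refl)
  \<comment> \<open>The quotient cancels except where \<open>M l = 0\<close>; there the left side is
    0.\<close>
  also have "\<dots> \<le> CARD('d) / (real h + 1) * avg (Suc h) F"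
    using F by (intro mult_left_mono avg_mono) (auto simp del: avg.simps)
  also have "\<dots> \<le> CARD('d) / (real h + 1) * (CARD('d) / (real (Suc h) + 1)) ^ card A"
    unfolding F_def by (intro mult_left_mono 2) auto
  also have "\<dots> \<le> CARD('d) / (real h + 1) * (CARD('d) / (real h + 1)) ^ card A"
    by (intro mult_left_mono power_mono divide_left_mono) auto
  finally show ?case using 2 by simp
qed (simp add: avg_const)

section \<open>The horizontal walk\<close>

primrec hk :: "nat \<Rightarrow> int ^ 'd::finite \<Rightarrow> real" where
  "hk 0 x = (if x = 0 then 1 else 0)"
| "hk (Suc h) x = (\<Sum>l\<in>UNIV. hk h (x + axis l 1) + 2 * hk h x + hk h (x - axis l 1)) / (4 * CARD('d))"

lemma hk_nonneg: "hk h x \<ge> 0"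
  by (induction h arbitrary: x) (auto intro!: divide_nonneg_nonneg sum_nonneg add_nonneg_nonneg)

text \<open>Given how many steps fall on each coordinate, the coordinates perform independent lazy
  walks.\<close>

lemma hk_eq_avg: "hk h x = avg h (\<lambda>M. \<Prod>i\<in>UNIV. bin (M i) (x $ i))" for x :: "int ^ 'd::finite"
proof (induction h arbitrary: x)
  case 0
  show ?case by (auto simp: vec_eq_iff)
next
  case (Suc h)
  have *: "(\<Prod>i\<in>UNIV. bin (incr M l i) (x $ i)) =
     1 / 4 * ((\<Prod>i\<in>UNIV. bin (M i) ((x + axis l 1) $ i)) + 2 * (\<Prod>i\<in>UNIV. bin (M i) (x $ i)) + (\<Prod>i\<in>UNIV. bin (M i) ((x - axis l 1) $ i)))"
    for M and l :: 'd
  proof -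
    have r: "(\<Prod>i\<in>UNIV - {l}. bin (incr M l i) (x $ i)) = (\<Prod>i\<in>UNIV - {l}. bin (M i) (x $ i))"
      "(\<Prod>i\<in>UNIV - {l}. bin (M i) ((x + axis l 1) $ i)) = (\<Prod>i\<in>UNIV - {l}. bin (M i) (x $ i))"
      "(\<Prod>i\<in>UNIV - {l}. bin (M i) ((x - axis l 1) $ i)) = (\<Prod>i\<in>UNIV - {l}. bin (M i) (x $ i))"
      by (auto intro!: prod.cong simp: axis_def)
    show ?thesis
      unfolding prod.remove[OF finite UNIV_I[of l]] r by (simp add: axis_def algebra_simps)
  qed
  show ?case
    unfolding avg.simps hk.simps * avg_cmult avg_add Suc.IH[symmetric]
    by (simp add: sum_distrib_left[symmetric] sum_divide_distrib[symmetric])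
qed

lemma hk_le:
  fixes x :: "int ^ 'd::finite"
  shows "hk h x \<le> (real CARD('d) ^ CARD('d) + 1) / 2 * exp (- (real_of_int (x $ i))\<^sup>2 / (2 * real h + 1)) / sqrt (real h + 1) ^ CARD('d)"
proof -
  let ?d = "CARD('d)" let ?e = "exp (- (real_of_int (x $ i))\<^sup>2 / (2 * real h + 1))"
  define t where "t = sqrt (real h + 1) ^ ?d"
  have t: "t > 0" "t ^ 2 = (real h + 1) ^ ?d"
  proof -
    show "t ^ 2 = (real h + 1) ^ ?d" unfolding t_def power_mult[symmetric] mult.commute[of ?d]
      by (simp add: power_mult)
  qed (simp add: t_def)
  have "(\<Prod>l\<in>UNIV. bin (M l) (x $ l)) \<le> ?e * ((t * (\<Prod>l\<in>UNIV. 1 / (real (M l) + 1)) + 1 / t) / 2)"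
    if M: "\<And>l. M l \<le> h" for M
  proof -
    define u where "u = (\<Prod>l\<in>UNIV. 1 / sqrt (real (M l) + 1))"
    have u2: "u ^ 2 = (\<Prod>l\<in>UNIV. 1 / (real (M l) + 1))"
      by (simp add: u_def power_divide prod_power_distrib)
    have "bin (M l) (x $ l) \<le> (if l = i then ?e else 1) * (1 / sqrt (real (M l) + 1))" for l
    proof -
      have "exp (- (real_of_int (x $ l))\<^sup>2 / (2 * real (M l) + 1)) \<le> (if l = i then ?e else 1)" (is "?E \<le> ?k")
        using M[of i] by (auto intro!: divide_left_mono)
      then have "?E / sqrt (real (M l) + 1) \<le> ?k / sqrt (real (M l) + 1)" by (rule divide_right_mono) simp
      then show ?thesis using bin_le[of "M l" "x $ l"] by simp
    qed
    then have "(\<Prod>l\<in>UNIV. bin (M l) (x $ l)) \<le> (\<Prod>l\<in>UNIV. (if l = i then ?e else 1) * (1 / sqrt (real (M l) + 1)))"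
      by (intro prod_mono) (auto simp: bin_nonneg)
    also have "\<dots> = ?e * u" by (simp only: prod.distrib u_def prod.delta[OF finite]) simp
    \<comment> \<open>The mean of \<open>u\<close> is needed while only that of its square is
      available. This form of the AM-GM inequality linearizes the square root, and \<open>t\<close>,
      of order (h+1)^(d/2), balances the two terms.\<close>
    also have "u \<le> (t * u ^ 2 + 1 / t) / 2"
    proof -
      have "0 \<le> (u * t - 1) ^ 2" by simp
      then have "2 * u * t \<le> u ^ 2 * t ^ 2 + 1" by (simp add: power2_eq_square algebra_simps)
      then show ?thesis using t(1) by (simp add: field_simps power2_eq_square)
    qed
    finally show ?thesis unfolding u2 by (simp add: mult_left_mono)
  qed
  then have "hk h x \<le> avg h (\<lambda>M::'d \<Rightarrow> nat. ?e * ((t * (\<Prod>l\<in>UNIV. 1 / (real (M l) + 1)) + 1 / t) / 2))"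
    unfolding hk_eq_avg by (rule avg_mono)
  also have "\<dots> = ?e * ((t * avg h (\<lambda>M::'d \<Rightarrow> nat. \<Prod>l\<in>UNIV. 1 / (real (M l) + 1)) + 1 / t) / 2)"
    using avg_cmult[of h "?e / 2" "\<lambda>M::'d \<Rightarrow> nat. t * (\<Prod>l\<in>UNIV. 1 / (real (M l) + 1)) + 1 / t"]
    by (simp add: avg_add avg_cmult avg_const)
  also have "\<dots> \<le> ?e * ((t * (?d / (real h + 1)) ^ ?d + 1 / t) / 2)"
    using avg_prod_inverse[of h "UNIV :: 'd set"] t(1) by (intro mult_left_mono divide_right_mono add_right_mono) auto
  also have "\<dots> = (real ?d ^ ?d + 1) / 2 * ?e / t"
    using t by (simp add: power_divide flip: t(2)) (simp add: power2_eq_square field_simps)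
  finally show ?thesis by (simp add: t_def)
qed

lemma one_plus_power_le_exp:
  assumes "y \<ge> 0" "d > 0" shows "(1 + y) ^ d \<le> real d ^ d * exp y"
proof -
  have "1 + y \<le> real d * (1 + y / real d)" using assms by (simp add: field_simps)
  then have "(1 + y) ^ d \<le> (real d * (1 + y / real d)) ^ d" using assms by (intro power_mono) auto
  also have "\<dots> = real d ^ d * (1 + y / real d) ^ d" by (rule power_mult_distrib)
  also have "\<dots> \<le> real d ^ d * exp y"
    using assms by (intro mult_left_mono exp_ge_one_plus_x_over_n_power_n) auto
  finally show ?thesis .
qed

text \<open>Some coordinate carries at least the fraction 1/d of the norm, and its Gaussian factor
  outweighs the d-th power. One factor \<open>real ?d ^ ?d\<close> pays for passing to this
  coordinate, the other comes from \<open>one_plus_power_le_exp\<close>.\<close>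

lemma hk_norm_le:
  "\<exists>C\<ge>0. \<forall>h. \<forall>x :: int ^ 'd::finite. hk h x * sqrt (real h + 1) ^ CARD('d) \<le> C \<and>
     hk h x * norm (\<chi> i. real_of_int (x $ i)) ^ CARD('d) \<le> C"
proof -
  let ?d = "CARD('d)"
  define C where "C = (real ?d ^ ?d + 1) / 2"
  have C: "C \<ge> 0" by (simp add: C_def)
  have 1: "hk h x * sqrt (real h + 1) ^ ?d \<le> C * exp (- (real_of_int (x $ i))\<^sup>2 / (2 * real h + 1))" for h i and x :: "int ^ 'd"
    using hk_le[of h x i] by (simp add: C_def pos_le_divide_eq)
  have "hk h x * norm (\<chi> i. real_of_int (x $ i)) ^ ?d \<le> C * real ?d ^ ?d * real ?d ^ ?d" for h and x :: "int ^ 'd"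
  proof -
    define X where "X = norm (\<chi> i. real_of_int (x $ i))"
    have X1: "X \<le> (\<Sum>i\<in>UNIV. \<bar>real_of_int (x $ i)\<bar>)" unfolding X_def using norm_le_l1_cart[of "\<chi> i. real_of_int (x $ i)"] by simp
    have "\<exists>i. X \<le> real ?d * \<bar>real_of_int (x $ i)\<bar>"
    proof (rule ccontr)
      assume "\<not> ?thesis"
      then have "\<And>i. \<bar>real_of_int (x $ i)\<bar> < X / real ?d" by (simp add: not_le field_simps)
      then have "(\<Sum>i\<in>UNIV. \<bar>real_of_int (x $ i)\<bar>) < (\<Sum>i\<in>(UNIV :: 'd set). X / real ?d)"
        by (intro sum_strict_mono) auto
      then show False using X1 by simp
    qed
    then obtain i where i: "X \<le> real ?d * \<bar>real_of_int (x $ i)\<bar>" by blast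
    define y where "y = (real_of_int (x $ i))\<^sup>2 / (2 * real h + 1)"
    define r where "r = sqrt (real h + 1)"
    have r: "r > 0" by (simp add: r_def)
    have y: "y \<ge> 0" by (simp add: y_def)
    have "\<bar>real_of_int (x $ i)\<bar> \<le> r * (1 + y)"
    proof (rule power2_le_imp_le)
      have "(real_of_int (x $ i))\<^sup>2 = (2 * real h + 1) * y" by (simp add: y_def)
      also have "\<dots> \<le> (real h + 1) * (2 * y)" using y by (simp add: algebra_simps)
      also have "\<dots> \<le> (real h + 1) * (1 + y)\<^sup>2" by (intro mult_left_mono) (auto simp: power2_eq_square algebra_simps)
      finally show "\<bar>real_of_int (x $ i)\<bar>\<^sup>2 \<le> (r * (1 + y))\<^sup>2" by (simp add: r_def power_mult_distrib)
    qed (use r y in auto)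
    then have "X \<le> real ?d * (r * (1 + y))" using i by (meson mult_left_mono of_nat_0_le_iff order_trans)
    then have "X ^ ?d \<le> (real ?d * (r * (1 + y))) ^ ?d" by (intro power_mono) (auto simp: X_def)
    also have "\<dots> = real ?d ^ ?d * (r ^ ?d * (1 + y) ^ ?d)" by (simp add: power_mult_distrib)
    also have "\<dots> \<le> real ?d ^ ?d * (r ^ ?d * (real ?d ^ ?d * exp y))"
      using r by (intro mult_left_mono one_plus_power_le_exp y) auto
    finally have "hk h x * X ^ ?d \<le> hk h x * (real ?d ^ ?d * (r ^ ?d * (real ?d ^ ?d * exp y)))"
      using hk_nonneg by (intro mult_left_mono)
    also have "\<dots> = (hk h x * r ^ ?d) * (real ?d ^ ?d * (real ?d ^ ?d * exp y))" by (simp only: mult_ac)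
    also have "\<dots> \<le> (C * exp (- y)) * (real ?d ^ ?d * (real ?d ^ ?d * exp y))"
      using 1[of h x i] by (intro mult_right_mono) (auto simp: y_def r_def)
    also have "\<dots> = C * real ?d ^ ?d * real ?d ^ ?d * (exp (- y) * exp y)" by (simp only: mult_ac)
    finally show ?thesis by (simp add: X_def flip: exp_add)
  qed
  moreover have "hk h x * sqrt (real h + 1) ^ ?d \<le> C * 1" for h and x :: "int ^ 'd"
    by (rule order_trans[OF 1[of h x undefined]]) (intro mult_left_mono C, simp)
  moreover have "C * 1 \<le> C + C * real ?d ^ ?d * real ?d ^ ?d" "C * real ?d ^ ?d * real ?d ^ ?d \<le> C + C * real ?d ^ ?d * real ?d ^ ?d"
    using C by simp_all
  ultimately show ?thesis using C
    by (intro exI[of _ "C + C * real ?d ^ ?d * real ?d ^ ?d"]) (meson add_nonneg_nonneg mult_nonneg_nonneg of_nat_0_le_iff order_trans zero_le_power)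
qed

section \<open>The vertical walk, with the number of horizontal steps recorded\<close>

text \<open>The probability that a walk started at height \<open>n\<close> is at height 0 after
  \<open>N\<close> steps, exactly \<open>h\<close> of which were not vertical; upward, downward and
  other steps have weights \<open>a\<close>, 1 and \<open>\<kappa>\<close>. Lazy holding is counted
  among the other steps.\<close>

primrec rho :: "real \<Rightarrow> real \<Rightarrow> nat \<Rightarrow> int \<Rightarrow> nat \<Rightarrow> real" where
  "rho a \<kappa> 0 n h = (if n = 0 \<and> h = 0 then 1 else 0)"
| "rho a \<kappa> (Suc N) n h = (a * rho a \<kappa> N (n + 1) h + rho a \<kappa> N (n - 1) h +
      \<kappa> * (case h of 0 \<Rightarrow> 0 | Suc h' \<Rightarrow> rho a \<kappa> N n h')) / (a + 1 + \<kappa>)"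

definition rho_sum :: "real \<Rightarrow> real \<Rightarrow> (nat \<Rightarrow> real) \<Rightarrow> nat \<Rightarrow> int \<Rightarrow> real" where
  "rho_sum a \<kappa> \<phi> N n = (\<Sum>h\<le>N. rho a \<kappa> N n h * \<phi> h)"

lemma rho_nonneg: "a \<ge> 0 \<Longrightarrow> \<kappa> \<ge> 0 \<Longrightarrow> rho a \<kappa> N n h \<ge> 0"
  by (induction N arbitrary: n h) (auto split: nat.split)

lemma rho_zero: "h > N \<Longrightarrow> rho a \<kappa> N n h = 0"
  by (induction N arbitrary: n h) (auto split: nat.split)

lemma rho_sum_0: "rho_sum a \<kappa> \<phi> 0 n = (if n = 0 then \<phi> 0 else 0)"
  by (simp add: rho_sum_def)

lemma rho_sum_Suc:
  "rho_sum a \<kappa> \<phi> (Suc N) n = (a * rho_sum a \<kappa> \<phi> N (n + 1) + rho_sum a \<kappa> \<phi> N (n - 1) +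
     \<kappa> * rho_sum a \<kappa> (\<lambda>h. \<phi> (Suc h)) N n) / (a + 1 + \<kappa>)"
proof -
  have "(\<Sum>h\<le>Suc N. (case h of 0 \<Rightarrow> 0 | Suc h' \<Rightarrow> rho a \<kappa> N n h') * \<phi> h) = rho_sum a \<kappa> (\<lambda>h. \<phi> (Suc h)) N n"
    by (simp add: rho_sum_def sum.atMost_Suc_shift del: sum.atMost_Suc)
  moreover have "(\<Sum>h\<le>Suc N. rho a \<kappa> N m h * \<phi> h) = rho_sum a \<kappa> \<phi> N m" for m
    by (simp add: rho_sum_def rho_zero)
  moreover have "rho_sum a \<kappa> \<phi> (Suc N) n = (\<Sum>h\<le>Suc N. (a * (rho a \<kappa> N (n + 1) h * \<phi> h) + rho a \<kappa> N (n - 1) h * \<phi> h +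
     \<kappa> * ((case h of 0 \<Rightarrow> 0 | Suc h' \<Rightarrow> rho a \<kappa> N n h') * \<phi> h)) / (a + 1 + \<kappa>))"
    unfolding rho_sum_def rho.simps by (intro sum.cong refl) (simp add: algebra_simps)
  ultimately show ?thesis
    by (simp only: sum_divide_distrib[symmetric] sum.distrib sum_distrib_left[symmetric])
qed

lemma rho_sum_nonneg: "a \<ge> 0 \<Longrightarrow> \<kappa> \<ge> 0 \<Longrightarrow> (\<And>h. \<phi> h \<ge> 0) \<Longrightarrow> rho_sum a \<kappa> \<phi> N n \<ge> 0"
  unfolding rho_sum_def by (intro sum_nonneg mult_nonneg_nonneg rho_nonneg)

lemma rho_sum_mono: "a \<ge> 0 \<Longrightarrow> \<kappa> \<ge> 0 \<Longrightarrow> (\<And>h. \<phi> h \<le> \<psi> h) \<Longrightarrow> rho_sum a \<kappa> \<phi> N n \<le> rho_sum a \<kappa> \<psi> N n"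
  unfolding rho_sum_def by (intro sum_mono mult_left_mono rho_nonneg)

lemma rho_sum_add: "rho_sum a \<kappa> (\<lambda>h. \<phi> h + \<psi> h) N n = rho_sum a \<kappa> \<phi> N n + rho_sum a \<kappa> \<psi> N n"
  by (simp add: rho_sum_def sum.distrib distrib_left)

lemma rho_sum_cmult: "rho_sum a \<kappa> (\<lambda>h. r * \<phi> h) N n = r * rho_sum a \<kappa> \<phi> N n"
  by (simp add: rho_sum_def sum_distrib_left mult_ac)

text \<open>Comparison with a supersolution \<open>V\<close> by first-step decomposition. For
  \<open>\<zeta>\<close> below 1 the factor \<open>\<zeta> ^ h\<close> amounts to killing the walk
  at non-vertical steps with probability \<open>1 - \<zeta>\<close>.\<close>

lemma rho_sum_green_le:
  assumes a: "a \<ge> 0" "\<kappa> \<ge> 0" and V0: "\<And>n. V n \<ge> 0"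
    and V: "\<And>n. a * V (n + 1) + V (n - 1) + \<kappa> * \<zeta> * V n + (if n = 0 then a + 1 + \<kappa> else 0) \<le> (a + 1 + \<kappa>) * V n"
    and z: "\<zeta> \<ge> 0"
  shows "(\<Sum>N<M. rho_sum a \<kappa> (\<lambda>h. \<zeta> ^ h) N n) \<le> V n"
proof (induction M arbitrary: n)
  case 0 show ?case using V0 by simp
next
  case (Suc M)
  let ?s = "a + 1 + \<kappa>" let ?R = "\<lambda>M n. \<Sum>N<M. rho_sum a \<kappa> (\<lambda>h. \<zeta> ^ h) N n"
  have s: "?s > 0" using a by linarith
  have "rho_sum a \<kappa> (\<lambda>h. \<zeta> ^ h) (Suc N) n = (a * rho_sum a \<kappa> (\<lambda>h. \<zeta> ^ h) N (n + 1) + rho_sum a \<kappa> (\<lambda>h. \<zeta> ^ h) N (n - 1)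
      + \<kappa> * \<zeta> * rho_sum a \<kappa> (\<lambda>h. \<zeta> ^ h) N n) / ?s" for N
    by (simp add: rho_sum_Suc rho_sum_cmult mult.assoc)
  then have "?R (Suc M) n = (if n = 0 then 1 else 0) + (a * ?R M (n + 1) + ?R M (n - 1) + \<kappa> * \<zeta> * ?R M n) / ?s"
    by (simp only: sum.lessThan_Suc_shift rho_sum_0 sum_divide_distrib[symmetric] sum.distrib sum_distrib_left[symmetric] power_0)
  also have "\<dots> \<le> (if n = 0 then 1 else 0) + (a * V (n + 1) + V (n - 1) + \<kappa> * \<zeta> * V n) / ?s"
    using a z s by (intro add_left_mono divide_right_mono add_mono mult_left_mono Suc.IH) auto
  also have "\<dots> \<le> V n" using V[of n] s by (auto simp: field_simps split: if_splits)
  finally show ?case .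
qed

lemma rho_green_bounded:
  assumes a: "a > 1" and k: "\<kappa> \<ge> 0"
  shows "(\<Sum>N<M. rho_sum a \<kappa> (\<lambda>_. 1) N n) \<le> (a + 1 + \<kappa>) / (a - 1)"
proof -
  define C where "C = (a + 1 + \<kappa>) / (a - 1)"
  have C: "C > 0" "C * (a - 1) = a + 1 + \<kappa>" using a k by (auto simp: C_def)
  \<comment> \<open>Gambler's ruin: from above, height 0 is reached with probability
    \<open>(1 / a) ^ nat n\<close>; from below it is reached surely. The constant \<open>C\<close>
    is the expected number of visits from 0.\<close>
  define V where "V n = (if n \<le> 0 then C else C * (1 / a) ^ nat n)" for n :: int
  have "(\<Sum>N<M. rho_sum a \<kappa> (\<lambda>h. 1 ^ h) N n) \<le> V n"
  proof (rule rho_sum_green_le)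
    fix n :: int
    show "V n \<ge> 0" using C a by (auto simp: V_def)
    consider "n < 0" | "n = 0" | "n > 0" by linarith
    then show "a * V (n + 1) + V (n - 1) + \<kappa> * 1 * V n + (if n = 0 then a + 1 + \<kappa> else 0) \<le> (a + 1 + \<kappa>) * V n"
    proof cases
      case 1 then show ?thesis by (simp add: V_def algebra_simps)
    next
      case 2
      have "a * V 1 = C" "V 0 = C" "V (- 1) = C" using a by (auto simp: V_def)
      then show ?thesis using 2 C(2) by (simp add: algebra_simps)
    next
      case 3
      define m where "m = nat (n - 1)"
      have m: "nat n = Suc m" "nat (n + 1) = Suc (Suc m)" using 3 by (auto simp: m_def)
      have V: "V (n - 1) = C * (1 / a) ^ m" "V n = C * (1 / a) ^ m / a" "V (n + 1) = C * (1 / a) ^ m / a / a"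
      proof -
        have Vp: "V n = C * (1 / a) ^ nat n" if "n \<ge> 0" for n using that by (auto simp: V_def)
        show "V (n - 1) = C * (1 / a) ^ m" using Vp[of "n - 1"] 3 by (simp add: m_def)
        show "V n = C * (1 / a) ^ m / a" using Vp[of n] 3 by (simp add: m)
        show "V (n + 1) = C * (1 / a) ^ m / a / a" using Vp[of "n + 1"] 3 by (simp add: m)
      qed
      then show ?thesis using 3 a unfolding V by (simp add: field_simps)
    qed
  qed (use a k in auto)
  also have "V n \<le> C" using C a by (auto simp: V_def power_le_one mult_left_le)
  finally show ?thesis by (simp add: C_def)
qed

text \<open>With half of the non-vertical steps killed, covering a vertical distance |n| has
  exponentially small weight. This makes it costly to cover that distance with few horizontal
  steps.\<close>

lemma rho_green_decay:
  assumes a: "a > 1" and k: "\<kappa> \<ge> 2"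
  shows "\<exists>c>0. \<exists>C\<ge>0. \<forall>M n. (\<Sum>N<M. rho_sum a \<kappa> (\<lambda>h. (1 / 2) ^ h) N n) \<le> C * exp (- c * \<bar>real_of_int n\<bar>)"
proof -
  \<comment> \<open>For \<open>n > 0\<close> the supersolution condition needs \<open>exp c\<close>
    at most \<open>a\<close>, for \<open>n < 0\<close> it needs \<open>exp c\<close> at most
    \<open>1 + 1 / a\<close>.\<close>
  define c where "c = min (ln a) (ln (1 + 1 / a))"
  have c: "c > 0" using a by (auto simp: c_def intro!: ln_gt_zero)
  have ec: "exp c \<le> a" "exp c \<le> 1 + 1 / a"
    using a by (metis c_def exp_ln exp_le_cancel_iff min.cobounded1 less_trans zero_less_one)
      (metis c_def exp_ln exp_le_cancel_iff min.cobounded2 add_pos_pos divide_pos_pos less_trans a zero_less_one)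
  define e where "e = exp c"
  have e: "e > 1" "e \<le> a" "e \<le> 1 + 1 / a" using c ec by (auto simp: e_def)
  define C where "C = (a + 1 + \<kappa>) / (\<kappa> / 2)"
  have C: "C > 0" "C * (\<kappa> / 2) = a + 1 + \<kappa>" using a k by (auto simp: C_def)
  define V where "V n = C * (1 / e) ^ nat \<bar>n\<bar>" for n :: int
  have "(\<Sum>N<M. rho_sum a \<kappa> (\<lambda>h. (1 / 2) ^ h) N n) \<le> V n" for M n
  proof (rule rho_sum_green_le)
    fix n :: int
    show "V n \<ge> 0" using C e by (auto simp: V_def)
    consider "n < 0" | "n = 0" | "n > 0" by linarith
    then show "a * V (n + 1) + V (n - 1) + \<kappa> * (1 / 2) * V n + (if n = 0 then a + 1 + \<kappa> else 0) \<le> (a + 1 + \<kappa>) * V n"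
    proof cases
      case 1
      define m where "m = nat \<bar>n + 1\<bar>"
      have m: "nat \<bar>n\<bar> = Suc m" "nat \<bar>n - 1\<bar> = Suc (Suc m)" using 1 by (auto simp: m_def)
      define v where "v = C * (1 / e) ^ Suc m"
      have v: "v \<ge> 0" using C e by (auto simp: v_def)
      have V: "V n = v" "V (n + 1) = e * v" "V (n - 1) = v / e"
        using e by (auto simp: V_def v_def m m_def[symmetric])
      have "a * e \<le> a + 1" using e(3) a by (simp add: field_simps)
      moreover have "1 / e \<le> 1" using e by simp
      ultimately have "a * e + 1 / e + \<kappa> / 2 \<le> a + 1 + \<kappa>" using k by linarith
      then have "(a * e + 1 / e + \<kappa> / 2) * v \<le> (a + 1 + \<kappa>) * v" using v by (rule mult_right_mono)
      then show ?thesis using 1 unfolding V by (simp add: algebra_simps)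
    next
      case 2
      have "a * (1 / e) \<le> a" "1 / e \<le> 1" using e a by (auto simp: field_simps)
      then have "(a * (1 / e) + 1 / e + \<kappa> / 2) * C + C * (\<kappa> / 2) \<le> (a + 1 + \<kappa>) * C"
      proof -
        assume "a * (1 / e) \<le> a" "1 / e \<le> 1"
        then have "(a * (1 / e) + 1 / e + \<kappa> / 2 + \<kappa> / 2) * C \<le> (a + 1 + \<kappa>) * C" using C by (intro mult_right_mono) auto
        then show ?thesis by (simp add: algebra_simps)
      qed
      then show ?thesis using 2 unfolding C(2) by (simp add: V_def algebra_simps)
    next
      case 3
      define m where "m = nat \<bar>n - 1\<bar>"
      have m: "nat \<bar>n\<bar> = Suc m" "nat \<bar>n + 1\<bar> = Suc (Suc m)" using 3 by (auto simp: m_def)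
      define v where "v = C * (1 / e) ^ Suc m"
      have v: "v \<ge> 0" using C e by (auto simp: v_def)
      have V: "V n = v" "V (n - 1) = e * v" "V (n + 1) = v / e"
        using e by (auto simp: V_def v_def m m_def[symmetric])
      have "(e - 1) * (1 - a / e) \<le> 0" using e by (intro mult_nonneg_nonpos) (auto simp: field_simps)
      then have "a / e + e \<le> a + 1" using e by (simp add: field_simps)
      then have "a / e + e + \<kappa> / 2 \<le> a + 1 + \<kappa>" using k by linarith
      then have "(a / e + e + \<kappa> / 2) * v \<le> (a + 1 + \<kappa>) * v" using v by (rule mult_right_mono)
      then show ?thesis using 3 unfolding V by (simp add: algebra_simps)
    qed
  qed (use a k in auto)
  moreover have "V n = C * exp (- c * \<bar>real_of_int n\<bar>)" for n
  proof -
    have "(1 / e) ^ nat \<bar>n\<bar> = exp (- c) ^ nat \<bar>n\<bar>" by (simp add: e_def exp_minus field_simps)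
    also have "\<dots> = exp (real (nat \<bar>n\<bar>) * (- c))" by (rule exp_of_nat_mult[symmetric])
    finally show ?thesis by (simp add: V_def mult.commute)
  qed
  ultimately show ?thesis using c C by (metis less_imp_le)
qed

section \<open>The Green function of the lazy walk with drift\<close>

text \<open>The probability that the lazy network walk from \<open>z\<close> is at the origin after
  \<open>N\<close> steps. Of the weight \<open>4 * CARD('d)\<close>, half belongs to the horizontal
  neighbours and half to holding.\<close>

definition walk :: "real \<Rightarrow> nat \<Rightarrow> 'd::finite site \<Rightarrow> real" where
  "walk a N z = rho_sum a (4 * CARD('d)) (\<lambda>h. hk h (snd z)) N (fst z)"

lemma walk_0: "walk a 0 z = (if z = 0 then 1 else 0)"
  by (cases z) (auto simp: walk_def rho_sum_0 zero_prod_def)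

lemma walk_nonneg: "a \<ge> 0 \<Longrightarrow> walk a N z \<ge> 0"
  unfolding walk_def by (intro rho_sum_nonneg hk_nonneg) auto

lemma rho_sum_sum: "finite I \<Longrightarrow> rho_sum a \<kappa> (\<lambda>h. \<Sum>i\<in>I. \<phi> i h) N n = (\<Sum>i\<in>I. rho_sum a \<kappa> (\<phi> i) N n)"
  unfolding rho_sum_def by (subst sum.swap) (simp add: sum_distrib_left)

lemma walk_Suc:
  fixes x :: "int ^ 'd::finite"
  shows "walk a (Suc N) (n, x) = (a * walk a N (n + 1, x) + walk a N (n - 1, x) +
     (\<Sum>l\<in>UNIV. walk a N (n, x + axis l 1) + 2 * walk a N (n, x) + walk a N (n, x - axis l 1))) / (a + 1 + 4 * CARD('d))"
proof -
  have "real (4 * CARD('d)) * rho_sum a (4 * CARD('d)) (\<lambda>h. hk (Suc h) x) N n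
    = rho_sum a (4 * CARD('d)) (\<lambda>h. \<Sum>l\<in>UNIV. hk h (x + axis l 1) + 2 * hk h x + hk h (x - axis l 1)) N n"
    unfolding rho_sum_cmult[symmetric] by (rule arg_cong[where f="\<lambda>\<phi>. rho_sum a _ \<phi> N n"]) (simp add: fun_eq_iff)
  also have "\<dots> = (\<Sum>l\<in>UNIV. walk a N (n, x + axis l 1) + 2 * walk a N (n, x) + walk a N (n, x - axis l 1))"
    by (simp only: rho_sum_sum[OF finite] rho_sum_add rho_sum_cmult walk_def fst_conv snd_conv)
  finally show ?thesis unfolding walk_def rho_sum_Suc fst_conv snd_conv by simp
qed

lemma bracket_power_le:
  "eta_bracket z ^ d \<le> 1 + sqrt \<bar>real_of_int (fst z)\<bar> ^ d + norm (\<chi> i. real_of_int (snd z $ i)) ^ d"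
proof -
  have "eta_bracket z ^ d \<in> {1 ^ d, sqrt \<bar>real_of_int (fst z)\<bar> ^ d, norm (\<chi> i. real_of_int (snd z $ i)) ^ d}"
    unfolding eta_bracket_def eta_def max_def by auto
  then show ?thesis by (auto simp: add_nonneg_nonneg)
qed

text \<open>The d-th power of the bracket is bounded by 1 + |n|^(d/2) + |x|^d. The first and last
  terms are controlled by uniform bounds on \<open>hk\<close>. For the middle one, either the number
  h of horizontal steps is comparable to |n| and \<open>hk\<close> is of order |n|^(-d/2), or h is
  small and the vertical decay estimate pays.\<close>

lemma walk_sum_le:
  assumes a: "a > 1"
  shows "\<exists>C\<ge>0. \<forall>M. \<forall>z :: 'd::finite site. (\<Sum>N<M. walk a N z) \<le> C / eta_bracket z ^ CARD('d)"
proof -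
  let ?d = "CARD('d)" let ?k = "real (4 * CARD('d))"
  have k: "?k \<ge> 2" "?k \<ge> 0" using zero_less_card_finite[where 'a='d] by linarith+
  obtain C where C: "C \<ge> 0" "\<And>h (x :: int ^ 'd). hk h x * sqrt (real h + 1) ^ ?d \<le> C"
    "\<And>h (x :: int ^ 'd). hk h x * norm (\<chi> i. real_of_int (x $ i)) ^ ?d \<le> C"
    using hk_norm_le[where 'd='d] by blast
  obtain c Ce where c: "c > 0" and Ce: "Ce \<ge> 0"
    "\<And>M n. (\<Sum>N<M. rho_sum a ?k (\<lambda>h. (1 / 2) ^ h) N n) \<le> Ce * exp (- c * \<bar>real_of_int n\<bar>)"
    using rho_green_decay[OF a k(1)] by blast
  define C1 where "C1 = (a + 1 + ?k) / (a - 1)"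
  have C1: "(\<Sum>N<M. rho_sum a ?k (\<lambda>_. 1) N n) \<le> C1" for M n
    unfolding C1_def by (rule rho_green_bounded[OF a k(2)])
  have C1p: "C1 \<ge> 0" using a k by (simp add: C1_def)
  \<comment> \<open>Half of the decay rate is spent on dominating |n|^(d/2), the other half on
    compensating \<open>(1 / 2) ^ h\<close> when h is below e |n|.\<close>
  define e where "e = c / 2"
  have e: "e > 0" using c by (simp add: e_def)
  define K where "K = (max 1 (1 / e)) ^ ?d"
  define A where "A = K * real ?d ^ ?d"
  have A: "A \<ge> 0" by (simp add: A_def K_def)
  define B where "B = sqrt (1 / e) ^ ?d"
  have B: "B \<ge> 0" using e by (simp add: B_def)
  have ptw: "sqrt \<bar>real_of_int n\<bar> ^ ?d / sqrt (real h + 1) ^ ?d \<le> B + A * exp (c * \<bar>real_of_int n\<bar>) * (1 / 2) ^ h" for n h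
  proof -
    define m where "m = \<bar>real_of_int n\<bar>"
    have m: "m \<ge> 0" by (simp add: m_def)
    show ?thesis
    proof (cases "e * m \<le> real h + 1")
      case True
      then have "m / (real h + 1) \<le> 1 / e" using e by (simp add: field_simps)
      then have "(sqrt (m / (real h + 1))) ^ ?d \<le> B" unfolding B_def using m by (intro power_mono) auto
      moreover have "0 \<le> A * exp (c * m) * (1 / 2) ^ h" using A by simp
      ultimately show ?thesis by (simp add: m_def real_sqrt_divide power_divide)
    next
      case False
      have "sqrt m \<le> max 1 (1 / e) * (1 + e * m)"
      proof -
        have "sqrt m \<le> 1 + m" by (rule real_le_lsqrt) (use m in \<open>auto simp: power2_eq_square algebra_simps\<close>)
        also have "\<dots> = 1 * 1 + (1 / e) * (e * m)" using e by simp
        also have "\<dots> \<le> max 1 (1 / e) * 1 + max 1 (1 / e) * (e * m)"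
          using e m by (intro add_mono mult_right_mono) auto
        finally show ?thesis by (simp add: distrib_left)
      qed
      then have "sqrt m ^ ?d \<le> (max 1 (1 / e) * (1 + e * m)) ^ ?d" using m by (intro power_mono) auto
      also have "\<dots> = K * (1 + e * m) ^ ?d" by (simp add: power_mult_distrib K_def)
      also have "\<dots> \<le> K * (real ?d ^ ?d * exp (e * m))"
        using e m by (intro mult_left_mono one_plus_power_le_exp) (auto simp: K_def)
      finally have 1: "sqrt m ^ ?d \<le> A * exp (e * m)" by (simp add: A_def)
      have "(2::real) ^ h \<le> exp (real h)"
      proof -
        have "(2::real) ^ h \<le> exp 1 ^ h" using exp_ge_add_one_self[of 1] by (intro power_mono) auto
        then show ?thesis by (simp flip: exp_of_nat_mult)
      qed
      also have "\<dots> \<le> exp (e * m)" using False by simp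
      finally have "1 \<le> exp (e * m) * (1 / 2) ^ h" by (simp add: power_divide field_simps)
      then have 2: "A * exp (e * m) * 1 \<le> A * exp (e * m) * (exp (e * m) * (1 / 2) ^ h)"
        using A by (intro mult_left_mono) auto
      have "sqrt m ^ ?d / sqrt (real h + 1) ^ ?d \<le> sqrt m ^ ?d / 1"
        using m by (intro divide_left_mono) (auto simp: one_le_power)
      also have "\<dots> \<le> A * exp (e * m) * (exp (e * m) * (1 / 2) ^ h)" using 1 2 by simp
      also have "\<dots> = A * exp (c * m) * (1 / 2) ^ h"
      proof -
        have "exp (e * m) * exp (e * m) = exp (c * m)" by (simp add: e_def flip: exp_add)
        then show ?thesis by (simp only: mult.assoc flip: \<open>exp (e * m) * exp (e * m) = exp (c * m)\<close>)
      qed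
      finally show ?thesis using B by (simp add: m_def)
    qed
  qed
  have main: "(\<Sum>N<M. walk a N z) * eta_bracket z ^ ?d \<le> 2 * C * C1 + C * (B * C1 + A * Ce)" for M and z :: "'d site"
  proof -
    define n where "n = fst z" define x where "x = snd z"
    define s where "s = sqrt \<bar>real_of_int n\<bar> ^ ?d" define X where "X = norm (\<chi> i. real_of_int (x $ i)) ^ ?d"
    have sX: "s \<ge> 0" "X \<ge> 0" by (auto simp: s_def X_def)
    have hk: "hk h x * (1 + s + X) \<le> 2 * C * 1 + C * (B * 1 + A * exp (c * \<bar>real_of_int n\<bar>) * (1 / 2) ^ h)" for h
    proof -
      have q: "1 \<le> sqrt (real h + 1) ^ ?d" by (intro one_le_power) simp
      have "hk h x * 1 \<le> hk h x * sqrt (real h + 1) ^ ?d" using q hk_nonneg by (rule mult_left_mono)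
      then have 1: "hk h x \<le> C" using C(2)[of h x] by simp
      have "hk h x \<le> C / sqrt (real h + 1) ^ ?d" using C(2)[of h x] q by (simp add: pos_le_divide_eq)
      then have "hk h x * s \<le> C / sqrt (real h + 1) ^ ?d * s" using sX by (intro mult_right_mono)
      also have "\<dots> = C * (s / sqrt (real h + 1) ^ ?d)" by simp
      also have "\<dots> \<le> C * (B + A * exp (c * \<bar>real_of_int n\<bar>) * (1 / 2) ^ h)"
        using ptw[of n h] C(1) unfolding s_def by (rule mult_left_mono)
      finally have "hk h x * s \<le> C * (B + A * exp (c * \<bar>real_of_int n\<bar>) * (1 / 2) ^ h)" .
      then show ?thesis using 1 C(3)[of h x] by (simp add: distrib_left X_def)
    qed
    let ?S = "\<lambda>\<phi>. \<Sum>N<M. rho_sum a ?k \<phi> N n"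
    have S_lin: "?S (\<lambda>h. r * \<phi> h) = r * ?S \<phi>" "?S (\<lambda>h. \<phi> h + \<psi> h) = ?S \<phi> + ?S \<psi>" for r \<phi> \<psi>
      by (simp_all add: rho_sum_cmult rho_sum_add sum_distrib_left sum.distrib)
    have "(\<Sum>N<M. walk a N z) * eta_bracket z ^ ?d \<le> (\<Sum>N<M. walk a N z) * (1 + s + X)"
      using bracket_power_le[of z ?d] a by (intro mult_left_mono sum_nonneg walk_nonneg) (auto simp: s_def X_def n_def x_def)
    also have "\<dots> = ?S (\<lambda>h. (1 + s + X) * hk h x)"
      by (simp only: S_lin(1)) (simp add: walk_def n_def x_def mult.commute)
    also have "\<dots> \<le> ?S (\<lambda>h. (2 * C) * 1 + C * (B * 1 + A * exp (c * \<bar>real_of_int n\<bar>) * (1 / 2) ^ h))"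
      using hk a k by (intro sum_mono rho_sum_mono) (auto simp: mult.commute)
    also have "\<dots> = 2 * C * ?S (\<lambda>_. 1) + C * (B * ?S (\<lambda>_. 1) + A * exp (c * \<bar>real_of_int n\<bar>) * ?S (\<lambda>h. (1 / 2) ^ h))"
      by (simp only: S_lin)
    also have "\<dots> \<le> 2 * C * C1 + C * (B * C1 + A * exp (c * \<bar>real_of_int n\<bar>) * (Ce * exp (- c * \<bar>real_of_int n\<bar>)))"
      using C(1) A B by (intro add_mono mult_left_mono C1 Ce(2)) auto
    also have "A * exp (c * \<bar>real_of_int n\<bar>) * (Ce * exp (- c * \<bar>real_of_int n\<bar>)) = A * Ce * (exp (c * \<bar>real_of_int n\<bar>) * exp (- c * \<bar>real_of_int n\<bar>))"
      by (simp only: mult_ac)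
    also have "exp (c * \<bar>real_of_int n\<bar>) * exp (- c * \<bar>real_of_int n\<bar>) = 1" by (simp flip: exp_add)
    finally show ?thesis by simp
  qed
  have "eta_bracket z ^ ?d > 0" for z :: "'d site" by (simp add: eta_bracket_def)
  then have "(\<Sum>N<M. walk a N z) \<le> (2 * C * C1 + C * (B * C1 + A * Ce)) / eta_bracket z ^ ?d" for M and z :: "'d site"
    using main[where M=M and z=z] by (simp add: pos_le_divide_eq)
  then show ?thesis using C A B C1p Ce by (intro exI[of _ "2 * C * C1 + C * (B * C1 + A * Ce)"]) auto
qed

definition green :: "real \<Rightarrow> 'd::finite site \<Rightarrow> real" where
  "green a z = (\<Sum>N. walk a N z)"

lemma walk_summable: "a > 1 \<Longrightarrow> summable (\<lambda>N. walk a N (z :: 'd::finite site))"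
proof -
  assume a: "a > 1"
  obtain C where "\<And>M (z :: 'd site). (\<Sum>N<M. walk a N z) \<le> C / eta_bracket z ^ CARD('d)"
    using walk_sum_le[OF a, where 'd='d] by blast
  then show ?thesis by (intro summableI_nonneg_bounded[of _ "C / eta_bracket z ^ CARD('d)"] walk_nonneg) (use a in auto)
qed

lemma green_le:
  assumes a: "a > 1"
  shows "\<exists>C\<ge>0. \<forall>z :: 'd::finite site. green a z \<le> C / eta_bracket z ^ CARD('d)"
proof -
  obtain C where C: "C \<ge> 0" "\<And>M (z :: 'd site). (\<Sum>N<M. walk a N z) \<le> C / eta_bracket z ^ CARD('d)"
    using walk_sum_le[OF a, where 'd='d] by blast
  have "green a z \<le> C / eta_bracket z ^ CARD('d)" for z :: "'d site"
    unfolding green_def by (rule suminf_le_const[OF walk_summable[OF a] C(2)])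
  then show ?thesis using C(1) by blast
qed

lemma green_nonneg: "a > 1 \<Longrightarrow> green a z \<ge> 0"
  unfolding green_def by (intro suminf_nonneg walk_summable walk_nonneg) auto

lemma green_origin: "a > 1 \<Longrightarrow> green a (0 :: 'd::finite site) \<ge> 1"
proof -
  assume a: "a > 1"
  have "(\<Sum>N<1. walk a N (0 :: 'd site)) \<le> green a (0 :: 'd site)"
    unfolding green_def using a by (intro sum_le_suminf walk_summable walk_nonneg) auto
  then show "green a (0 :: 'd site) \<ge> 1" by (simp add: walk_0)
qed

text \<open>Holding contributes \<open>2 * CARD('d)\<close> times the value at the point to both
  sides and cancels, so the lazy Green function is superharmonic for the network without
  laziness.\<close>

lemma green_superharmonic:
  fixes x :: "int ^ 'd::finite"
  assumes a: "a > 1"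
  shows "a * green a (n + 1, x) + green a (n - 1, x) + (\<Sum>l\<in>UNIV. green a (n, x + axis l 1) + green a (n, x - axis l 1))
    \<le> (a + 1 + 2 * CARD('d)) * green a (n, x)"
proof -
  let ?s = "a + 1 + 4 * CARD('d)"
  have s: "?s > 0" using a by simp
  have sm: "(\<lambda>N. walk a N z) sums green a z" for z :: "'d site"
    unfolding green_def by (rule summable_sums[OF walk_summable[OF a]])
  have "(\<lambda>N. walk a (Suc N) (n, x)) sums ((a * green a (n + 1, x) + green a (n - 1, x) +
     (\<Sum>l\<in>UNIV. green a (n, x + axis l 1) + 2 * green a (n, x) + green a (n, x - axis l 1))) / ?s)"
    unfolding walk_Suc by (intro sums_divide sums_add sums_mult sums_sum sm)
  moreover have "(\<lambda>N. walk a (Suc N) (n, x)) sums (green a (n, x) - walk a 0 (n, x))"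
    using sums_split_initial_segment[OF sm[of "(n, x)"], of 1] by simp
  ultimately have "(a * green a (n + 1, x) + green a (n - 1, x) +
     (\<Sum>l\<in>UNIV. green a (n, x + axis l 1) + 2 * green a (n, x) + green a (n, x - axis l 1))) / ?s = green a (n, x) - walk a 0 (n, x)"
    by (rule sums_unique2)
  also have "\<dots> \<le> green a (n, x)" by (simp add: walk_0)
  finally have "a * green a (n + 1, x) + green a (n - 1, x) +
     (\<Sum>l\<in>UNIV. green a (n, x + axis l 1) + 2 * green a (n, x) + green a (n, x - axis l 1)) \<le> ?s * green a (n, x)"
    using s by (simp add: pos_divide_le_eq mult.commute)
  moreover have "(\<Sum>l\<in>(UNIV::'d set). green a (n, x + axis l 1) + 2 * green a (n, x) + green a (n, x - axis l 1))
    = (\<Sum>l\<in>UNIV. green a (n, x + axis l 1) + green a (n, x - axis l 1)) + 2 * CARD('d) * green a (n, x)"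
    by (simp add: sum.distrib algebra_simps)
  ultimately show ?thesis by (simp add: algebra_simps)
qed

section \<open>The lattice\<close>

definition lattice_nb :: "'d::finite site \<Rightarrow> 'd site set" where
  "lattice_nb z = {y. neighbours z y}"

definition lattice_cond :: "real \<Rightarrow> 'd::finite site \<Rightarrow> 'd site \<Rightarrow> real" where
  "lattice_cond lam z y = exp (lam * real_of_int (max (fst z) (fst y)))"

lemma sum_abs_eq_1:
  fixes a :: "'d::finite \<Rightarrow> int"
  assumes "(\<Sum>i\<in>UNIV. \<bar>a i\<bar>) = 1"
  shows "\<exists>l. \<bar>a l\<bar> = 1 \<and> (\<forall>i. i \<noteq> l \<longrightarrow> a i = 0)"
proof -
  obtain l where l: "a l \<noteq> 0" using assms by force
  have s: "\<bar>a l\<bar> + (\<Sum>i\<in>UNIV - {l}. \<bar>a i\<bar>) = 1" using assms by (simp add: sum.remove[of UNIV l])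
  have nn: "(\<Sum>i\<in>UNIV - {l}. \<bar>a i\<bar>) \<ge> 0" by (rule sum_nonneg) auto
  then have "\<bar>a l\<bar> = 1" "(\<Sum>i\<in>UNIV - {l}. \<bar>a i\<bar>) = 0" using s l by linarith+
  moreover from this(2) have "\<forall>i\<in>UNIV - {l}. \<bar>a i\<bar> = 0" by (subst (asm) sum_nonneg_eq_0_iff) auto
  ultimately show ?thesis by auto
qed

lemma sum_abs_axis: "(\<Sum>i\<in>UNIV. \<bar>(axis l 1 :: int ^ 'd::finite) $ i\<bar>) = 1"
proof -
  have "(\<Sum>i\<in>UNIV. \<bar>(axis l 1 :: int ^ 'd) $ i\<bar>) = (\<Sum>i\<in>UNIV. if i = l then 1 else 0)"
    by (rule sum.cong) (auto simp: axis_def)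
  then show ?thesis by simp
qed

lemma lattice_nb_eq:
  fixes x :: "int ^ 'd::finite"
  shows "lattice_nb (n, x) = {(n + 1, x), (n - 1, x)} \<union> ((\<lambda>l. (n, x + axis l 1)) ` UNIV \<union> (\<lambda>l. (n, x - axis l 1)) ` UNIV)"
proof (intro equalityI subsetI)
  fix y assume "y \<in> lattice_nb (n, x)"
  then have y: "\<bar>n - fst y\<bar> + (\<Sum>i\<in>UNIV. \<bar>x $ i - snd y $ i\<bar>) = 1" by (simp add: lattice_nb_def neighbours_def)
  have nn: "(\<Sum>i\<in>UNIV. \<bar>x $ i - snd y $ i\<bar>) \<ge> 0" by (rule sum_nonneg) auto
  consider "\<bar>n - fst y\<bar> = 1" "(\<Sum>i\<in>UNIV. \<bar>x $ i - snd y $ i\<bar>) = 0"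
    | "fst y = n" "(\<Sum>i\<in>UNIV. \<bar>x $ i - snd y $ i\<bar>) = 1" using y nn by linarith
  then show "y \<in> {(n + 1, x), (n - 1, x)} \<union> ((\<lambda>l. (n, x + axis l 1)) ` UNIV \<union> (\<lambda>l. (n, x - axis l 1)) ` UNIV)"
  proof cases
    case 1
    then have "\<forall>i. x $ i - snd y $ i = 0" by (subst (asm) sum_nonneg_eq_0_iff) auto
    then have "snd y = x" by (simp add: vec_eq_iff)
    then show ?thesis using 1(1) by (cases y) (auto simp: abs_if split: if_splits)
  next
    case 2
    then obtain l where l: "\<bar>x $ l - snd y $ l\<bar> = 1" "\<And>i. i \<noteq> l \<Longrightarrow> x $ i - snd y $ i = 0"
      using sum_abs_eq_1[of "\<lambda>i. x $ i - snd y $ i"] by blast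
    then have "snd y = x + axis l 1 \<or> snd y = x - axis l 1"
    proof -
      consider "snd y $ l = x $ l + 1" | "snd y $ l = x $ l - 1" using l(1) by linarith
      then show ?thesis
      proof cases
        case 1
        then have "snd y = x + axis l 1" using l(2) by (auto simp: vec_eq_iff axis_def)
        then show ?thesis ..
      next
        case 2
        then have "snd y = x - axis l 1" using l(2) by (auto simp: vec_eq_iff axis_def)
        then show ?thesis ..
      qed
    qed
    then show ?thesis using 2(1) by (cases y) auto
  qed
next
  fix y assume "y \<in> {(n + 1, x), (n - 1, x)} \<union> ((\<lambda>l. (n, x + axis l 1)) ` UNIV \<union> (\<lambda>l. (n, x - axis l 1)) ` UNIV)"
  then show "y \<in> lattice_nb (n, x)" using sum_abs_axis by (auto simp: lattice_nb_def neighbours_def)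
qed

lemma finite_lattice_nb: "finite (lattice_nb z)"
  by (cases z) (simp add: lattice_nb_eq)

lemma sum_lattice_nb:
  fixes x :: "int ^ 'd::finite" and F :: "'d site \<Rightarrow> real"
  shows "(\<Sum>y\<in>lattice_nb (n, x). F y) = F (n + 1, x) + F (n - 1, x) + (\<Sum>l\<in>UNIV. F (n, x + axis l 1) + F (n, x - axis l 1))"
proof -
  have ax: "axis l 1 \<noteq> - (axis k 1 :: int ^ 'd)" for l k
  proof
    assume "axis l 1 = - (axis k 1 :: int ^ 'd)"
    then have "(axis l 1 :: int ^ 'd) $ l = (- axis k 1) $ l" by simp
    then show False by (simp add: axis_def split: if_splits)
  qed
  have ax0: "(axis l 1 :: int ^ 'd) \<noteq> 0" for l by (simp add: axis_eq_0_iff)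
  have d: "(\<lambda>l. (n, x + axis l 1)) ` UNIV \<inter> (\<lambda>l. (n, x - axis l 1)) ` (UNIV :: 'd set) = {}"
    using ax by (auto simp: diff_conv_add_uminus simp del: add_uminus_conv_diff)
  have i1: "inj_on (\<lambda>l. (n, x + axis l 1)) (UNIV :: 'd set)" by (auto simp: inj_on_def axis_eq_axis)
  have i2: "inj_on (\<lambda>l. (n, x - axis l 1)) (UNIV :: 'd set)" by (auto simp: inj_on_def axis_eq_axis)
  have "(\<Sum>y\<in>lattice_nb (n, x). F y) = (\<Sum>y\<in>{(n + 1, x), (n - 1, x)}. F y) +
     (\<Sum>y\<in>(\<lambda>l. (n, x + axis l 1)) ` UNIV \<union> (\<lambda>l. (n, x - axis l 1)) ` UNIV. F y)"
    unfolding lattice_nb_eq by (rule sum.union_disjoint) (use ax0 in auto)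
  also have "(\<Sum>y\<in>(\<lambda>l. (n, x + axis l 1)) ` UNIV \<union> (\<lambda>l. (n, x - axis l 1)) ` UNIV. F y)
    = (\<Sum>l\<in>UNIV. F (n, x + axis l 1)) + (\<Sum>l\<in>UNIV. F (n, x - axis l 1))"
    by (subst sum.union_disjoint) (use d i1 i2 in \<open>auto simp: sum.reindex\<close>)
  finally show ?thesis by (simp add: sum.distrib)
qed

text \<open>All conductances at height \<open>n\<close> share the factor
  \<open>exp (lam * n)\<close>. After normalisation the walk is translation invariant, with upward
  weight \<open>exp lam\<close> against 1 for every other step.\<close>

lemma sum_lattice_cond:
  fixes x :: "int ^ 'd::finite"
  shows "(\<Sum>y\<in>lattice_nb (n, x). lattice_cond lam (n, x) y * F y) =
    exp (lam * n) * (exp lam * F (n + 1, x) + F (n - 1, x) + (\<Sum>l\<in>UNIV. F (n, x + axis l 1) + F (n, x - axis l 1)))"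
proof -
  have "lattice_cond lam (n, x) (n + 1, x) = exp (lam * n) * exp lam" by (simp add: lattice_cond_def max_def distrib_left exp_add)
  moreover have "lattice_cond lam (n, x) (n - 1, x) = exp (lam * n)" by (simp add: lattice_cond_def max_def)
  moreover have "lattice_cond lam (n, x) (n, y) = exp (lam * n)" for y by (simp add: lattice_cond_def)
  ultimately show ?thesis unfolding sum_lattice_nb by (simp add: distrib_left sum_distrib_left)
qed

lemma sum_lattice_cond_1:
  "(\<Sum>y\<in>lattice_nb (n, x). lattice_cond lam (n, x) y) = exp (lam * n) * (exp lam + 1 + 2 * CARD('d))"
  for x :: "int ^ 'd::finite"
  using sum_lattice_cond[where n=n and x=x and lam=lam and F="\<lambda>_. 1"] by (simp add: mult.commute)

lemma neighbours_sym: "neighbours z y \<longleftrightarrow> neighbours y z"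
  by (simp add: neighbours_def abs_minus_commute)

interpretation lattice: simple_network lattice_nb "lattice_network lam" "lattice_cond lam" for lam
proof
  show "(Upair x y \<in> Edges (lattice_network lam)) = (y \<in> lattice_nb x)" for x y :: "'a site"
  proof -
    have "Upair x y \<in> Edges (lattice_network lam) \<longleftrightarrow> (\<exists>z z'. Upair x y = Upair z z' \<and> neighbours z z')"
      by (simp add: lattice_network_def)
    then show ?thesis using neighbours_sym[of x y] by (auto simp only: Upair_inject lattice_nb_def mem_Collect_eq)
  qed
  show "Cond (lattice_network lam) (Upair x y) = lattice_cond lam x y" for x y :: "'a site"
    by (simp add: lattice_network_def lattice_cond_def conductance.rep_eq)
qed (auto simp: lattice_network_def lattice_cond_def finite_lattice_nb)

definition lattice_up :: "'d::finite site \<Rightarrow> 'd site" where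
  "lattice_up z = (fst z + 1, snd z)"

text \<open>The gambler's ruin bound for descending from \<open>v\<close> to the level of
  \<open>x\<close>. The exponential is harmonic for the network, and the minimum with the constant 1
  is superharmonic.\<close>

definition descend :: "real \<Rightarrow> 'd::finite site \<Rightarrow> 'd site \<Rightarrow> real" where
  "descend lam x v = min 1 (exp (- lam * real_of_int (fst v - fst x)))"

lemma drifted_lattice:
  assumes lam: "lam > 0"
  shows "drifted_network lattice_nb (lattice_cond lam) fst lattice_up (descend lam :: 'd::finite site \<Rightarrow> _)"
proof
  fix x v :: "'d site"
  show "lattice_up x \<in> lattice_nb x" by (cases x) (simp add: lattice_up_def lattice_nb_eq)
  show "fst v \<le> fst x \<Longrightarrow> descend lam x v = 1" using lam
    by (simp add: descend_def min_def mult_nonneg_nonpos)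
  show "descend lam x (lattice_up x) < 1" using lam by (simp add: descend_def lattice_up_def)
  let ?S = "\<Sum>y\<in>lattice_nb v. lattice_cond lam v y"
  let ?e = "\<lambda>y :: 'd site. exp (- lam * real_of_int (fst y - fst x))"
  have c: "lattice_cond lam v y \<ge> 0" for y by (simp add: lattice_cond_def)
  have "(\<Sum>y\<in>lattice_nb v. lattice_cond lam v y * descend lam x y) \<le> (\<Sum>y\<in>lattice_nb v. lattice_cond lam v y * 1)"
    using c by (intro sum_mono mult_left_mono) (auto simp: descend_def)
  moreover have "(\<Sum>y\<in>lattice_nb v. lattice_cond lam v y * descend lam x y) \<le> (\<Sum>y\<in>lattice_nb v. lattice_cond lam v y * ?e y)"
    using c by (intro sum_mono mult_left_mono) (auto simp: descend_def)
  moreover have "(\<Sum>y\<in>lattice_nb v. lattice_cond lam v y * ?e y) = ?S * ?e v"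
  proof -
    obtain n z where v: "v = (n, z)" by (cases v)
    define w where "w = ?e v"
    have "exp lam * ?e (n + 1, z) = w" "?e (n - 1, z) = exp lam * w" "?e (n, y) = w" for y
      unfolding w_def v by (simp_all add: algebra_simps flip: exp_add)
    then have "(\<Sum>y\<in>lattice_nb v. lattice_cond lam v y * ?e y) = exp (lam * n) * (w + exp lam * w + 2 * CARD('d) * w)"
      unfolding v sum_lattice_cond by simp
    then show ?thesis unfolding w_def[symmetric] by (simp add: v sum_lattice_cond_1 algebra_simps)
  qed
  ultimately show "(\<Sum>y\<in>lattice_nb v. lattice_cond lam v y * descend lam x y) \<le> ?S * descend lam x v"
    by (auto simp: descend_def[of lam x v] min_def)
qed (auto simp: lattice_cond_def lattice_up_def descend_def)

lemma lattice_hit: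
  fixes x r :: "'d::finite site"
  assumes lam: "lam > 0" and V: "finite V" "r \<notin> V"
  shows "mass lattice_nb (lattice_cond lam) V (\<lambda>f. leads f V x r) \<le> green (exp lam) (x - r) * Z lattice_nb (lattice_cond lam) V"
proof (rule lattice.hit_bound)
  have a: "exp lam > 1" using lam by simp
  fix v :: "'d site"
  obtain n z where v: "v = (n, z)" by (cases v)
  have *: "(n, z) - r = (n - fst r, z - snd r)" "(n + 1, z) - r = (n - fst r + 1, z - snd r)" "(n - 1, z) - r = (n - fst r - 1, z - snd r)"
    "(n, z + axis l 1) - r = (n - fst r, z - snd r + axis l 1)" "(n, z - axis l 1) - r = (n - fst r, z - snd r - axis l 1)" for l
    by (cases r; simp)+
  have "exp (lam * n) * (exp lam * green (exp lam) (n - fst r + 1, z - snd r) + green (exp lam) (n - fst r - 1, z - snd r)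
      + (\<Sum>l\<in>UNIV. green (exp lam) (n - fst r, z - snd r + axis l 1) + green (exp lam) (n - fst r, z - snd r - axis l 1)))
    \<le> exp (lam * n) * ((exp lam + 1 + 2 * CARD('d)) * green (exp lam) (n - fst r, z - snd r))"
    by (intro mult_left_mono green_superharmonic a) simp
  then show "(\<Sum>y\<in>lattice_nb v. lattice_cond lam v y * green (exp lam) (y - r)) \<le> (\<Sum>y\<in>lattice_nb v. lattice_cond lam v y) * green (exp lam) (v - r)"
    unfolding v sum_lattice_cond sum_lattice_cond_1 * by (simp add: mult.assoc)
  show "green (exp lam) (v - r) \<ge> 0" by (rule green_nonneg[OF a])
  show "green (exp lam) (r - r) \<ge> 1" using green_origin[OF a] by simp
qed (use V in \<open>auto simp: lattice_cond_def\<close>)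

lemma finite_volume_bound:
  assumes d: "CARD('d::finite) \<ge> 3" and lam: "lam > 0"
  shows "\<exists>K\<ge>0. \<forall>V (W :: 'd site set). finite V \<longrightarrow> finite W \<longrightarrow> 2 \<le> card W \<longrightarrow> card W \<le> L \<longrightarrow>
     mass lattice_nb (lattice_cond lam) V (\<lambda>f. \<exists>z\<in>V. \<forall>w\<in>W. (w, z) \<in> (steps f V)\<^sup>*)
       \<le> K / spread W ^ (CARD('d) - 2) * Z lattice_nb (lattice_cond lam) V"
proof -
  have a: "exp lam > 1" using lam by simp
  obtain Cg where Cg: "Cg \<ge> 0" "\<And>z :: 'd site. green (exp lam) z \<le> Cg / eta_bracket z ^ CARD('d)"
    using green_le[OF a] by blast
  obtain C2 where C2: "C2 \<ge> 0" "\<And>a b (V :: 'd site set). finite V \<Longrightarrow>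
      (\<Sum>z\<in>V. 1 / eta_bracket (a - z) ^ CARD('d) * (1 / eta_bracket (b - z) ^ CARD('d))) \<le> C2 / eta_bracket (a - b) ^ (CARD('d) - 2)"
    using two_point_sum[OF d] by blast
  \<comment> \<open>The value 0 at infinite and empty sets gives \<open>S_nonneg\<close> for all
    sets, also those where the minimum defining \<open>spread\<close> carries no
    information.\<close>
  define S where "S W = (if finite W \<and> W \<noteq> {} then 1 / spread W ^ (CARD('d) - 2) else 0)" for W :: "'d site set"
  interpret tree_kernel lattice_nb "lattice_cond lam" "\<lambda>x y :: 'd site. eta_bracket (x - y)" "CARD('d)" Cg C2 S
  proof
    fix x y z :: "'d site"
    show "eta_bracket (x - y) = eta_bracket (y - x)" by (rule bracket_minus_commute)
    show "eta_bracket (x - z) \<le> eta_bracket (x - y) + eta_bracket (y - z)" using bracket_triangle[of "x - y" "y - z"] by simp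
  next
    fix V :: "'d site set" and x r assume V: "finite V" "r \<notin> V"
    have "Z lattice_nb (lattice_cond lam) V \<ge> 0" by (rule lattice.mass_nonneg) (simp add: lattice_cond_def)
    then show "mass lattice_nb (lattice_cond lam) V (\<lambda>f. leads f V x r) \<le> Cg / eta_bracket (x - r) ^ CARD('d) * Z lattice_nb (lattice_cond lam) V"
      using lattice_hit[OF lam V, of x] Cg(2)[of "x - r"] by (meson mult_right_mono order_trans)
  next
    show "0 \<le> S W" for W
    proof (cases "finite W \<and> W \<noteq> {}")
      case True
      then have "spread W \<ge> 1" using spread_ge_1 by blast
      then show ?thesis by (simp add: S_def)
    next
      case False
      then have "S W = 0" unfolding S_def by (rule if_not_P)
      then show ?thesis by simp
    qed
  next
    fix W1 W2 :: "'d site set" and w1 w2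
    assume W: "finite W1" "finite W2" "W1 \<inter> W2 = {}" "w1 \<in> W1" "w2 \<in> W2"
    let ?p = "CARD('d) - 2"
    have ne: "W1 \<noteq> {}" "W2 \<noteq> {}" using W by auto
    have ge: "spread W1 \<ge> 1" "spread W2 \<ge> 1" "spread (W1 \<union> W2) \<ge> 1" using W ne by (auto intro!: spread_ge_1)
    have "spread (W1 \<union> W2) ^ ?p \<le> (spread W1 * spread W2 * eta_bracket (w1 - w2)) ^ ?p"
      using spread_union_le[OF W] ge by (intro power_mono) auto
    then have "1 / (spread W1 * spread W2 * eta_bracket (w1 - w2)) ^ ?p \<le> 1 / spread (W1 \<union> W2) ^ ?p"
      using ge bracket_ge_1[of "w1 - w2"] by (intro divide_left_mono) auto
    then show "S W1 * S W2 / eta_bracket (w1 - w2) ^ ?p \<le> S (W1 \<union> W2)"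
      using W ne by (simp add: S_def power_mult_distrib mult.assoc)
  qed (use d Cg C2 bracket_ge_1 in \<open>auto simp: lattice_cond_def S_def spread_singleton finite_lattice_nb\<close>)
  obtain K where "K \<ge> 0" and K: "\<And>V W. finite V \<Longrightarrow> finite W \<Longrightarrow> 2 \<le> card W \<Longrightarrow> card W \<le> L \<Longrightarrow>
     mass lattice_nb (lattice_cond lam) V (\<lambda>f. \<exists>z\<in>V. \<forall>w\<in>W. (w, z) \<in> (steps f V)\<^sup>*) \<le> K * S W * Z lattice_nb (lattice_cond lam) V"
    using common_descendant_bound[of L] by blast
  have "S W = 1 / spread W ^ (CARD('d) - 2)" if "finite W" "2 \<le> card W" for W using that by (auto simp: S_def)
  then show ?thesis using K \<open>K \<ge> 0\<close> by (intro exI[of _ K]) fastforce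
qed

section \<open>The uniform spanning forest of the lattice\<close>

text \<open>One concrete exhaustion is needed: if there were none, the condition under
  \<open>THE\<close> in \<open>wired_spanning_forest\<close> would be vacuous.\<close>

primrec graph_ball :: "nat \<Rightarrow> 'd::finite site set" where
  "graph_ball 0 = {0}"
| "graph_ball (Suc q) = graph_ball q \<union> (\<Union>z\<in>graph_ball q. lattice_nb z)"

lemma graph_ball_union: "(\<Union>q. graph_ball q) = (UNIV :: 'd::finite site set)"
proof -
  have step: "y \<in> (\<Union>q. graph_ball q)" if "z \<in> (\<Union>q. graph_ball q)" "y \<in> lattice_nb z" for y z :: "'d site"
    using that by (metis (no_types, lifting) UN_iff Un_iff graph_ball.simps(2) iso_tuple_UNIV_I)
  have "(n, x) \<in> (\<Union>q. graph_ball q)" for n and x :: "int ^ 'd"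
  proof (induction "nat (\<bar>n\<bar> + (\<Sum>i\<in>UNIV. \<bar>x $ i\<bar>))" arbitrary: n x rule: less_induct)
    case less
    have nn: "(\<Sum>i\<in>UNIV. \<bar>x $ i\<bar>) \<ge> 0" by (rule sum_nonneg) auto
    consider "n > 0" | "n < 0" | l where "x $ l > 0" | l where "x $ l < 0" | "n = 0" "\<And>l. x $ l = 0" by (metis linorder_neqE)
    then show ?case
    proof cases
      case 1
      then have "nat (\<bar>n - 1\<bar> + (\<Sum>i\<in>UNIV. \<bar>x $ i\<bar>)) < nat (\<bar>n\<bar> + (\<Sum>i\<in>UNIV. \<bar>x $ i\<bar>))" using nn by linarith
      then have "(n - 1, x) \<in> (\<Union>q. graph_ball q)" by (rule less)
      then show ?thesis by (rule step) (simp add: lattice_nb_eq)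
    next
      case 2
      then have "nat (\<bar>n + 1\<bar> + (\<Sum>i\<in>UNIV. \<bar>x $ i\<bar>)) < nat (\<bar>n\<bar> + (\<Sum>i\<in>UNIV. \<bar>x $ i\<bar>))" using nn by linarith
      then have "(n + 1, x) \<in> (\<Union>q. graph_ball q)" by (rule less)
      then show ?thesis by (rule step) (simp add: lattice_nb_eq)
    next
      case (3 l)
      have lt: "(\<Sum>i\<in>UNIV. \<bar>(x - axis l 1) $ i\<bar>) < (\<Sum>i\<in>UNIV. \<bar>x $ i\<bar>)"
        by (rule sum_strict_mono_ex1) (use 3 in \<open>auto simp: axis_def intro!: exI[of _ l]\<close>)
      moreover have "0 \<le> (\<Sum>i\<in>UNIV. \<bar>(x - axis l 1) $ i\<bar>)" by (rule sum_nonneg) auto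
      ultimately have "nat (\<bar>n\<bar> + (\<Sum>i\<in>UNIV. \<bar>(x - axis l 1) $ i\<bar>)) < nat (\<bar>n\<bar> + (\<Sum>i\<in>UNIV. \<bar>x $ i\<bar>))" by linarith
      then have "(n, x - axis l 1) \<in> (\<Union>q. graph_ball q)" by (rule less)
      then show ?thesis by (rule step) (auto simp: lattice_nb_eq intro!: image_eqI[of _ _ l])
    next
      case (4 l)
      have lt: "(\<Sum>i\<in>UNIV. \<bar>(x + axis l 1) $ i\<bar>) < (\<Sum>i\<in>UNIV. \<bar>x $ i\<bar>)"
        by (rule sum_strict_mono_ex1) (use 4 in \<open>auto simp: axis_def intro!: exI[of _ l]\<close>)
      moreover have "0 \<le> (\<Sum>i\<in>UNIV. \<bar>(x + axis l 1) $ i\<bar>)" by (rule sum_nonneg) auto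
      ultimately have "nat (\<bar>n\<bar> + (\<Sum>i\<in>UNIV. \<bar>(x + axis l 1) $ i\<bar>)) < nat (\<bar>n\<bar> + (\<Sum>i\<in>UNIV. \<bar>x $ i\<bar>))" by linarith
      then have "(n, x + axis l 1) \<in> (\<Union>q. graph_ball q)" by (rule less)
      then show ?thesis by (rule step) (auto simp: lattice_nb_eq intro!: image_eqI[of _ _ l])
    next
      case 5
      then have "(n, x) \<in> graph_ball 0" by (simp add: zero_prod_def vec_eq_iff)
      then show ?thesis by blast
    qed
  qed
  then show ?thesis by auto
qed

lemma lattice_exhaustion: "exhaustion (lattice_network lam) (graph_ball :: nat \<Rightarrow> 'd::finite site set)"
proof -
  let ?N = "lattice_network lam :: ('d site, 'd site uprod) network"
  let ?A = "\<lambda>q. adjacency (Ends ?N) (Edges (induced ?N (graph_ball q)))"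
  have fin: "finite (graph_ball q :: 'd site set)" for q
    by (induction q) (auto simp: finite_lattice_nb)
  have adj: "(x, y) \<in> ?A q \<longleftrightarrow> y \<in> lattice_nb x \<and> x \<in> graph_ball q \<and> y \<in> graph_ball q" for x y q
    by (auto simp: adjacency_def induced_def lattice.Ends_N lattice.edge_iff)
  have ne: "0 \<in> graph_ball q" for q by (induction q) auto
  have path: "(x, 0) \<in> (?A q)\<^sup>*" if "x \<in> graph_ball q" for x q
    using that
  proof (induction q arbitrary: x)
    case (Suc q)
    have mono: "(?A q)\<^sup>* \<subseteq> (?A (Suc q))\<^sup>*" by (intro rtrancl_mono subrelI) (unfold adj, auto)
    show ?case
    proof (cases "x \<in> graph_ball q")
      case True then show ?thesis using Suc.IH mono by blast
    next
      case False
      then obtain y where y: "y \<in> graph_ball q" "x \<in> lattice_nb y" using Suc.prems by auto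
      then have "y \<in> lattice_nb x" using neighbours_sym[of x y] by (simp add: lattice_nb_def)
      then have "(x, y) \<in> ?A (Suc q)" unfolding adj using y Suc.prems by simp
      moreover have "(y, 0) \<in> (?A (Suc q))\<^sup>*" using Suc.IH[OF y(1)] mono by blast
      ultimately show ?thesis by (rule converse_rtrancl_into_rtrancl)
    qed
  qed simp
  have "joins (Ends ?N) (Edges (induced ?N (graph_ball q))) (graph_ball q)" for q
    unfolding joins_def
  proof (intro ballI)
    fix x y :: "'d site" assume "x \<in> graph_ball q" "y \<in> graph_ball q"
    then have "(x, 0) \<in> (?A q)\<^sup>*" "(0, y) \<in> (?A q)\<^sup>*"
      using path[of x q] symD[OF sym_adjacency_rtrancl path[of y q]] by auto
    then show "(x, y) \<in> (?A q)\<^sup>*" by (rule rtrancl_trans)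
  qed
  moreover have "graph_ball q \<noteq> ({} :: 'd site set)" for q using ne by blast
  moreover have "(\<Union>q. graph_ball q) = Verts ?N" by (simp add: graph_ball_union lattice_network_def)
  ultimately show ?thesis unfolding exhaustion_def using fin by simp
qed

text \<open>Transfers limits along the net of finite sets to every exhaustion, with the same
  value.\<close>

lemma exhaustion_filterlim:
  assumes "exhaustion (lattice_network lam) V"
  shows "filterlim V (finite_subsets_at_top UNIV) sequentially"
  unfolding filterlim_finite_subsets_at_top
proof (intro allI impI)
  fix X :: "'a site set" assume X: "finite X \<and> X \<subseteq> UNIV"
  have V: "finite (V q)" "V q \<subseteq> V (Suc q)" for q using assms by (auto simp: exhaustion_def)
  have "(\<Union>q. V q) = UNIV" using assms by (simp add: exhaustion_def lattice_network_def)
  then obtain k where k: "\<And>x. x \<in> V (k x)" by (metis UNIV_I UN_iff)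
  have mono: "V i \<subseteq> V j" if "i \<le> j" for i j using V(2) that by (rule lift_Suc_mono_le)
  have "X \<subseteq> V q" if "q \<ge> Max (k ` X)" for q
  proof
    fix x assume "x \<in> X"
    then have "k x \<le> q" using that X by (meson Max_ge finite_imageI imageI order_trans)
    then show "x \<in> V q" using k mono by blast
  qed
  then show "\<forall>\<^sub>F q in sequentially. finite (V q) \<and> X \<subseteq> V q \<and> V q \<subseteq> UNIV"
    using V unfolding eventually_sequentially by blast
qed

lemma cylinder_converges:
  fixes J :: "'d::finite site uprod set"
  assumes lam: "lam > 0" and J: "finite J"
  shows "\<exists>l. ((\<lambda>V. measure (ust_measure (wired (lattice_network lam) V)) (cyl J \<eta>)) \<longlongrightarrow> l) (finite_subsets_at_top UNIV)"
proof -
  interpret drifted_network lattice_nb "lattice_cond lam" fst lattice_up "descend lam :: 'd site \<Rightarrow> _"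
    by (rule drifted_lattice[OF lam])
  define X where "X = (\<Union>e\<in>J. set_uprod e)"
  have X: "finite X" using J by (simp add: X_def)
  \<comment> \<open>An edge belongs to the tree exactly when it is the out-edge of one of its ends,
    so the cylinder depends only on the out-edges at the finitely many endpoints.\<close>
  define R where "R g \<longleftrightarrow> (\<forall>e\<in>J. (\<exists>v\<in>set_uprod e. e = Upair v (g v)) = \<eta> e)" for g
  obtain l where l: "((\<lambda>V. mass lattice_nb (lattice_cond lam) V (\<lambda>f. R (restrict f X)) / Z lattice_nb (lattice_cond lam) V) \<longlongrightarrow> l) (finite_subsets_at_top UNIV)"
    using local_event_converges[OF X] by blast
  have "eventually (\<lambda>V. mass lattice_nb (lattice_cond lam) V (\<lambda>f. R (restrict f X)) / Z lattice_nb (lattice_cond lam) V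
      = measure (ust_measure (wired (lattice_network lam) V)) (cyl J \<eta>)) (finite_subsets_at_top UNIV)"
    unfolding eventually_finite_subsets_at_top
  proof (intro exI[of _ X] conjI allI impI)
    fix V assume "finite V \<and> X \<subseteq> V \<and> V \<subseteq> (UNIV :: 'd site set)"
    then have V: "finite V" "X \<subseteq> V" by auto
    have "e \<in> tree_of f V \<longleftrightarrow> (\<exists>v\<in>set_uprod e. e = Upair v (restrict f X v))" if "e \<in> J" for e f
    proof -
      have sub: "set_uprod e \<subseteq> X" using that by (auto simp: X_def)
      show ?thesis
      proof
        assume "e \<in> tree_of f V"
        then obtain v where v: "e = Upair v (f v)" by (auto simp: tree_of_def)
        then have "v \<in> set_uprod e" by simp
        then show "\<exists>v\<in>set_uprod e. e = Upair v (restrict f X v)" using v sub by (intro bexI[of _ v]) auto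
      next
        assume "\<exists>v\<in>set_uprod e. e = Upair v (restrict f X v)"
        then obtain v where v: "v \<in> set_uprod e" "e = Upair v (restrict f X v)" by blast
        then have "v \<in> V" "e = Upair v (f v)" using sub V by auto
        then show "e \<in> tree_of f V" unfolding tree_of_def by blast
      qed
    qed
    then have "(\<lambda>e. e \<in> tree_of f V) \<in> cyl J \<eta> \<longleftrightarrow> R (restrict f X)" for f
      by (simp add: cyl_def R_def)
    then show "mass lattice_nb (lattice_cond lam) V (\<lambda>f. R (restrict f X)) / Z lattice_nb (lattice_cond lam) V
      = measure (ust_measure (wired (lattice_network lam) V)) (cyl J \<eta>)"
      using lattice.measure_ust[OF V(1) Z_pos[OF V(1)] borel_cyl[OF J]] by simp
  qed (use X in auto)
  with l show ?thesis by - (rule exI, erule (1) Lim_transform_eventually)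
qed

text \<open>The cylinder limits \<open>p\<close> do not depend on the exhaustion, so a measure
  constructed along \<open>V\<close> is a weak limit along all of them; uniqueness of the weak limit
  along \<open>V\<close> then determines the \<open>THE\<close> in the definition.\<close>

lemma USF_weak_limit:
  fixes V :: "nat \<Rightarrow> 'd::finite site set"
  assumes lam: "lam > 0" and V: "exhaustion (lattice_network lam) V"
  shows "weak_limit (\<lambda>q. ust_measure (wired (lattice_network lam) (V q))) (USF lam)"
proof -
  let ?mu = "\<lambda>V :: 'd site set. ust_measure (wired (lattice_network lam) V)"
  define p where "p J \<eta> = (SOME l. ((\<lambda>V. measure (?mu V) (cyl J \<eta>)) \<longlongrightarrow> l) (finite_subsets_at_top UNIV))" for J \<eta>
  have p: "((\<lambda>V. measure (?mu V) (cyl J \<eta>)) \<longlongrightarrow> p J \<eta>) (finite_subsets_at_top UNIV)" if "finite J" for J \<eta>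
    unfolding p_def by (rule someI_ex[OF cylinder_converges[OF lam that]])
  have pV: "(\<lambda>q. measure (?mu (V q)) (cyl J \<eta>)) \<longlonglongrightarrow> p J \<eta>"
    if "exhaustion (lattice_network lam) V" "finite J" for V J \<eta>
    by (rule filterlim_compose[OF p[OF that(2)] exhaustion_filterlim[OF that(1)]])
  have "\<exists>M. prob_space M \<and> sets M = sets borel \<and> (\<forall>J \<eta>. finite J \<longrightarrow> measure M (cyl J \<eta>) = p J \<eta>)"
    by (rule limit_measure_exists[OF lattice.prob_space_ust lattice.sets_ust]) (rule pV[OF V])
  then obtain M where M: "prob_space M" "sets M = sets borel" "\<And>J \<eta>. finite J \<Longrightarrow> measure M (cyl J \<eta>) = p J \<eta>"
    by blast
  have wl: "weak_limit (\<lambda>q. ?mu (V q)) M" if "exhaustion (lattice_network lam) V" for V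
    by (rule weak_limitI_cyl[OF M(1,2) lattice.prob_space_ust lattice.sets_ust]) (simp add: M(3) pV[OF that])
  have "USF lam = M"
    unfolding USF_def wired_spanning_forest_def
  proof (rule the_equality)
    show "\<forall>V. exhaustion (lattice_network lam) V \<longrightarrow> weak_limit (\<lambda>q. ?mu (V q)) M" using wl by blast
    fix M' assume "\<forall>V. exhaustion (lattice_network lam) V \<longrightarrow> weak_limit (\<lambda>q. ?mu (V q)) M'"
    then have "weak_limit (\<lambda>q. ?mu (V q)) M'" using V by blast
    then show "M' = M" using wl[OF V] by (rule weak_limit_unique)
  qed
  then show ?thesis using wl[OF V] by simp
qed

lemma joins_restrict_exhaustion:
  assumes V: "\<And>q. V q \<subseteq> V (Suc q)" "(\<Union>q. V q) = UNIV" and W: "finite W" and j: "joins (\<lambda>e. e) T W"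
  shows "\<exists>q. joins (\<lambda>e. e) {e \<in> T. set_uprod e \<subseteq> V q} W"
proof -
  let ?A = "\<lambda>q. adjacency (\<lambda>e. e) {e \<in> T. set_uprod e \<subseteq> V q}"
  have Vm: "V i \<subseteq> V j" if "i \<le> j" for i j using V(1) that by (rule lift_Suc_mono_le)
  have mono: "(?A i)\<^sup>* \<subseteq> (?A j)\<^sup>*" if "i \<le> j" for i j
    using Vm[OF that] by (intro rtrancl_mono adjacency_mono) auto
  have one: "\<exists>q. (x, y) \<in> (?A q)\<^sup>*" if "(x, y) \<in> (adjacency (\<lambda>e. e) T)\<^sup>*" for x y
    using that
  proof (induction rule: rtrancl_induct)
    case (step y z)
    then obtain q where q: "(x, y) \<in> (?A q)\<^sup>*" by blast
    obtain i j where "y \<in> V i" "z \<in> V j" using V(2) by blast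
    moreover have "V i \<subseteq> V (max q (max i j))" "V j \<subseteq> V (max q (max i j))" by (intro Vm; simp)+
    ultimately have yz: "y \<in> V (max q (max i j))" "z \<in> V (max q (max i j))" by blast+
    have "(y, z) \<in> ?A (max q (max i j))" using step(2) yz by (auto simp: adjacency_def)
    moreover have "(x, y) \<in> (?A (max q (max i j)))\<^sup>*" using q mono[of q "max q (max i j)"] by auto
    ultimately have "(x, z) \<in> (?A (max q (max i j)))\<^sup>*" by (rule rtrancl_into_rtrancl[rotated])
    then show ?case by blast
  qed blast
  then have "\<forall>p\<in>W \<times> W. \<exists>q. p \<in> (?A q)\<^sup>*" using j by (auto simp: joins_def)
  from bchoice[OF this] obtain k where k: "\<And>p. p \<in> W \<times> W \<Longrightarrow> p \<in> (?A (k p))\<^sup>*" by blast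
  define q where "q = Max (insert 0 (k ` (W \<times> W)))"
  have "p \<in> (?A q)\<^sup>*" if "p \<in> W \<times> W" for p
  proof -
    have "k p \<le> q" unfolding q_def using that W by (intro Max_ge) auto
    then show ?thesis using k[OF that] mono by blast
  qed
  then show ?thesis by (intro exI[of _ q]) (auto simp: joins_def)
qed

text \<open>Being joined within the finite edge set \<open>B\<close> is a finite union of cylinders,
  hence open and closed, and its probability converges. Once the vertex set contains
  \<open>W\<close> and all ends of edges in \<open>B\<close>, the finite-volume bound
  applies.\<close>

lemma local_joins_bound:
  fixes W :: "'d::finite site set" and V :: "nat \<Rightarrow> 'd site set"
  assumes lam: "lam > 0" and V: "exhaustion (lattice_network lam) V"
    and W: "finite W" "W \<noteq> {}" and B: "finite B"
    and K: "\<And>V. finite V \<Longrightarrow> mass lattice_nb (lattice_cond lam) V (\<lambda>f. \<exists>z\<in>V. \<forall>w\<in>W. (w, z) \<in> (steps f V)\<^sup>*) \<le> K * Z lattice_nb (lattice_cond lam) V"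
  shows "{\<omega>. joins (\<lambda>e. e) {e \<in> B. \<omega> e} W} \<in> sets borel"
    "measure (USF lam) {\<omega>. joins (\<lambda>e. e) {e \<in> B. \<omega> e} W} \<le> K"
proof -
  let ?C = "{\<omega>. joins (\<lambda>e. e) {e \<in> B. \<omega> e} W}"
  let ?mu = "\<lambda>q. ust_measure (wired (lattice_network lam) (V q))"
  define SS where "SS = {S \<in> Pow B. joins (\<lambda>e. e) S W}"
  have fS: "finite SS" using B by (simp add: SS_def)
  have C: "?C = (\<Union>S\<in>SS. cyl B (\<lambda>e. e \<in> S))"
  proof (intro equalityI subsetI)
    fix \<omega> assume "\<omega> \<in> ?C"
    then have "{e \<in> B. \<omega> e} \<in> SS" by (simp add: SS_def)
    moreover have "\<omega> \<in> cyl B (\<lambda>e. e \<in> {e \<in> B. \<omega> e})" by (simp add: cyl_def)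
    ultimately show "\<omega> \<in> (\<Union>S\<in>SS. cyl B (\<lambda>e. e \<in> S))" by blast
  next
    fix \<omega> assume "\<omega> \<in> (\<Union>S\<in>SS. cyl B (\<lambda>e. e \<in> S))"
    then obtain S where S: "S \<in> SS" "\<omega> \<in> cyl B (\<lambda>e. e \<in> S)" by blast
    then have "{e \<in> B. \<omega> e} = S" by (auto simp: cyl_def SS_def)
    then show "\<omega> \<in> ?C" using S(1) by (simp add: SS_def)
  qed
  show Cm: "?C \<in> sets borel" unfolding C using fS B by (intro sets.finite_UN) auto
  have "open ?C" unfolding C using B by (intro open_UN ballI open_cyl)
  moreover have "closed ?C" unfolding C using fS B by (intro closed_UN ballI closed_cyl)
  ultimately have cont: "continuous_on UNIV (indicator ?C :: _ \<Rightarrow> real)"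
    by (intro continuous_indicator_clopen)
  have wl: "weak_limit ?mu (USF lam)" by (rule USF_weak_limit[OF lam V])
  have int: "integral\<^sup>L M (indicator ?C :: _ \<Rightarrow> real) = measure M ?C" if "sets M = sets borel" for M
    using sets_eq_imp_space_eq[OF that] by simp
  have "bounded (range (indicator ?C :: _ \<Rightarrow> real))" by (rule boundedI[of _ 1]) (auto simp: indicator_def)
  then have "(\<lambda>q. integral\<^sup>L (?mu q) (indicator ?C :: _ \<Rightarrow> real)) \<longlonglongrightarrow> integral\<^sup>L (USF lam) (indicator ?C)"
    using wl cont unfolding weak_limit_def by blast
  then have lim: "(\<lambda>q. measure (?mu q) ?C) \<longlonglongrightarrow> measure (USF lam) ?C"
  proof -
    have "sets (USF lam :: ('d site uprod \<Rightarrow> bool) measure) = sets borel" using wl by (simp add: weak_limit_def)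
    with \<open>(\<lambda>q. integral\<^sup>L (?mu q) (indicator ?C :: _ \<Rightarrow> real)) \<longlonglongrightarrow> integral\<^sup>L (USF lam) (indicator ?C)\<close>
    show ?thesis by (simp only: int lattice.sets_ust)
  qed
  define X where "X = W \<union> (\<Union>e\<in>B. set_uprod e)"
  have X: "finite X" using W B by (simp add: X_def)
  have "eventually (\<lambda>q. finite (V q) \<and> X \<subseteq> V q \<and> V q \<subseteq> UNIV) sequentially"
    using exhaustion_filterlim[OF V] X unfolding filterlim_finite_subsets_at_top by blast
  then have "eventually (\<lambda>q. measure (?mu q) ?C \<le> K) sequentially"
  proof eventually_elim
    case (elim q)
    then have Vq: "finite (V q)" "W \<subseteq> V q" "\<And>e. e \<in> B \<Longrightarrow> set_uprod e \<subseteq> V q" by (auto simp: X_def)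
    have Zp: "Z lattice_nb (lattice_cond lam) (V q) > 0"
      by (rule drifted_network.Z_pos[OF drifted_lattice[OF lam] Vq(1)])
    have "mass lattice_nb (lattice_cond lam) (V q) (\<lambda>f. (\<lambda>e. e \<in> tree_of f (V q)) \<in> ?C)
      \<le> mass lattice_nb (lattice_cond lam) (V q) (\<lambda>f. \<exists>z\<in>V q. \<forall>w\<in>W. (w, z) \<in> (steps f (V q))\<^sup>*)"
      by (intro lattice.mass_mono Vq) (auto simp: lattice_cond_def intro!: lattice.same_component_common[OF _ W(2) Vq(2,3)])
    also have "\<dots> \<le> K * Z lattice_nb (lattice_cond lam) (V q)" by (rule K[OF Vq(1)])
    finally show ?case using lattice.measure_ust[OF Vq(1) Zp Cm] Zp by (simp add: pos_divide_le_eq)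
  qed
  then show "measure (USF lam) ?C \<le> K" by (intro tendsto_upperbound[OF lim]) auto
qed

theorem mainTheorem11:
  fixes lam :: real
  assumes "CARD('d::finite) \<ge> 3" and "lam > 0"
  shows "\<forall>L::nat. L > 0 \<longrightarrow>
    (\<exists>c>0. \<forall>W :: 'd site set. finite W \<and> 2 \<le> card W \<and> card W \<le> L \<longrightarrow>
       measure (USF lam) (same_component W) \<le> c * spread W powr (- (real CARD('d) - 2)))"
proof (intro allI impI)
  fix L :: nat
  obtain K where K0: "K \<ge> 0" and K: "\<And>V (W :: 'd site set). finite V \<Longrightarrow> finite W \<Longrightarrow> 2 \<le> card W \<Longrightarrow> card W \<le> L \<Longrightarrow>
     mass lattice_nb (lattice_cond lam) V (\<lambda>f. \<exists>z\<in>V. \<forall>w\<in>W. (w, z) \<in> (steps f V)\<^sup>*)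
       \<le> K / spread W ^ (CARD('d) - 2) * Z lattice_nb (lattice_cond lam) V"
    using finite_volume_bound[OF assms, of L] by blast
  \<comment> \<open>The constant is \<open>K + 1\<close> because \<open>K\<close> may be 0 and a
    positive constant is claimed.\<close>
  have "measure (USF lam) (same_component W) \<le> (K + 1) * spread W powr (- (real CARD('d) - 2))"
    if W: "finite W" "2 \<le> card W" "card W \<le> L" for W :: "'d site set"
  proof -
    let ?V = "graph_ball :: nat \<Rightarrow> 'd site set"
    have ne: "W \<noteq> {}" using W by auto
    have ex: "exhaustion (lattice_network lam) ?V" by (rule lattice_exhaustion)
    have V: "finite (?V q)" "?V q \<subseteq> ?V (Suc q)" for q using ex by (auto simp: exhaustion_def)
    \<comment> \<open>All pairs inside the ball, not only lattice edges, since
      \<open>same_component\<close> ranges over configurations on all pairs.\<close>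
    define B where "B q = {e. set_uprod e \<subseteq> ?V q}" for q
    have finB: "finite (B q)" for q
    proof (rule finite_subset)
      show "B q \<subseteq> (\<lambda>(x, y). Upair x y) ` (?V q \<times> ?V q)"
      proof
        fix e assume "e \<in> B q"
        then show "e \<in> (\<lambda>(x, y). Upair x y) ` (?V q \<times> ?V q)" by (cases e) (auto simp: B_def image_iff)
      qed
    qed (use V in auto)
    define C where "C q = {\<omega>. joins (\<lambda>e. e) {e \<in> B q. \<omega> e} W}" for q
    let ?b = "K / spread W ^ (CARD('d) - 2)"
    have Cm: "C q \<in> sets borel" and Cb: "measure (USF lam) (C q) \<le> ?b" for q
      unfolding C_def using local_joins_bound[OF assms(2) ex W(1) ne finB K[OF _ W]] by auto
    have P: "prob_space (USF lam :: ('d site uprod \<Rightarrow> bool) measure)" "sets (USF lam :: ('d site uprod \<Rightarrow> bool) measure) = sets borel"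
      using USF_weak_limit[OF assms(2) ex] by (auto simp: weak_limit_def)
    interpret prob_space "USF lam :: ('d site uprod \<Rightarrow> bool) measure" by (rule P)
    have inc: "incseq C"
    proof (rule incseq_SucI, rule subsetI)
      fix q \<omega> assume w: "\<omega> \<in> C q"
      have "{e \<in> B q. \<omega> e} \<subseteq> {e \<in> B (Suc q). \<omega> e}" using V(2)[of q] unfolding B_def by blast
      then have "(adjacency (\<lambda>e. e) {e \<in> B q. \<omega> e})\<^sup>* \<subseteq> (adjacency (\<lambda>e. e) {e \<in> B (Suc q). \<omega> e})\<^sup>*"
        by (intro rtrancl_mono adjacency_mono)
      then show "\<omega> \<in> C (Suc q)" using w unfolding C_def joins_def by blast
    qed
    have "same_component W \<subseteq> (\<Union>q. C q)"
    proof
      fix \<omega> assume "\<omega> \<in> same_component W"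
      then have "joins (\<lambda>e. e) {e. \<omega> e} W" by (simp add: same_component_def)
      from joins_restrict_exhaustion[of ?V, OF V(2) graph_ball_union W(1) this]
      show "\<omega> \<in> (\<Union>q. C q)" by (auto simp: C_def B_def conj_commute)
    qed
    then have "measure (USF lam) (same_component W) \<le> measure (USF lam) (\<Union>q. C q)"
      using Cm P(2) by (intro finite_measure_mono) auto
    \<comment> \<open>Continuity from below: the bound \<open>?b\<close> is the same for every
      \<open>q\<close>.\<close>
    also have "\<dots> \<le> ?b"
    proof (rule LIMSEQ_le_const2)
      show "(\<lambda>q. measure (USF lam) (C q)) \<longlonglongrightarrow> measure (USF lam) (\<Union>q. C q)"
        using Cm P(2) inc by (intro finite_Lim_measure_incseq) auto
    qed (use Cb in auto)
    also have "\<dots> \<le> (K + 1) * (1 / spread W ^ (CARD('d) - 2))"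
      using spread_ge_1[OF W(1) ne] by (simp add: divide_right_mono)
    also have "1 / spread W ^ (CARD('d) - 2) = spread W powr (- (real CARD('d) - 2))"
    proof -
      have "real CARD('d) - 2 = real (CARD('d) - 2)" using assms(1) by simp
      then show ?thesis using spread_ge_1[OF W(1) ne] by (simp only: powr_minus_divide powr_realpow)
    qed
    finally show ?thesis .
  qed
  then show "\<exists>c>0. \<forall>W :: 'd site set. finite W \<and> 2 \<le> card W \<and> card W \<le> L \<longrightarrow>
       measure (USF lam) (same_component W) \<le> c * spread W powr (- (real CARD('d) - 2))"
    using K0 by (intro exI[of _ "K + 1"]) auto
qed

end
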